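(* Let a seed of rank $3$ of affine type (i.e. realised in $\mathbb E^2$) be given by a triangle with angles $r_1\pi,r_2\pi,r_3\pi$, where $r_1,r_2,r_3\in\mathbb Q$, together with a quiver. Then there exists a lattice $L$ (a finitely generated free abelian group of translation vectors) such that the following hold: 1. The lattice $L$ acts (by translations of seeds) on the exchange graph of the seed, and the quotient of the group action is finite. 2. The rank of the lattice is $\operatorname{rk}_{\mathbb Z}(L)=\varphi(d)/2$ or $\operatorname{rk}_{\mathbb Z}(L)=\varphi(d)$, where $\varphi$ is Euler's totient function and $d$ is the least common denominator of $r_1,r_2,r_3$.
   Context: **Exchange matrices.** An exchange matrix is a real skew-symmetric $3\times3$ matrix $B=(b_{ij})$, identified with the quiver on $\{1,2,3\}$ having an arrow $i\to j$ of weight $b_{ij}$ whenever $b_{ij}>0$; $B$ is acyclic if this quiver has no oriented cycle, and cyclic otherwise. The mutation $\mu_k(B)=(b'_{ij})$ is given by $b'_{ij}=-b_{ij}$ if $k\in\{i,j\}$ and $b'_{ij}=b_{ij}+(b_{ik}|b_{kj}|+|b_{ik}|b_{kj})/2$ otherwise. Exchange matrices are assumed mutation-finite (only finitely many matrices are obtained by mutations) and mutation-equivalent to an acyclic one. **Seeds in $\mathbb E^2$.** Let $V$ be the $3$-dimensional space of affine functions $f(x)=\langle a,x\rangle+c$ on the Euclidean plane $\mathbb E^2$, with the degenerate form $(f,g)=\langle a,a'\rangle$ for $g(x)=\langle a',x\rangle+c'$. For non-constant $f\in V$ put $\Pi_f=\{x: f(x)<0\}$ and $l_f=\{x:f(x)=0\}$.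 A geometric realisation of $B$ is a basis $\mathbf v=(v_1,v_2,v_3)$ of $V$ with $(v_i,v_i)=2$, $|(v_i,v_j)|=|b_{ij}|$ for $i\neq j$, and such that, if all $(v_i,v_j)\ne0$, the number of pairs $i<j$ with $(v_i,v_j)>0$ is even if $B$ is acyclic and odd otherwise. A seed is a pair $(\mathbf v,B)$, up to simultaneous permutation of indices. It is called affine (of affine type) when realised in $\mathbb E^2$ in this way. It is represented by its domain $\Pi_{v_1}\cap\Pi_{v_2}\cap\Pi_{v_3}$, which is a triangle (or an infinite region bounded by two parallel half-lines and a segment), together with a quiver whose vertices are the sides; $|b_{ij}|=2\cos$ of the angle between the corresponding lines. **Positivity and mutation.** A reference point $u$ is either a point of $\mathbb E^2$ or an infinitely far point on a directed line $\ell$. A vector $v$ is positive if $u\in\Pi_v$ (for $u$ infinitely far on $\ell$: all points of $\ell$ sufficiently far in the given direction lie in $\Pi_v$), and negative if $-v$ is positive. The mutation is $\mu_k(\mathbf v,B)=(\mathbf v',\mu_k(B))$ with $v_k'=-v_k$ and, for $i\ne k$: if $v_k$ is positive, $v_i'=v_i$ when $b_{ik}>0$ and $v_i'=v_i-(v_i,v_k)v_k$ when $b_{ik}<0$; if $v_k$ is negative, $v_i'=v_i$ when $b_{ik}<0$ and $v_i'=v_i-(v_i,v_k)v_k$ when $b_{ik}>0$ (if $b_{ik}=0$ then $v_i'=v_i$). The exchange graph has as vertices all seeds obtained from the given one by sequences of mutations; edges join seeds related by one mutation. **Compatibility.** For $i\ne j$ with $|b_{ij}|<2$, regard $(v_i,v_j)$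 with the corresponding $2\times2$ submatrix as a rank $2$ seed, ordered so that $b_{ij}\ge0$, and write $b_{ij}=2\cos(\pi p/q)$ with $p,q\ge1$ coprime, $2p\le q$. Let $\tau$ swap the two indices and let $\mu_2$ be mutation at the second vector. $u$ is compatible with this rank $2$ subseed if the period of $(\tau\circ\mu_2)^m$, $m\ge0$, on the ordered rank $2$ seed equals $q+2p$. The reference point is always assumed to be compatible with all such rank $2$ subseeds of all seeds in the exchange graph. **Translations.** For $w\in\mathbb E^2$ (viewed as a vector), $w+(\mathbf v,B)$ is the seed whose domain is the translate by $w$ of the domain of $(\mathbf v,B)$, with the same quiver. A lattice here is a finitely generated free abelian group (not required to be discrete in the plane).
   Formalization: The formal theorem assumes that the domain of every seed of the exchange graph is a triangle or a region bounded by two parallel half-lines and a segment; without this the claim fails for a compatible finite reference point, e.g. one inside a triangle with angles π/3, π/3, π/3. *)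

theory Defs
  imports
    "HOL-Analysis.Analysis"
    "HOL-Combinatorics.Transposition"
    "HOL-Number_Theory.Totient"
begin

subsection \<open>Exchange matrices\<close>

definition exchange_matrix :: "real^'n^'n \<Rightarrow> bool" where
  "exchange_matrix B \<longleftrightarrow> transpose B = - B"

definition acyclic_matrix :: "real^'n^'n \<Rightarrow> bool" where
  "acyclic_matrix B \<longleftrightarrow> acyclic {(i, j). B $ i $ j > 0}"

definition mutate_matrix :: "'n \<Rightarrow> real^'n^'n \<Rightarrow> real^'n^'n" where
  "mutate_matrix k B = (\<chi> i j. if k \<in> {i, j} then - B $ i $ j
     else B $ i $ j + (B $ i $ k * \<bar>B $ k $ j\<bar> + \<bar>B $ i $ k\<bar> * B $ k $ j) / 2)"

inductive_set mutation_class :: "real^'n^'n \<Rightarrow> (real^'n^'n) set" for B where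
  base: "B \<in> mutation_class B"
| step: "B' \<in> mutation_class B \<Longrightarrow> mutate_matrix k B' \<in> mutation_class B"

definition mutation_finite :: "real^'n^'n \<Rightarrow> bool" where
  "mutation_finite B \<longleftrightarrow> finite (mutation_class B)"

definition mutation_acyclic :: "real^'n^'n \<Rightarrow> bool" where
  "mutation_acyclic B \<longleftrightarrow> (\<exists>B' \<in> mutation_class B. acyclic_matrix B')"


subsection \<open>Affine functions on the Euclidean plane\<close>

text \<open>The pair \<open>(a, c)\<close> stands for the affine function \<open>x \<mapsto> a \<bullet> x + c\<close>. The vector space
  structure of the product type is that of the space of affine functions. The form \<open>aff_form\<close> is
  not the inner product of the product type, which would also involve the constant terms.\<close>

type_synonym aff = "(real^2) \<times> real"

definition aff_val :: "aff \<Rightarrow> real^2 \<Rightarrow> real" where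
  "aff_val f x = fst f \<bullet> x + snd f"

definition aff_form :: "aff \<Rightarrow> aff \<Rightarrow> real" where
  "aff_form f g = fst f \<bullet> fst g"

definition half_plane :: "aff \<Rightarrow> (real^2) set" where
  "half_plane f = {x. aff_val f x < 0}"

definition aff_translate :: "real^2 \<Rightarrow> aff \<Rightarrow> aff" where
  "aff_translate w f = (fst f, snd f - fst f \<bullet> w)"

lemma aff_val_translate: "aff_val (aff_translate w f) x = aff_val f (x - w)"
  by (simp add: aff_val_def aff_translate_def inner_diff_right)

lemma half_plane_translate: "half_plane (aff_translate w f) = (+) w ` half_plane f"
proof (intro set_eqI iffI)
  fix x assume "x \<in> half_plane (aff_translate w f)"
  then have "x - w \<in> half_plane f" "x = w + (x - w)"
    by (simp_all add: half_plane_def aff_val_translate)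
  then show "x \<in> (+) w ` half_plane f" by blast
qed (auto simp: half_plane_def aff_val_translate)


subsection \<open>Seeds\<close>

text \<open>Labelled seeds of arbitrary rank: a tuple of affine functions together with a matrix.\<close>

type_synonym 'n seed = "(aff^'n) \<times> (real^'n^'n)"

definition geometric_realisation :: "aff^3 \<Rightarrow> real^3^3 \<Rightarrow> bool" where
  "geometric_realisation v B \<longleftrightarrow>
     inj (($) v) \<and> independent (range (($) v)) \<and> span (range (($) v)) = UNIV \<and>
     (\<forall>i. aff_form (v $ i) (v $ i) = 2) \<and>
     (\<forall>i j. i \<noteq> j \<longrightarrow> \<bar>aff_form (v $ i) (v $ j)\<bar> = \<bar>B $ i $ j\<bar>) \<and>
     ((\<forall>i j. i \<noteq> j \<longrightarrow> aff_form (v $ i) (v $ j) \<noteq> 0) \<longrightarrow>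
        (even (card {(i, j). i < j \<and> aff_form (v $ i) (v $ j) > 0}) \<longleftrightarrow> acyclic_matrix B))"

text \<open>For a permutation \<open>\<sigma>\<close>, \<open>relabel \<sigma>\<close> permutes the indices simultaneously; for an injection it
  extracts the subseed indexed by the range of \<open>\<sigma>\<close>.\<close>

definition relabel :: "(('m::finite) \<Rightarrow> ('n::finite)) \<Rightarrow> 'n seed \<Rightarrow> 'm seed" where
  "relabel \<sigma> s = ((\<chi> i. fst s $ \<sigma> i), (\<chi> i j. snd s $ \<sigma> i $ \<sigma> j))"

definition unlabelled :: "('n::finite) seed \<Rightarrow> 'n seed set" where
  "unlabelled s = {relabel \<sigma> s | \<sigma>. bij \<sigma>}"

definition seed_domain :: "('n::finite) seed \<Rightarrow> (real^2) set" where
  "seed_domain s = (\<Inter>i. half_plane (fst s $ i))"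

definition seed_translate :: "real^2 \<Rightarrow> ('n::finite) seed \<Rightarrow> 'n seed" where
  "seed_translate w s = ((\<chi> i. aff_translate w (fst s $ i)), snd s)"

lemma seed_domain_translate: "seed_domain (seed_translate w s) = (+) w ` seed_domain s"
  by (simp add: seed_domain_def seed_translate_def half_plane_translate image_INT[of _ UNIV])


subsection \<open>Shapes of domains\<close>

text \<open>All regions are open, like the half-planes.\<close>

definition vec_angle :: "real^2 \<Rightarrow> real^2 \<Rightarrow> real" where
  "vec_angle x y = arccos (x \<bullet> y / (norm x * norm y))"

definition is_triangle :: "(real^2) set \<Rightarrow> bool" where
  "is_triangle D \<longleftrightarrow> (\<exists>P Q R. \<not> collinear {P, Q, R} \<and> D = interior (convex hull {P, Q, R}))"

definition is_triangle_with_angles :: "(real^2) set \<Rightarrow> real \<Rightarrow> real \<Rightarrow> real \<Rightarrow> bool" where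
  "is_triangle_with_angles D \<alpha> \<beta> \<gamma> \<longleftrightarrow>
     (\<exists>P Q R. \<not> collinear {P, Q, R} \<and> D = interior (convex hull {P, Q, R}) \<and>
        vec_angle (Q - P) (R - P) = \<alpha> \<and>
        vec_angle (R - Q) (P - Q) = \<beta> \<and>
        vec_angle (P - R) (Q - R) = \<gamma>)"

text \<open>The region bounded by the segment from \<open>P\<close> to \<open>Q\<close> and the half-lines in direction \<open>e\<close>
  starting at \<open>P\<close> and \<open>Q\<close>.\<close>

definition is_half_strip :: "(real^2) set \<Rightarrow> bool" where
  "is_half_strip D \<longleftrightarrow>
     (\<exists>P Q e. \<not> collinear {P, Q, P + e} \<and>
        D = {P + s *\<^sub>R (Q - P) + t *\<^sub>R e | s t. 0 < s \<and> s < 1 \<and> 0 < t})"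


subsection \<open>Positivity and mutation\<close>

text \<open>\<open>Infinitely_far p e\<close> is the infinitely far point on the line through \<open>p\<close> directed by \<open>e\<close>.\<close>

datatype reference_point = Point "real^2" | Infinitely_far "real^2" "real^2"

fun valid_reference_point :: "reference_point \<Rightarrow> bool" where
  "valid_reference_point (Point p) \<longleftrightarrow> True"
| "valid_reference_point (Infinitely_far p e) \<longleftrightarrow> e \<noteq> 0"

fun positive :: "reference_point \<Rightarrow> aff \<Rightarrow> bool" where
  "positive (Point p) v \<longleftrightarrow> p \<in> half_plane v"
| "positive (Infinitely_far p e) v \<longleftrightarrow> (\<forall>\<^sub>F t in at_top. p + t *\<^sub>R e \<in> half_plane v)"

definition negative :: "reference_point \<Rightarrow> aff \<Rightarrow> bool" where
  "negative u v \<longleftrightarrow> positive u (- v)"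

text \<open>Only meaningful if the \<open>k\<close>-th vector is positive or negative, that is, if the seed satisfies
  the predicate \<open>mutable\<close>.\<close>

definition mutate :: "reference_point \<Rightarrow> ('n::finite) \<Rightarrow> 'n seed \<Rightarrow> 'n seed" where
  "mutate u k s = (let v = fst s; B = snd s in
     ((\<chi> i. if i = k then - v $ k
            else if (positive u (v $ k) \<and> B $ i $ k < 0) \<or> (negative u (v $ k) \<and> B $ i $ k > 0)
              then v $ i - aff_form (v $ i) (v $ k) *\<^sub>R v $ k
            else v $ i),
      mutate_matrix k B))"

definition mutable :: "reference_point \<Rightarrow> ('n::finite) seed \<Rightarrow> bool" where
  "mutable u s \<longleftrightarrow> (\<forall>k. positive u (fst s $ k) \<or> negative u (fst s $ k))"

inductive_set mutation_orbit :: "reference_point \<Rightarrow> ('n::finite) seed \<Rightarrow> 'n seed set" for u s where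
  base: "s \<in> mutation_orbit u s"
| step: "s' \<in> mutation_orbit u s \<Longrightarrow> mutate u k s' \<in> mutation_orbit u s"


subsection \<open>The exchange graph\<close>

definition exchange_vertices :: "reference_point \<Rightarrow> ('n::finite) seed \<Rightarrow> 'n seed set set" where
  "exchange_vertices u s = unlabelled ` mutation_orbit u s"

definition exchange_edges :: "reference_point \<Rightarrow> ('n::finite) seed \<Rightarrow> 'n seed set set set" where
  "exchange_edges u s =
     {{unlabelled s', unlabelled (mutate u k s')} | s' k. s' \<in> mutation_orbit u s}"


subsection \<open>Compatibility\<close>

definition has_period :: "('a \<Rightarrow> 'a) \<Rightarrow> 'a \<Rightarrow> nat \<Rightarrow> bool" where
  "has_period F x n \<longleftrightarrow> 0 < n \<and> (F ^^ n) x = x \<and> (\<forall>m. 0 < m \<and> m < n \<longrightarrow> (F ^^ m) x \<noteq> x)"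

definition compatible_rank2 :: "reference_point \<Rightarrow> 2 seed \<Rightarrow> bool" where
  "compatible_rank2 u s \<longleftrightarrow>
     (\<exists>p q :: nat. 1 \<le> p \<and> 1 \<le> q \<and> coprime p q \<and> 2 * p \<le> q \<and>
        snd s $ 1 $ 2 = 2 * cos (pi * real p / real q) \<and>
        has_period (relabel (Transposition.transpose 1 2) \<circ> mutate u 2) s (q + 2 * p))"

definition compatible :: "reference_point \<Rightarrow> 3 seed \<Rightarrow> bool" where
  "compatible u s \<longleftrightarrow>
     (\<forall>i j. i \<noteq> j \<and> 0 \<le> snd s $ i $ j \<and> snd s $ i $ j < 2 \<longrightarrow>
        compatible_rank2 u (relabel (\<lambda>k. if k = 1 then i else j) s))"


subsection \<open>Lattices of translations\<close>

text \<open>\<open>L\<close> has a finite basis of \<open>n\<close> elements over the integers.\<close>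

definition lattice_of_rank :: "(real^2) set \<Rightarrow> nat \<Rightarrow> bool" where
  "lattice_of_rank L n \<longleftrightarrow>
     (\<exists>S. finite S \<and> card S = n \<and>
        \<not> module.dependent (\<lambda>(m::int) x. of_int m *\<^sub>R x) S \<and>
        module.span (\<lambda>(m::int) x. of_int m *\<^sub>R x) S = L)"

definition acts_on_exchange_graph :: "(real^2) set \<Rightarrow> reference_point \<Rightarrow> ('n::finite) seed \<Rightarrow> bool" where
  "acts_on_exchange_graph L u s \<longleftrightarrow>
     (\<forall>w \<in> L.
        (\<forall>X \<in> exchange_vertices u s. seed_translate w ` X \<in> exchange_vertices u s) \<and>
        (\<forall>E \<in> exchange_edges u s. image (seed_translate w) ` E \<in> exchange_edges u s))"

definition vertex_orbits :: "(real^2) set \<Rightarrow> reference_point \<Rightarrow> ('n::finite) seed \<Rightarrow> 'n seed set set set" where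
  "vertex_orbits L u s = (\<lambda>X. {seed_translate w ` X | w. w \<in> L}) ` exchange_vertices u s"

definition edge_orbits ::
    "(real^2) set \<Rightarrow> reference_point \<Rightarrow> ('n::finite) seed \<Rightarrow> 'n seed set set set set" where
  "edge_orbits L u s = (\<lambda>E. {image (seed_translate w) ` E | w. w \<in> L}) ` exchange_edges u s"

definition least_common_denominator :: "rat set \<Rightarrow> nat" where
  "least_common_denominator A = (LEAST d. 0 < d \<and> (\<forall>r \<in> A. of_nat d * r \<in> \<int>))"

end

theory Submission
  imports Defs "HOL-Computational_Algebra.Polynomial"
begin

text \<open>The domains of the seeds are triangles and half-strips, and the product of the reflections in the
three sides, taken in a suitable order, is a glide reflection. Mutation does not change this glide
reflection, and its axis rules everything: all symmetries found below are translations along it.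

\<^bold>\<open>Normal form.\<close> The vectors of every seed in the orbit can be ordered as \<open>p\<close>, \<open>q\<close>, \<open>r\<close> so that
\<open>(p,q) \<le> 0\<close>, \<open>(q,r) \<le> 0\<close> and the matrix entries are the negated values of the form
(\<open>triple_seed\<close>). Let \<open>d\<close> be the common denominator, let \<open>x \<pi> / d\<close> be the angle between the
lines of \<open>p\<close> and \<open>q\<close> and \<open>y \<pi> / d\<close> the angle between the lines of \<open>q\<close> and \<open>r\<close>, both at most
a right angle. In coordinates adapted to the axis of the glide reflection the three vectors satisfy
the equations \<open>formatted\<close>, with a sign \<open>\<epsilon>\<close> telling the two sides of the axis apart. The sign and
the two numerators determine the seed up to a translation along the axis
(\<open>formatted_unique_translate\<close>).

\<^bold>\<open>Signs are forced.\<close> Mutation with the wrong sign would produce three normal vectors in an open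
half-plane, and then the domain would contain a whole cone, so that it is neither a triangle nor a
half-strip. Hence \<open>p\<close> is positive, \<open>r\<close> is negative, and \<open>q\<close> is positive if \<open>x > y\<close> and
negative if \<open>x < y\<close>. For \<open>x = y\<close> the sign of \<open>q\<close> may depend on the reference point, but then
the line of \<open>q\<close> is parallel to the axis, and translations along the axis fix \<open>q\<close>. In all cases
mutation commutes with those translations that map a seed of the orbit into the orbit
(\<open>mutate_shift\<close>); since mutation is an involution, a translation that does this for one seed does
it for all of them (\<open>translation_group_I\<close>). As there are only finitely many values of
\<open>(\<epsilon>, x, y)\<close>, the group of all these translations has finitely many orbits on the exchange graph. It
remains to find a lattice of finite index in it.

\<^bold>\<open>Lower bound.\<close> On the pairs \<open>(x, y)\<close> mutation acts by the steps of the subtractive Euclidean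
algorithm, by their inverses as long as the third angle is not acute, and by cyclic permutations of
the three angles when it is not obtuse. It follows that half-strips of angle \<open>t \<pi> / d\<close> occur for
every \<open>t < d / 2\<close> coprime to \<open>d\<close> (\<open>strip_coprime\<close>). Two successive mutations in the parallel
sides of such a half-strip translate it by \<open>sqrt 2 * \<Delta> / sin\<^sup>2 (t \<pi> / d)\<close>, where \<open>sqrt 2 * \<bar>\<Delta>\<bar>\<close> is the
length of the glide (\<open>translation_group_lower\<close>).

\<^bold>\<open>Upper bound.\<close> The points in which the lines of \<open>p\<close> and \<open>r\<close> cross the axis differ, in units of
\<open>\<Delta> / sqrt 2\<close>, by \<open>1 - cot (x \<pi> / d) * cot (y \<pi> / d)\<close>, and mutations keep at least one of the two
lines unless the domain is a half-strip, in which case the line that is lost may be replaced by a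
parallel one at a distance of \<open>1 / sin\<^sup>2 (t \<pi> / d)\<close> along the axis. Consequently all crossing points lie in one coset
of the group of integer combinations of the numbers \<open>cos (2 \<pi> m / d)\<close>, divided by \<open>d\<^sup>2\<close>
(\<open>orb_positions\<close>), and this group contains all translation lengths (\<open>translation_group_upper\<close>).

\<^bold>\<open>Comparison.\<close> It remains a statement on cyclotomic numbers: the \<open>\<phi>(d) / 2\<close> numbers
\<open>1 / sin\<^sup>2 (t \<pi> / d)\<close> are linearly independent over the integers (\<open>csc2_independent\<close>), and their
span has finite index in the group of the upper bound (\<open>csc2_span_finite_index\<close>). Both follow from one
observation. The Galois conjugates of these numbers form a square matrix whose entries are the same
numbers, arranged by multiplication in the units modulo sign; the single entry \<open>1 / sin\<^sup>2 (\<pi> / d)\<close> in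
each row exceeds the sum of the others (\<open>sum_csc2_dominated\<close>), so the matrix is diagonally dominant up
to a permutation. Thus the lattice of translations has rank \<open>\<phi>(d) / 2\<close>.\<close>

section \<open>Galois conjugation of sums of roots of unity\<close>

lemma prime_dvd_power_add:
  fixes a b :: "'a :: comm_ring_1"
  assumes "prime p"
  shows "of_nat p dvd (a + b) ^ p - a ^ p - b ^ p"
proof -
  have p: "p > 0" using assms prime_gt_0_nat by blast
  have "(a + b) ^ p = (\<Sum>k\<le>p. of_nat (p choose k) * a ^ k * b ^ (p - k))"
    by (rule binomial_ring)
  also have "{..p} = insert 0 (insert p {0<..<p})" using p by auto
  also have "(\<Sum>k\<in>\<dots>. of_nat (p choose k) * a ^ k * b ^ (p - k)) =
      b ^ p + (a ^ p + (\<Sum>k\<in>{0<..<p}. of_nat (p choose k) * a ^ k * b ^ (p - k)))"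
    using p by (subst sum.insert; simp)
  finally have "(a + b) ^ p - a ^ p - b ^ p = (\<Sum>k\<in>{0<..<p}. of_nat (p choose k) * a ^ k * b ^ (p - k))"
    by simp
  also have "of_nat p dvd \<dots>"
  proof (rule dvd_sum)
    fix k assume "k \<in> {0<..<p}"
    then have "p dvd p choose k"
      using assms by (intro dvd_choose_prime) auto
    then have "(of_nat p :: 'a) dvd of_nat (p choose k)" by (metis dvdE dvd_triv_left of_nat_mult)
    then show "of_nat p dvd of_nat (p choose k) * a ^ k * b ^ (p - k)" by (simp add: mult.assoc)
  qed
  finally show ?thesis .
qed

lemma prime_dvd_power_minus_self:
  fixes a :: int
  assumes "prime p"
  shows "int p dvd a ^ p - a"
proof (induction a rule: int_induct[where k = 0])
  case base
  then show ?case using assms prime_gt_0_nat by (simp add: power_0_left)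
next
  case (step1 i)
  show ?case
    using dvd_add[OF prime_dvd_power_add[OF assms, of i 1] step1(2)] by (simp add: algebra_simps)
next
  case (step2 i)
  show ?case
    using dvd_diff[OF step2(2) prime_dvd_power_add[OF assms, of "i - 1" 1]] by (simp add: algebra_simps)
qed

text \<open>The Frobenius congruence \<open>f(X)\<^sup>p \<equiv> f(X\<^sup>p)\<close> modulo \<open>p\<close> for integer polynomials. It is the arithmetic
input of Landau's proof that cyclotomic polynomials are irreducible, which is used here in the form that
vanishing at a root of unity is inherited by its conjugates.\<close>

lemma prime_dvd_poly_power_minus_pcompose:
  fixes f :: "int poly"
  assumes p: "prime p"
  shows "of_nat p dvd f ^ p - pcompose f (monom 1 p)"
proof (induction f)
  case 0
  then show ?case using prime_gt_0_nat[OF p] by (simp add: power_0_left)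
next
  case (pCons a g)
  have 1: "pCons a g = [:a:] + monom 1 1 * g"
    by (simp add: monom_altdef)
  have 2: "pcompose (pCons a g) (monom 1 p) = [:a:] + monom 1 p * pcompose g (monom 1 p)"
    by (simp add: pcompose_pCons)
  have 3: "pCons a g ^ p - pcompose (pCons a g) (monom 1 p) =
      (([:a:] + monom 1 1 * g) ^ p - [:a:] ^ p - (monom 1 1 * g) ^ p)
      + ([:a:] ^ p - [:a:]) + monom 1 p * (g ^ p - pcompose g (monom 1 p))"
    unfolding 2 unfolding 1 by (simp add: algebra_simps power_mult_distrib monom_power)
  have "[:a:] ^ p - [:a:] = [:a ^ p - a:]" by (simp add: poly_const_pow)
  moreover have "of_nat p dvd [:a ^ p - a:]"
  proof -
    obtain k where "a ^ p - a = int p * k" using prime_dvd_power_minus_self[OF p, of a] by (auto elim: dvdE)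
    then have "[:a ^ p - a:] = of_nat p * [:k:]" by (simp add: of_nat_poly)
    then show ?thesis by (rule dvdI)
  qed
  ultimately show ?case unfolding 3
    by (intro dvd_add dvd_mult prime_dvd_power_add[OF p] pCons) simp
qed

text \<open>Extend \<open>\<alpha>\<close> to a basis of the complex numbers over the rationals and read off its coordinate.\<close>

lemma additive_rational_functional:
  fixes \<alpha> :: complex
  assumes "\<alpha> \<noteq> 0"
  shows "\<exists>\<phi> :: complex \<Rightarrow> rat. (\<forall>x y. \<phi> (x + y) = \<phi> x + \<phi> y) \<and> \<phi> \<alpha> = 1"
proof -
  interpret V: vector_space "\<lambda>(q::rat) (z::complex). of_rat q * z"
    by unfold_locales (simp_all add: algebra_simps of_rat_add of_rat_mult)
  have ind: "V.independent {\<alpha>}" using assms by simp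
  define B where "B = V.extend_basis {\<alpha>}"
  have B: "V.independent B" "V.span B = UNIV" "\<alpha> \<in> B"
    using V.independent_extend_basis[OF ind] V.span_extend_basis[OF ind] V.extend_basis_superset[OF ind]
    by (auto simp: B_def)
  show ?thesis
  proof (intro exI[of _ "\<lambda>v. V.representation B v \<alpha>"] conjI allI)
    show "V.representation B (x + y) \<alpha> = V.representation B x \<alpha> + V.representation B y \<alpha>" for x y
      using B by (subst V.representation_add) auto
    show "V.representation B \<alpha> \<alpha> = 1"
      using B by (simp add: V.representation_basis)
  qed
qed

lemma additive_of_int_mult:
  fixes \<phi> :: "complex \<Rightarrow> rat"
  assumes add: "\<And>x y. \<phi> (x + y) = \<phi> x + \<phi> y"
  shows "\<phi> (of_int c * x) = of_int c * \<phi> x"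
proof -
  have 0: "\<phi> 0 = 0" using add[of 0 0] by simp
  have neg: "\<phi> (- x) = - \<phi> x" for x using add[of x "-x"] 0 by simp
  have nat: "\<phi> (of_nat n * x) = of_nat n * \<phi> x" for n x
    by (induction n) (simp_all add: 0 algebra_simps add)
  show ?thesis
    by (cases c rule: int_cases2) (simp_all add: nat neg)
qed

lemma additive_sum:
  fixes \<phi> :: "complex \<Rightarrow> rat"
  assumes add: "\<And>x y. \<phi> (x + y) = \<phi> x + \<phi> y"
  shows "\<phi> (sum f S) = (\<Sum>i\<in>S. \<phi> (f i))"
proof -
  have 0: "\<phi> 0 = 0" using add[of 0 0] by simp
  show ?thesis by (induction S rule: infinite_finite_induct) (simp_all add: 0 add)
qed

text \<open>A nonzero number is divisible in \<open>\<int>[\<zeta>]\<close> by only finitely many primes. A rational-valued additive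
functional with value \<open>1\<close> at \<open>\<alpha>\<close> has bounded denominators on \<open>\<int>[\<zeta>]\<close>, because \<open>\<zeta>\<close> has only
finitely many powers, whereas \<open>\<alpha> = p \<beta>\<close> forces the value \<open>1 / p\<close> at \<open>\<beta>\<close>.\<close>

lemma multiples_of_cyclotomic_integer_bounded:
  fixes \<alpha> \<zeta> :: complex
  assumes "\<alpha> \<noteq> 0" "\<zeta> ^ n = 1" "n > 0"
  shows "\<exists>N :: nat. \<forall>p h. p > N \<longrightarrow> \<alpha> \<noteq> of_nat p * poly (map_poly of_int h) \<zeta>"
proof -
  obtain \<phi> :: "complex \<Rightarrow> rat" where "\<forall>x y. \<phi> (x + y) = \<phi> x + \<phi> y" and 1: "\<phi> \<alpha> = 1"
    using additive_rational_functional[OF assms(1)] by (elim exE conjE)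
  then have add: "\<And>x y. \<phi> (x + y) = \<phi> x + \<phi> y" by simp
  \<comment> \<open>A common denominator of the values at all powers of \<open>\<zeta>\<close>, so that \<open>D \<phi>\<close> is integral on \<open>\<int>[\<zeta>]\<close>.\<close>
  define D :: int where "D = (\<Prod>i<n. snd (quotient_of (\<phi> (\<zeta> ^ i))))"
  have D0: "D > 0" unfolding D_def by (intro prod_pos) (auto simp: quotient_of_denom_pos')
  have den: "of_int D * \<phi> (\<zeta> ^ i) \<in> \<int>" for i
  proof -
    have z: "\<zeta> ^ i = \<zeta> ^ (i mod n)"
      by (metis assms(2) div_mult_mod_eq mult.commute mult_1 power_add power_mult power_one)
    let ?q = "quotient_of (\<phi> (\<zeta> ^ (i mod n)))"
    have "i mod n < n" using assms by simp
    then have "snd ?q dvd D" unfolding D_def by (intro dvd_prodI) auto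
    then obtain k where k: "D = snd ?q * k" by auto
    have "\<phi> (\<zeta> ^ (i mod n)) = of_int (fst ?q) / of_int (snd ?q)"
      by (metis quotient_of_div surjective_pairing)
    moreover have "snd ?q \<noteq> 0" using quotient_of_denom_pos' by (metis less_irrefl)
    ultimately have "of_int (snd ?q) * \<phi> (\<zeta> ^ (i mod n)) = of_int (fst ?q)"
      by (metis nonzero_mult_div_cancel_left times_divide_eq_right of_int_eq_0_iff)
    then have "of_int D * \<phi> (\<zeta> ^ (i mod n)) = of_int (k * fst ?q)"
      by (simp only: k of_int_mult) (simp add: mult_ac)
    then have "of_int D * \<phi> (\<zeta> ^ i) = of_int (k * fst ?q)"
      using z by simp
    then show ?thesis by (metis Ints_of_int)
  qed
  show ?thesis
  proof (intro exI[of _ "nat D"] allI impI notI)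
    fix p and h :: "int poly" assume p: "p > nat D" and eq: "\<alpha> = of_nat p * poly (map_poly of_int h) \<zeta>"
    have "poly (map_poly of_int h) \<zeta> = (\<Sum>i\<le>degree (map_poly of_int h :: complex poly). of_int (coeff h i) * \<zeta> ^ i)"
      by (simp add: poly_altdef coeff_map_poly)
    then have "\<phi> (poly (map_poly of_int h) \<zeta>) = (\<Sum>i\<le>degree (map_poly of_int h :: complex poly). of_int (coeff h i) * \<phi> (\<zeta> ^ i))"
      by (simp add: additive_sum[OF add] additive_of_int_mult[OF add])
    then have "of_int D * \<phi> (poly (map_poly of_int h) \<zeta>) = (\<Sum>i\<le>degree (map_poly of_int h :: complex poly). of_int (coeff h i) * (of_int D * \<phi> (\<zeta> ^ i)))"
      by (simp add: sum_distrib_left mult_ac)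
    also have "\<dots> \<in> \<int>" using den by (intro Ints_sum) (rule Ints_mult, auto)
    finally obtain m where m: "of_int D * \<phi> (poly (map_poly of_int h) \<zeta>) = of_int m" by (elim Ints_cases)
    have "\<phi> \<alpha> = of_nat p * \<phi> (poly (map_poly of_int h) \<zeta>)"
      unfolding eq using additive_of_int_mult[OF add, of "int p"] by simp
    then have "of_int D = (of_int (int p * m) :: rat)" using 1 m
      by (metis mult.assoc mult.commute mult.right_neutral of_int_mult of_int_of_nat_eq)
    then have "D = int p * m" by (simp only: of_int_eq_iff)
    then have "int p dvd D" by simp
    then have "int p \<le> D" using D0 by (simp add: zdvd_imp_le)
    then show False using p by simp
  qed
qed

lemma eval_int_poly:
  fixes z :: "'a :: comm_ring_1"
  shows "poly (map_poly of_int (f + g)) z = poly (map_poly of_int f) z + poly (map_poly of_int g) z"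
    and "poly (map_poly of_int (f - g)) z = poly (map_poly of_int f) z - poly (map_poly of_int g) z"
    and "poly (map_poly of_int (- f)) z = - poly (map_poly of_int f) z"
    and "poly (map_poly of_int (f * g)) z = poly (map_poly of_int f) z * poly (map_poly of_int g) z"
    and "poly (map_poly of_int (f ^ n)) z = poly (map_poly of_int f) z ^ n"
    and "poly (map_poly of_int (of_nat n :: int poly)) z = of_nat n"
    and "poly (map_poly of_int (pcompose f (monom 1 n))) z = poly (map_poly of_int f) (z ^ n)"
proof -
  show add: "poly (map_poly of_int (f + g)) z = poly (map_poly of_int f) z + poly (map_poly of_int g) z" for f g
    unfolding poly_add[symmetric]
    by (rule arg_cong[where f = "\<lambda>p. poly p z"], simp add: poly_eq_iff coeff_map_poly)
  show neg: "poly (map_poly of_int (- f)) z = - poly (map_poly of_int f) z" for f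
    unfolding poly_minus[symmetric]
    by (rule arg_cong[where f = "\<lambda>p. poly p z"], simp add: poly_eq_iff coeff_map_poly)
  show "poly (map_poly of_int (f - g)) z = poly (map_poly of_int f) z - poly (map_poly of_int g) z"
    using add[of f "- g"] neg[of g] by simp
  have smult: "poly (map_poly of_int (smult a f)) z = of_int a * poly (map_poly of_int f) z" for a f
    unfolding poly_smult[symmetric]
    by (rule arg_cong[where f = "\<lambda>p. poly p z"], simp add: poly_eq_iff coeff_map_poly)
  show mult: "poly (map_poly of_int (f * g)) z = poly (map_poly of_int f) z * poly (map_poly of_int g) z" for f g
    by (induction f) (simp_all add: map_poly_pCons add smult algebra_simps)
  show "poly (map_poly of_int (f ^ n)) z = poly (map_poly of_int f) z ^ n"
    by (induction n) (simp_all add: mult)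
  show "poly (map_poly of_int (of_nat n :: int poly)) z = of_nat n"
    by (simp add: of_nat_poly map_poly_pCons)
  have monom: "poly (map_poly of_int (monom 1 n)) z = z ^ n"
    by (simp add: map_poly_monom poly_monom)
  show "poly (map_poly of_int (pcompose f (monom 1 n))) z = poly (map_poly of_int f) (z ^ n)"
    by (induction f) (simp_all add: map_poly_pCons pcompose_pCons add mult monom)
qed

text \<open>Landau's argument. If \<open>f(\<zeta>\<^sup>k) = 0\<close> and \<open>p\<close> is prime, then \<open>f(\<zeta>\<^sup>k\<^sup>p)\<close> lies in \<open>p \<int>[\<zeta>]\<close> by the
Frobenius congruence; for large \<open>p\<close> this makes it zero. So the exponent may be multiplied by any number
without small prime factors, and every residue class of units contains such a number.\<close>

lemma int_poly_root_power_coprime: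
  fixes f :: "int poly" and \<zeta> :: complex
  assumes \<zeta>: "\<zeta> ^ n = 1" and n: "n > 0" and f: "poly (map_poly of_int f) \<zeta> = 0" and j: "coprime j n"
  shows "poly (map_poly of_int f) (\<zeta> ^ j) = 0"
proof -
  let ?F = "poly (map_poly of_int f) :: complex \<Rightarrow> complex"
  have modn: "\<zeta> ^ i = \<zeta> ^ (i mod n)" for i
    by (metis \<zeta> div_mult_mod_eq mult.commute mult_1 power_add power_mult power_one)
  have "\<exists>N. \<forall>p h. p > N \<longrightarrow> ?F (\<zeta> ^ k) \<noteq> 0 \<longrightarrow> ?F (\<zeta> ^ k) \<noteq> of_nat p * poly (map_poly of_int h) \<zeta>" for k
    using multiples_of_cyclotomic_integer_bounded[OF _ \<zeta> n, of "?F (\<zeta> ^ k)"] by blast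
  then obtain N where N: "\<And>k p h. p > N k \<Longrightarrow> ?F (\<zeta> ^ k) \<noteq> 0 \<Longrightarrow> ?F (\<zeta> ^ k) \<noteq> of_nat p * poly (map_poly of_int h) \<zeta>"
    by metis
  \<comment> \<open>A bound that works for all \<open>n\<close> residues of the exponent at once.\<close>
  define A where "A = (\<Sum>k<n. N k)"
  have A: "N k \<le> A" if "k < n" for k
    unfolding A_def using that by (intro member_le_sum) auto
  have step: "?F (\<zeta> ^ (k * p)) = 0" if p: "prime p" "p > A" and k: "?F (\<zeta> ^ k) = 0" for p k
  proof (rule ccontr)
    assume nz: "?F (\<zeta> ^ (k * p)) \<noteq> 0"
    obtain h where h: "f ^ p - pcompose f (monom 1 p) = of_nat p * h"
      using prime_dvd_poly_power_minus_pcompose[OF p(1), of f] by (auto elim: dvdE)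
    have "map_poly of_int (f ^ p - pcompose f (monom 1 p)) = (map_poly of_int (of_nat p * h) :: complex poly)"
      by (simp only: h)
    then have "poly (map_poly of_int (f ^ p - pcompose f (monom 1 p))) (\<zeta> ^ k) = (poly (map_poly of_int (of_nat p * h)) (\<zeta> ^ k) :: complex)"
      by (simp only:)
    then have "?F (\<zeta> ^ k) ^ p - ?F (\<zeta> ^ (k * p)) = of_nat p * poly (map_poly of_int h) (\<zeta> ^ k)"
      by (simp add: eval_int_poly power_mult)
    then have "?F (\<zeta> ^ (k * p)) = of_nat p * poly (map_poly of_int (- pcompose h (monom 1 k))) \<zeta>"
      using k prime_gt_0_nat[OF p(1)] by (simp add: power_0_left eval_int_poly) (metis minus_minus)
    moreover have "\<zeta> ^ (k * p) = \<zeta> ^ (k * p mod n)" by (rule modn)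
    moreover have "p > N (k * p mod n)" using A[of "k * p mod n"] p(2) n by simp
    ultimately show False using N nz by metis
  qed
  have mult: "m > 0 \<Longrightarrow> (\<And>q. prime q \<Longrightarrow> q dvd m \<Longrightarrow> q > A) \<Longrightarrow> ?F (\<zeta> ^ m) = 0" for m
  proof (induction m rule: prime_divisors_induct)
    case (factor p x)
    then have "?F (\<zeta> ^ x) = 0" by simp
    then have "?F (\<zeta> ^ (x * p)) = 0" using factor by (intro step) auto
    then show ?case by (simp add: mult.commute)
  qed (use f in auto)
  \<comment> \<open>Each prime \<open>q \<le> A\<close> divides exactly one of \<open>j\<close> and \<open>n * P\<close>, hence not \<open>j + n * P\<close>: if \<open>q\<close> divides
    \<open>j\<close>, then it divides neither \<open>n\<close> nor \<open>P\<close>.\<close>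
  define P where "P = \<Prod>{q. prime q \<and> q \<le> A \<and> \<not> q dvd j}"
  have fin: "finite {q. prime q \<and> q \<le> A \<and> \<not> q dvd j}" by (rule finite_subset[of _ "{..A}"]) auto
  have P0: "P > 0" unfolding P_def using prime_gt_0_nat by (intro prod_pos) auto
  have "?F (\<zeta> ^ (j + n * P)) = 0"
  proof (rule mult)
    show "j + n * P > 0" using n P0 by simp
    fix q :: nat assume q: "prime q" "q dvd j + n * P"
    show "q > A"
    proof (rule ccontr)
      assume "\<not> q > A"
      then have qA: "q \<le> A" by simp
      show False
      proof (cases "q dvd j")
        case True
        then have "q dvd n * P" using q(2) by (simp add: dvd_add_right_iff)
        moreover have "\<not> q dvd n"
          using True j q(1) by (metis coprime_common_divisor not_prime_unit)
        ultimately have "q dvd P" using q(1) prime_dvd_mult_iff by blast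
        then obtain r where "prime r" "r \<le> A" "\<not> r dvd j" "q dvd r"
          unfolding P_def using fin q(1) by (auto simp: prime_dvd_prod_iff)
        then show False using True q(1) primes_dvd_imp_eq by blast
      next
        case False
        then have "q dvd P" unfolding P_def using fin q(1) qA by (intro dvd_prodI) auto
        then show False using False q(2) by (metis dvd_add_left_iff dvd_mult)
      qed
    qed
  qed
  moreover have "\<zeta> ^ (j + n * P) = \<zeta> ^ j" by (simp add: power_add power_mult \<zeta>)
  ultimately show ?thesis by simp
qed

section \<open>Conjugate families of cosine sums\<close>

text \<open>The integer combination of the numbers \<open>cos (2 \<pi> m / d)\<close> with coefficients \<open>c\<close>, after the Galois
conjugation that raises the \<open>d\<close>-th roots of unity to the power \<open>s\<close>.\<close>

definition cos_sum :: "nat \<Rightarrow> (nat \<Rightarrow> int) \<Rightarrow> nat \<Rightarrow> real" where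
  "cos_sum d c s = (\<Sum>m<d. of_int (c m) * cos (2 * pi * real s * real m / real d))"

text \<open>The values \<open>g s\<close> are the Galois conjugates of \<open>g 1\<close>, which is an integer combination of cosines.
Carrying the whole family avoids field automorphisms.\<close>

definition conjugate_family :: "nat \<Rightarrow> (nat \<Rightarrow> real) \<Rightarrow> bool" where
  "conjugate_family d g \<longleftrightarrow> (\<exists>c. \<forall>s. coprime s d \<longrightarrow> g s = cos_sum d c s)"

definition cos_lattice :: "nat \<Rightarrow> real set" where
  "cos_lattice d = {cos_sum d c 1 | c. True}"

lemma cos_period_mod:
  fixes m :: int
  assumes "d > 0"
  shows "cos (2 * pi * real s * of_int m / real d) = cos (2 * pi * real s * real (nat (m mod int d)) / real d)"
proof -
  have "m mod int d \<ge> 0" using assms by simp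
  then have "real (nat (m mod int d)) = of_int (m mod int d)" by simp
  moreover have "of_int m = of_int (m mod int d) + real d * of_int (m div int d)"
    by (metis mult_div_mod_eq of_int_add of_int_mult of_int_of_nat_eq add.commute)
  ultimately have "2 * pi * real s * of_int m / real d =
      2 * pi * real s * real (nat (m mod int d)) / real d + 2 * pi * of_int (int s * (m div int d))"
    using assms by (simp add: field_simps)
  then show ?thesis
    by (simp add: cos_add cos_int_2pin sin_int_2pin del: of_int_mult)
qed

lemma conjugate_family_cos:
  fixes m :: int
  assumes "d > 0"
  shows "conjugate_family d (\<lambda>s. cos (2 * pi * real s * of_int m / real d))"
  unfolding conjugate_family_def cos_sum_def
proof (intro exI allI impI)
  fix s
  have "nat (m mod int d) < d" using assms by (simp add: nat_less_iff)
  then show "cos (2 * pi * real s * of_int m / real d) =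
    (\<Sum>k<d. of_int ((\<lambda>k. if k = nat (m mod int d) then 1 else 0) k) * cos (2 * pi * real s * real k / real d))"
    using assms by (subst cos_period_mod) (simp_all add: if_distrib[of of_int] if_distribR if_distrib[of "\<lambda>x. x * _"] cong: if_cong)
qed

lemma conjugate_family_add:
  assumes "conjugate_family d f" "conjugate_family d g"
  shows "conjugate_family d (\<lambda>s. f s + g s)"
proof -
  obtain a b where "\<And>s. coprime s d \<Longrightarrow> f s = cos_sum d a s" "\<And>s. coprime s d \<Longrightarrow> g s = cos_sum d b s"
    using assms unfolding conjugate_family_def by metis
  then show ?thesis unfolding conjugate_family_def
    by (intro exI[of _ "\<lambda>m. a m + b m"]) (auto simp: cos_sum_def sum.distrib algebra_simps)
qed

lemma conjugate_family_mult:
  assumes "conjugate_family d f"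
  shows "conjugate_family d (\<lambda>s. of_int n * f s)"
proof -
  obtain a where "\<And>s. coprime s d \<Longrightarrow> f s = cos_sum d a s"
    using assms unfolding conjugate_family_def by metis
  then show ?thesis unfolding conjugate_family_def
    by (intro exI[of _ "\<lambda>m. n * a m"]) (auto simp: cos_sum_def sum_distrib_left algebra_simps)
qed

lemma conjugate_family_diff:
  assumes "conjugate_family d f" "conjugate_family d g"
  shows "conjugate_family d (\<lambda>s. f s - g s)"
  using conjugate_family_add[OF assms(1) conjugate_family_mult[OF assms(2), of "-1"]] by simp

lemma conjugate_family_sum:
  assumes "\<And>i. i \<in> S \<Longrightarrow> conjugate_family d (f i)" 
  shows "conjugate_family d (\<lambda>s. \<Sum>i\<in>S. f i s)"
  using assms
proof (induction S rule: infinite_finite_induct)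
  case (insert x F)
  then show ?case by (simp add: conjugate_family_add)
qed (auto simp: conjugate_family_def cos_sum_def intro!: exI[of _ "\<lambda>_. 0"])

lemma conjugate_family_cong:
  assumes "conjugate_family d f" "\<And>s. coprime s d \<Longrightarrow> f s = g s"
  shows "conjugate_family d g"
  using assms unfolding conjugate_family_def by auto

lemma cos_lattice_iff: "a \<in> cos_lattice d \<longleftrightarrow> (\<exists>g. conjugate_family d g \<and> g 1 = a)"
proof
  assume "a \<in> cos_lattice d"
  then obtain c where "a = cos_sum d c 1" unfolding cos_lattice_def by auto
  then show "\<exists>g. conjugate_family d g \<and> g 1 = a"
    by (intro exI[of _ "cos_sum d c"]) (auto simp: conjugate_family_def)
next
  assume "\<exists>g. conjugate_family d g \<and> g 1 = a"
  then obtain g where "conjugate_family d g" "g 1 = a" by blast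
  then show "a \<in> cos_lattice d" unfolding conjugate_family_def cos_lattice_def by auto
qed

lemma cos_lattice_add: "a \<in> cos_lattice d \<Longrightarrow> b \<in> cos_lattice d \<Longrightarrow> a + b \<in> cos_lattice d"
  unfolding cos_lattice_iff using conjugate_family_add by blast

lemma cos_lattice_diff: "a \<in> cos_lattice d \<Longrightarrow> b \<in> cos_lattice d \<Longrightarrow> a - b \<in> cos_lattice d"
  unfolding cos_lattice_iff using conjugate_family_diff by blast

text \<open>Closed form of the sum that appears in the finite Fourier expansion of the cotangent.\<close>

lemma sum_mult_sin:
  "4 * (sin \<theta>)\<^sup>2 * (\<Sum>k<n. real k * sin (2 * real k * \<theta>)) =
     sin (2 * (real n - 1) * \<theta>) - 2 * (real n - 1) * sin \<theta> * cos ((2 * real n - 1) * \<theta>)"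
proof (induction n)
  case 0
  have "sin (2 * \<theta>) = 2 * sin \<theta> * cos \<theta>" by (rule sin_double)
  then show ?case by simp
next
  case (Suc n)
  define A where "A = 2 * real n * \<theta>"
  have 1: "2 * (real n - 1) * \<theta> = A - 2 * \<theta>" "(2 * real n - 1) * \<theta> = A - \<theta>"
    "2 * (real (Suc n) - 1) * \<theta> = A" "(2 * real (Suc n) - 1) * \<theta> = A + \<theta>"
    by (simp_all add: A_def algebra_simps)
  have 2: "(cos \<theta>)\<^sup>2 = 1 - (sin \<theta>)\<^sup>2" by (simp add: cos_squared_eq)
  have e: "4 * (sin \<theta>)\<^sup>2 * (real n * sin A) + (sin (A - 2 * \<theta>) - 2 * (real n - 1) * sin \<theta> * cos (A - \<theta>))
      = sin A - 2 * real n * sin \<theta> * cos (A + \<theta>)"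
    unfolding sin_diff cos_diff cos_add sin_double cos_double 
    by (simp add: algebra_simps power2_eq_square[symmetric] 2)
  have "4 * (sin \<theta>)\<^sup>2 * (\<Sum>k<Suc n. real k * sin (2 * real k * \<theta>)) =
     4 * (sin \<theta>)\<^sup>2 * (real n * sin A) + 4 * (sin \<theta>)\<^sup>2 * (\<Sum>k<n. real k * sin (2 * real k * \<theta>))"
    by (simp add: A_def algebra_simps)
  also have "\<dots> = sin A - 2 * real n * sin \<theta> * cos (A + \<theta>)"
    unfolding Suc.IH 1 e ..
  finally show ?case unfolding 1 by simp
qed

lemma sin_pi_fraction_nonzero:
  assumes "d > 0" "\<not> d dvd i"
  shows "sin (pi * real i / real d) \<noteq> 0"
proof
  assume "sin (pi * real i / real d) = 0"
  then obtain k :: int where "pi * real i / real d = of_int k * pi"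
    by (auto simp: sin_zero_iff_int2)
  then have "real i = real d * of_int k" using assms by (simp add: field_simps)
  then have "of_int (int i) = (of_int (int d * k) :: real)" by simp
  then have "int i = int d * k" by (simp only: of_int_eq_iff)
  then have "int d dvd int i" by simp
  then show False using assms by simp
qed

text \<open>The finite Fourier expansion of the cotangent. It shows that \<open>d * cot (i \<pi> / d)\<close> is an integer
combination of sines, with coefficients that do not depend on \<open>i\<close>; products of two such numbers are
therefore integer combinations of cosines, compatibly with conjugation.\<close>

lemma cot_pi_fraction:
  assumes "d > 0" "\<not> d dvd i"
  shows "real d * cot (pi * real i / real d) = - 2 * (\<Sum>k<d. real k * sin (2 * pi * real k * real i / real d))"
proof -
  define \<theta> where "\<theta> = pi * real i / real d"
  have s: "sin \<theta> \<noteq> 0" unfolding \<theta>_def by (rule sin_pi_fraction_nonzero[OF assms])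
  have d\<theta>: "2 * real d * \<theta> = 2 * pi * of_int (int i)" using assms by (simp add: \<theta>_def)
  have e: "2 * (real d - 1) * \<theta> = 2 * pi * of_int (int i) - 2 * \<theta>" "(2 * real d - 1) * \<theta> = 2 * pi * of_int (int i) - \<theta>"
    using d\<theta> by (auto simp: algebra_simps)
  have "sin (2 * (real d - 1) * \<theta>) = - sin (2 * \<theta>)"
    unfolding e sin_diff sin_int_2pin cos_int_2pin by simp
  moreover have "cos ((2 * real d - 1) * \<theta>) = cos \<theta>"
    unfolding e cos_diff sin_int_2pin cos_int_2pin by simp
  ultimately have q: "sin (2 * (real d - 1) * \<theta>) = - sin (2 * \<theta>)" "cos ((2 * real d - 1) * \<theta>) = cos \<theta>" by blast+
  have "4 * (sin \<theta>)\<^sup>2 * (\<Sum>k<d. real k * sin (2 * real k * \<theta>)) = - 2 * real d * sin \<theta> * cos \<theta>"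
    unfolding sum_mult_sin q sin_double[of \<theta>] by (simp add: algebra_simps sin_double)
  then have "sin \<theta> * (real d * cos \<theta>) = sin \<theta> * (- 2 * sin \<theta> * (\<Sum>k<d. real k * sin (2 * real k * \<theta>)))"
    by (simp add: power2_eq_square algebra_simps)
  then have "real d * cos \<theta> = - 2 * sin \<theta> * (\<Sum>k<d. real k * sin (2 * real k * \<theta>))"
    using s by (simp only: mult_cancel_left) auto
  then have "real d * cot \<theta> = - 2 * (\<Sum>k<d. real k * sin (2 * real k * \<theta>))"
    using s by (simp add: cot_def field_simps)
  then show ?thesis by (simp add: \<theta>_def mult_ac)
qed

lemma coprime_not_dvd_mult:
  assumes "coprime s d" "\<not> d dvd (i::nat)"
  shows "\<not> d dvd s * i"
  using assms by (simp add: coprime_commute coprime_dvd_mult_right_iff)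

lemma conjugate_family_cot_cot:
  assumes d: "d > 0" and ij: "\<not> d dvd i" "\<not> d dvd j"
  shows "conjugate_family d (\<lambda>s. (real d)\<^sup>2 * (cot (pi * real (s * i) / real d) * cot (pi * real (s * j) / real d)))"
proof -
  let ?c = "\<lambda>s (m::int). cos (2 * pi * real s * of_int m / real d)"
  have "conjugate_family d (\<lambda>s. \<Sum>k<d. \<Sum>l<d. of_int (2 * int k * int l) *
      (?c s (int k * int i - int l * int j) - ?c s (int k * int i + int l * int j)))"
    by (intro conjugate_family_sum conjugate_family_mult conjugate_family_diff conjugate_family_cos d)
  then show ?thesis
  proof (rule conjugate_family_cong)
    fix s assume s: "coprime s d"
    let ?f = "\<lambda>i k. real k * sin (2 * pi * real k * real (s * i) / real d)"
    have "(real d)\<^sup>2 * (cot (pi * real (s * i) / real d) * cot (pi * real (s * j) / real d)) =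
       (real d * cot (pi * real (s * i) / real d)) * (real d * cot (pi * real (s * j) / real d))"
      by (simp add: power2_eq_square mult_ac)
    also have "\<dots> = (- 2 * sum (?f i) {..<d}) * (- 2 * sum (?f j) {..<d})"
      by (simp only: cot_pi_fraction[OF d coprime_not_dvd_mult[OF s ij(1)]] cot_pi_fraction[OF d coprime_not_dvd_mult[OF s ij(2)]])
    also have "\<dots> = 4 * (sum (?f i) {..<d} * sum (?f j) {..<d})" by simp
    also have "\<dots> = (\<Sum>k<d. \<Sum>l<d. 4 * (?f i k * ?f j l))"
      unfolding sum_product by (simp add: sum_distrib_left)
    also have "\<dots> = (\<Sum>k<d. \<Sum>l<d. of_int (2 * int k * int l) *
      (?c s (int k * int i - int l * int j) - ?c s (int k * int i + int l * int j)))"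
    proof (intro sum.cong refl)
      fix k l
      let ?A = "2 * pi * real k * real (s * i) / real d" and ?B = "2 * pi * real l * real (s * j) / real d"
      have "2 * pi * real s * of_int (int k * int i - int l * int j) / real d = ?A - ?B"
        "2 * pi * real s * of_int (int k * int i + int l * int j) / real d = ?A + ?B"
        by (simp_all add: algebra_simps add_divide_distrib diff_divide_distrib)
      then show "4 * (?f i k * ?f j l) = of_int (2 * int k * int l) *
      (?c s (int k * int i - int l * int j) - ?c s (int k * int i + int l * int j))"
        by (simp add: cos_diff cos_add)
    qed
    finally show "(\<Sum>k<d. \<Sum>l<d. of_int (2 * int k * int l) *
      (?c s (int k * int i - int l * int j) - ?c s (int k * int i + int l * int j))) =
      (real d)\<^sup>2 * (cot (pi * real (s * i) / real d) * cot (pi * real (s * j) / real d))" by simp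
  qed
qed

definition csc2 :: "real \<Rightarrow> real" where "csc2 x = 1 / (sin x)\<^sup>2"

lemma csc2_eq_cot: "sin x \<noteq> 0 \<Longrightarrow> csc2 x = 1 + cot x * cot x"
  unfolding csc2_def cot_def using sin_cos_squared_add[of x] by (simp add: field_simps power2_eq_square)

lemma conjugate_family_csc2:
  assumes d: "d > 0" and i: "\<not> d dvd i"
  shows "conjugate_family d (\<lambda>s. (real d)\<^sup>2 * csc2 (pi * real (s * i) / real d))"
proof (rule conjugate_family_cong)
  show "conjugate_family d (\<lambda>s. of_int (int d * int d) * cos (2 * pi * real s * of_int 0 / real d)
     + (real d)\<^sup>2 * (cot (pi * real (s * i) / real d) * cot (pi * real (s * i) / real d)))"
    by (intro conjugate_family_add conjugate_family_mult conjugate_family_cos conjugate_family_cot_cot d i)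
  fix s assume "coprime s d"
  then have "sin (pi * real (s * i) / real d) \<noteq> 0"
    by (intro sin_pi_fraction_nonzero d coprime_not_dvd_mult i)
  then show "of_int (int d * int d) * cos (2 * pi * real s * of_int 0 / real d)
     + (real d)\<^sup>2 * (cot (pi * real (s * i) / real d) * cot (pi * real (s * i) / real d)) = (real d)\<^sup>2 * csc2 (pi * real (s * i) / real d)"
    by (simp add: csc2_eq_cot power2_eq_square algebra_simps)
qed

text \<open>The polynomial \<open>f = \<Sum> c\<^sub>m (X\<^sup>m + X\<^sup>d\<^sup>-\<^sup>m)\<close> takes the value \<open>2 * cos_sum d c t\<close> at the \<open>t\<close>-th power of the
primitive root of unity, so the claim is Galois conjugation for integer polynomials.\<close>

lemma cos_sum_conjugate_zero:
  assumes d: "d > 0" and z: "cos_sum d c 1 = 0" and s: "coprime s d"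
  shows "cos_sum d c s = 0"
proof -
  define f :: "int poly" where "f = (\<Sum>m<d. monom (c m) m + monom (c m) (d - m))"
  define \<zeta> where "\<zeta> = cis (2 * pi / real d)"
  have \<zeta>: "\<zeta> ^ d = 1" 
  proof -
    have "real d * (2 * pi / real d) = 2 * pi" using d by simp
    then show ?thesis unfolding \<zeta>_def by (metis Complex.DeMoivre cis_2pi)
  qed
  have hom: "poly (map_poly of_int (sum g S)) z = (\<Sum>i\<in>S. poly (map_poly of_int (g i)) z)" for g :: "nat \<Rightarrow> int poly" and S and z :: complex
    by (induction S rule: infinite_finite_induct) (simp_all add: eval_int_poly)
  have ev: "poly (map_poly of_int f) (\<zeta> ^ t) = of_real (2 * cos_sum d c t)" for t
  proof -
    have "poly (map_poly of_int f) (\<zeta> ^ t) = (\<Sum>m<d. of_int (c m) * ((\<zeta> ^ t) ^ m + (\<zeta> ^ t) ^ (d - m)))"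
      unfolding f_def hom by (simp add: eval_int_poly map_poly_monom poly_monom algebra_simps)
    also have "\<dots> = (\<Sum>m<d. of_real (of_int (c m) * (2 * cos (2 * pi * real t * real m / real d))))"
    proof (intro sum.cong refl)
      fix m assume "m \<in> {..<d}"
      then have m: "m < d" by simp
      have 1: "(\<zeta> ^ t) ^ m = cis (2 * pi * real t * real m / real d)"
        by (simp add: \<zeta>_def Complex.DeMoivre mult_ac)
      have "(\<zeta> ^ t) ^ m * (\<zeta> ^ t) ^ (d - m) = 1"
        using m \<zeta> by (simp flip: power_add) (metis mult.commute power_mult power_one)
      then have "(\<zeta> ^ t) ^ (d - m) = inverse ((\<zeta> ^ t) ^ m)" by (simp add: inverse_unique)
      also have "\<dots> = cis (- (2 * pi * real t * real m / real d))" unfolding 1 cis_inverse ..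
      finally show "of_int (c m) * ((\<zeta> ^ t) ^ m + (\<zeta> ^ t) ^ (d - m)) =
         complex_of_real (of_int (c m) * (2 * cos (2 * pi * real t * real m / real d)))"
        unfolding 1 by (simp add: complex_eq_iff)
    qed
    finally show ?thesis by (simp add: cos_sum_def sum_distrib_left mult_ac)
  qed
  have "poly (map_poly of_int f) \<zeta> = 0" using ev[of 1] z by simp
  then have "poly (map_poly of_int f) (\<zeta> ^ s) = 0"
    by (rule int_poly_root_power_coprime[OF \<zeta> d _ s])
  then show ?thesis using ev[of s] by simp
qed

lemma sum_cos_all_Ints:
  assumes "n > 0"
  shows "(\<Sum>j\<in>{0<..n}. cos (2 * pi * real j * of_int m / real n)) \<in> \<int>"
proof -
  define w where "w = cis (2 * pi * of_int m / real n)"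
  have wn: "w ^ n = 1" 
  proof -
    have "real n * (2 * pi * of_int m / real n) = 2 * pi * of_int m" using assms by simp
    then have "w ^ n = cis (2 * pi * of_int m)" unfolding w_def by (metis Complex.DeMoivre)
    then show ?thesis by (simp add: complex_eq_iff cos_int_2pin sin_int_2pin)
  qed
  have "(\<Sum>j\<in>{0<..n}. cos (2 * pi * real j * of_int m / real n)) = Re (\<Sum>j\<in>{0<..n}. w ^ j)"
    by (simp add: w_def Complex.DeMoivre mult_ac)
  also have "(\<Sum>j\<in>{0<..n}. w ^ j) = w * (\<Sum>j<n. w ^ j)"
    unfolding sum_distrib_left
    by (rule sum.reindex_bij_witness[of _ Suc "\<lambda>j. j - 1"]) (auto simp flip: power_Suc)
  also have "Re \<dots> \<in> \<int>"
  proof (cases "w = 1")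
    case False
    then show ?thesis using wn by (simp add: geometric_sum)
  qed simp
  finally show ?thesis .
qed

text \<open>Ramanujan sums are integers: partition \<open>1, \<dots>, n\<close> by the greatest common divisor with \<open>n\<close>. The
full sum is \<open>0\<close> or \<open>n\<close>, and each proper part is a Ramanujan sum of a smaller modulus.\<close>

lemma ramanujan_sum_Ints:
  "n > 0 \<Longrightarrow> (\<Sum>j\<in>totatives n. cos (2 * pi * real j * of_int m / real n)) \<in> \<int>"
proof (induction n rule: less_induct)
  case (less n)
  let ?f = "\<lambda>n j. cos (2 * pi * real j * of_int m / real n)"
  let ?D = "{e. e dvd n}"
  have fin: "finite ?D" using less.prems by simp
  have part: "(\<Sum>j\<in>{k\<in>{0<..n}. gcd k n = e}. ?f n j) = sum (?f (n div e)) (totatives (n div e))" if "e \<in> ?D" for e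
  proof -
    from that obtain k where k: "n = e * k" by auto
    then have "e > 0" "k > 0" using less.prems by auto
    have "sum (?f n) {k\<in>{0<..n}. gcd k n = e} = (\<Sum>j\<in>totatives (n div e). ?f n (j * e))"
      using sum.reindex_bij_betw[OF bij_betw_totatives_gcd_eq[of e n], of "?f n"] that less.prems by (simp add: mult.commute)
    also have "\<dots> = sum (?f (n div e)) (totatives (n div e))"
      using \<open>e > 0\<close> \<open>k > 0\<close> by (intro sum.cong) (auto simp: k mult_ac)
    finally show ?thesis .
  qed
  have "(\<Sum>j\<in>{0<..n}. ?f n j) = (\<Sum>e\<in>?D. \<Sum>j\<in>{k\<in>{0<..n}. gcd k n = e}. ?f n j)"
    by (rule sum.group[symmetric]) (use fin in auto)
  also have "\<dots> = (\<Sum>e\<in>?D. sum (?f (n div e)) (totatives (n div e)))"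
    by (intro sum.cong refl part)
  also have "\<dots> = sum (?f n) (totatives n) + (\<Sum>e\<in>?D - {1}. sum (?f (n div e)) (totatives (n div e)))"
    using fin by (subst sum.remove[of _ 1]) auto
  finally have "sum (?f n) (totatives n) = (\<Sum>j\<in>{0<..n}. ?f n j) - (\<Sum>e\<in>?D - {1}. sum (?f (n div e)) (totatives (n div e)))"
    by simp
  also have "\<dots> \<in> \<int>"
  proof (intro Ints_diff Ints_sum[of "?D - {1}"])
    show "(\<Sum>j\<in>{0<..n}. ?f n j) \<in> \<int>" using less.prems by (rule sum_cos_all_Ints)
    fix e assume e: "e \<in> ?D - {1}"
    then have "e \<noteq> 0" "e \<noteq> 1" using less.prems by (auto intro: ccontr)
    then have "e > 1" by simp
    then have "n div e < n" using less.prems by simp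
    moreover have "n div e > 0" using e less.prems by (auto simp: dvd_div_eq_0_iff)
    ultimately show "sum (?f (n div e)) (totatives (n div e)) \<in> \<int>" by (rule less.IH)
  qed
  finally show ?case .
qed

section \<open>The module spanned by squared cosecants\<close>

text \<open>Representatives of the units modulo \<open>d\<close>, up to sign.\<close>

definition half_units :: "nat \<Rightarrow> nat set" where
  "half_units d = {y. 0 < y \<and> 2 * y < d \<and> coprime y d}"

lemma finite_half_units [simp]: "finite (half_units d)"
  by (rule finite_subset[of _ "{..d}"]) (auto simp: half_units_def)

lemma coprime_diff_self: "y \<le> d \<Longrightarrow> coprime (d - y) d \<longleftrightarrow> coprime y (d::nat)"
  by (metis coprime_commute coprime_iff_gcd_eq_1 gcd_diff2_nat gcd.commute diff_diff_cancel diff_le_self)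

lemma totatives_cases:
  assumes "d \<ge> 3" "y \<in> totatives d"
  shows "y \<in> half_units d \<or> (y < d \<and> d - y \<in> half_units d)"
proof -
  have y: "0 < y" "y < d" "coprime y d" using assms totatives_less[of y d] by (auto simp: in_totatives_iff)
  have "2 * y \<noteq> d"
  proof
    assume "2 * y = d"
    then have "y dvd d" by auto
    then have "y = 1" using y(3) by (metis coprime_common_divisor_nat dvd_refl)
    then show False using \<open>2 * y = d\<close> assms(1) by simp
  qed
  then show ?thesis using y by (auto simp: half_units_def coprime_diff_self)
qed

lemma totient_eq_half_units:
  assumes "d \<ge> 3"
  shows "totient d = 2 * card (half_units d)"
proof -
  have "totatives d = half_units d \<union> (\<lambda>y. d - y) ` half_units d"
  proof (intro equalityI subsetI)
    fix y assume "y \<in> totatives d"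
    from totatives_cases[OF assms this] show "y \<in> half_units d \<union> (\<lambda>y. d - y) ` half_units d"
      by (metis UnI1 UnI2 diff_diff_cancel image_eqI less_imp_le)
  qed (auto simp: half_units_def in_totatives_iff coprime_diff_self)
  moreover have "half_units d \<inter> (\<lambda>y. d - y) ` half_units d = {}"
    by (auto simp: half_units_def)
  moreover have "card ((\<lambda>y. d - y) ` half_units d) = card (half_units d)"
    by (intro card_image) (auto simp: inj_on_def half_units_def)
  ultimately show ?thesis unfolding totient_def by (simp add: card_Un_disjoint)
qed

text \<open>For \<open>m\<close> coprime to \<open>d\<close> this is the representative of the class of \<open>m\<close> up to sign.\<close>

definition fold_residue :: "nat \<Rightarrow> nat \<Rightarrow> nat" where
  "fold_residue d m = (if 2 * (m mod d) < d then m mod d else d - m mod d)"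

lemma csc2_minus [simp]: "csc2 (- x) = csc2 x"
  by (simp add: csc2_def)

lemma csc2_add_nat_pi: "csc2 (x + real n * pi) = csc2 x"
proof -
  have "sin (x + real n * pi) = (- 1) ^ n * sin x"
    by (simp add: sin_add mult.commute)
  then show ?thesis by (simp add: csc2_def power_mult_distrib flip: power_mult)
qed

lemma csc2_fold_residue:
  assumes "d > 0"
  shows "csc2 (pi * real (fold_residue d m) / real d) = csc2 (pi * real m / real d)"
proof -
  have "real m = real (m mod d) + real (m div d) * real d"
    by (metis mod_mult_div_eq of_nat_add of_nat_mult mult.commute)
  then have 1: "csc2 (pi * real m / real d) = csc2 (pi * real (m mod d) / real d)"
    using assms csc2_add_nat_pi[of "pi * real (m mod d) / real d" "m div d"]
    by (simp add: field_simps)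
  have "pi * real (d - m mod d) / real d = - (pi * real (m mod d) / real d) + real 1 * pi"
    using assms by (simp add: of_nat_diff field_simps less_imp_le)
  then have "csc2 (pi * real (d - m mod d) / real d) = csc2 (pi * real (m mod d) / real d)"
    by (simp only: csc2_add_nat_pi csc2_minus)
  then show ?thesis unfolding fold_residue_def 1 by simp
qed

lemma fold_residue_in:
  assumes "d \<ge> 3" "coprime m d"
  shows "fold_residue d m \<in> half_units d"
proof -
  have c: "coprime (m mod d) d" using assms by simp
  moreover have "m mod d \<noteq> 0"
  proof
    assume "m mod d = 0"
    then have "d dvd m" by auto
    then have "d = 1" using assms(2) by (metis coprime_common_divisor_nat dvd_refl)
    then show False using assms(1) by simp
  qed
  ultimately have "m mod d \<in> totatives d" using assms by (simp add: in_totatives_iff less_imp_le)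
  from totatives_cases[OF assms(1) this] show ?thesis
    unfolding fold_residue_def by (auto simp: half_units_def)
qed

lemma fold_residue_cong:
  assumes "d > 0" "fold_residue d m = fold_residue d m'"
  shows "int d dvd int m - int m' \<or> int d dvd int m + int m'"
proof -
  have lt: "m mod d < d" "m' mod d < d" using assms by auto
  have "m mod d = m' mod d \<or> m mod d + m' mod d = d"
    using assms(2) lt unfolding fold_residue_def by (simp split: if_splits; linarith)
  then show ?thesis
  proof
    assume "m mod d = m' mod d"
    then show ?thesis by (metis mod_eq_dvd_iff of_nat_mod)
  next
    assume *: "m mod d + m' mod d = d"
    have "(m + m') mod d = (m mod d + m' mod d) mod d" by (simp add: mod_add_eq)
    then have "d dvd m + m'" using * by (simp add: mod_0_imp_dvd)
    then show ?thesis by (metis of_nat_add of_nat_dvd_iff)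
  qed
qed

text \<open>The units modulo sign form a group, and multiplication by one of its elements permutes it.\<close>

lemma fold_residue_mult_bij:
  assumes d: "d \<ge> 3" and j: "j \<in> half_units d"
  shows "bij_betw (\<lambda>y. fold_residue d (j * y)) (half_units d) (half_units d)"
proof -
  have cj: "coprime j d" using j by (simp add: half_units_def)
  have sub: "(\<lambda>y. fold_residue d (j * y)) ` half_units d \<subseteq> half_units d"
    by (intro image_subsetI fold_residue_in d) (simp add: half_units_def cj)
  have "inj_on (\<lambda>y. fold_residue d (j * y)) (half_units d)"
  proof (rule inj_onI)
    fix y z assume y: "y \<in> half_units d" and z: "z \<in> half_units d" and e: "fold_residue d (j * y) = fold_residue d (j * z)"
    have cji: "coprime (int d) (int j)" using cj by (simp add: coprime_commute)
    have "int d dvd int (j * y) - int (j * z) \<or> int d dvd int (j * y) + int (j * z)"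
      using fold_residue_cong[OF _ e] d by simp
    then have "int d dvd int j * (int y - int z) \<or> int d dvd int j * (int y + int z)"
      by (simp add: algebra_simps)
    then have "int d dvd int y - int z \<or> int d dvd int y + int z"
      using cji by (simp add: coprime_dvd_mult_right_iff)
    moreover have "\<not> int d dvd int y + int z"
      using y z by (auto simp: half_units_def dest: zdvd_imp_le)
    ultimately have "int d dvd int y - int z" by blast
    moreover have "\<bar>int y - int z\<bar> < int d" using y z by (auto simp: half_units_def)
    ultimately show "y = z" by (metis dvd_imp_le_int eq_iff_diff_eq_0 linorder_not_less of_nat_eq_iff abs_of_nat)
  qed
  then show ?thesis
    using sub by (simp add: bij_betw_def endo_inj_surj)
qed

definition half_inverse :: "nat \<Rightarrow> nat \<Rightarrow> nat" where
  "half_inverse d j = (THE y. y \<in> half_units d \<and> fold_residue d (j * y) = 1)"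

lemma one_in_half_units: "d \<ge> 3 \<Longrightarrow> 1 \<in> half_units d"
  by (simp add: half_units_def)

lemma half_inverse:
  assumes d: "d \<ge> 3" and j: "j \<in> half_units d"
  shows half_inverse_in: "half_inverse d j \<in> half_units d"
    and half_inverse_eq: "fold_residue d (j * half_inverse d j) = 1"
    and half_inverse_unique: "y \<in> half_units d \<Longrightarrow> fold_residue d (j * y) = 1 \<Longrightarrow> y = half_inverse d j"
proof -
  have ex: "\<exists>!y. y \<in> half_units d \<and> fold_residue d (j * y) = 1"
    using fold_residue_mult_bij[OF d j] one_in_half_units[OF d] unfolding bij_betw_def inj_on_def
    by (smt (verit, ccfv_SIG) image_iff)
  from theI'[OF this] show 1: "half_inverse d j \<in> half_units d" "fold_residue d (j * half_inverse d j) = 1"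
    unfolding half_inverse_def by blast+
  show "y \<in> half_units d \<Longrightarrow> fold_residue d (j * y) = 1 \<Longrightarrow> y = half_inverse d j"
    using ex 1 by blast
qed

lemma half_inverse_idem:
  assumes d: "d \<ge> 3" and j: "j \<in> half_units d"
  shows "half_inverse d (half_inverse d j) = j"
  using half_inverse_unique[OF d half_inverse_in[OF d j] j] half_inverse_eq[OF d j]
  by (simp add: mult.commute)

text \<open>The identity \<open>cot A - cot B = sin (B - A) / (sin A * sin B)\<close> together with
\<open>sin (t - x/2) * sin (t + x/2) = sin\<^sup>2 t - sin\<^sup>2 (x/2)\<close> bounds a squared cosecant by a difference that
telescopes along an arithmetic progression.\<close>

lemma csc2_le_cot_diff:
  assumes A: "sin (t - x / 2) > 0" and B: "sin (t + x / 2) > 0" and x: "sin x > 0"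
  shows "csc2 t \<le> (cot (t - x / 2) - cot (t + x / 2)) / sin x"
proof -
  let ?A = "t - x / 2" and ?B = "t + x / 2"
  have "cot ?A - cot ?B = sin (?B - ?A) / (sin ?A * sin ?B)"
    unfolding cot_def sin_diff[of ?B ?A] using A B by (simp add: field_simps)
  then have e: "(cot ?A - cot ?B) / sin x = 1 / (sin ?A * sin ?B)" using x by simp
  have "sin ?A * sin ?B = (sin t)\<^sup>2 * (cos (x/2))\<^sup>2 - (cos t)\<^sup>2 * (sin (x/2))\<^sup>2"
    unfolding sin_diff sin_add by (simp add: power2_eq_square algebra_simps)
  also have "\<dots> = (sin t)\<^sup>2 - (sin (x / 2))\<^sup>2"
    unfolding cos_squared_eq by (simp add: algebra_simps)
  finally have "sin ?A * sin ?B \<le> (sin t)\<^sup>2" by simp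
  moreover have "sin ?A * sin ?B > 0" using A B by simp
  ultimately have "1 / (sin t)\<^sup>2 \<le> 1 / (sin ?A * sin ?B)" by (intro frac_le) auto
  then show ?thesis unfolding e csc2_def .
qed

text \<open>The smallest angle contributes more than all others together. With \<open>x = \<pi> / d\<close>, the sum over
\<open>2, 3, \<dots>\<close> telescopes to at most \<open>cot (3x/2) / sin x\<close>, and \<open>cot (3x/2) < 1 / sin x\<close>.\<close>

lemma sum_csc2_dominated:
  assumes d: "d \<ge> 3"
  shows "(\<Sum>y\<in>half_units d - {1}. csc2 (pi * real y / real d)) < csc2 (pi / real d)"
proof -
  define x where "x = pi / real d"
  have x: "0 < x" "x * real d = pi" "x \<le> pi / 3" using d by (auto simp: x_def field_simps)
  have sx: "sin x > 0" using x pi_gt_zero by (intro sin_gt_zero) auto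
  have pos: "sin (real k * x - x / 2) > 0" if "k \<ge> 1" "2 * k \<le> d + 1" for k
  proof (rule sin_gt_zero)
    have "1 * x \<le> real k * x" using that x by (intro mult_right_mono) auto
    then show "0 < real k * x - x / 2" using x by simp
    have "real (2 * k) * x \<le> real (d + 1) * x" using that x by (intro mult_right_mono) (auto simp del: of_nat_mult of_nat_add)
    then have "real k * x - x / 2 \<le> pi / 2" using x by (simp add: algebra_simps)
    then show "real k * x - x / 2 < pi" using pi_gt_zero by linarith
  qed
  have tel: "2 * N + 1 \<le> d \<Longrightarrow> N \<ge> 1 \<Longrightarrow>
     (\<Sum>k\<in>{2..N}. csc2 (real k * x)) \<le> (cot (3 * x / 2) - cot (real N * x + x / 2)) / sin x" for N
  proof (induction N)
    case (Suc N)
    show ?case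
    proof (cases "N = 0")
      case True
      then show ?thesis by (simp add: field_simps)
    next
      case False
      have 1: "real (Suc N) * x - x / 2 = real N * x + x / 2" by (simp add: algebra_simps)
      have 2: "real (Suc N) * x + x / 2 = real (Suc (Suc N)) * x - x / 2" by (simp add: algebra_simps)
      have "csc2 (real (Suc N) * x) \<le> (cot (real (Suc N) * x - x / 2) - cot (real (Suc N) * x + x / 2)) / sin x"
      proof (rule csc2_le_cot_diff[OF _ _ sx])
        show "0 < sin (real (Suc N) * x - x / 2)" using Suc.prems by (intro pos) auto
        show "0 < sin (real (Suc N) * x + x / 2)" unfolding 2 using Suc.prems by (intro pos) auto
      qed
      moreover have "(\<Sum>k\<in>{2..Suc N}. csc2 (real k * x)) = (\<Sum>k\<in>{2..N}. csc2 (real k * x)) + csc2 (real (Suc N) * x)"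
        using False by (simp add: sum.cl_ivl_Suc)
      ultimately show ?thesis using Suc.IH False Suc.prems unfolding 1
        by (simp add: diff_divide_distrib)
    qed
  qed simp
  define N where "N = (d - 1) div 2"
  have N: "2 * N + 1 \<le> d" "N \<ge> 1" using d by (auto simp: N_def)
  have "(\<Sum>y\<in>half_units d - {1}. csc2 (pi * real y / real d)) = (\<Sum>y\<in>half_units d - {1}. csc2 (real y * x))"
    by (simp add: x_def mult.commute)
  also have "\<dots> \<le> (\<Sum>k\<in>{2..N}. csc2 (real k * x))"
    by (intro sum_mono2) (auto simp: half_units_def N_def csc2_def)
  also have "\<dots> \<le> (cot (3 * x / 2) - cot (real N * x + x / 2)) / sin x"
    by (rule tel[OF N])
  also have "\<dots> \<le> cot (3 * x / 2) / sin x"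
  proof -
    have "real (2 * N + 1) * x \<le> real d * x" using N x by (intro mult_right_mono) (auto simp del: of_nat_mult of_nat_add)
    then have "real N * x + x / 2 \<le> pi / 2" using x by (simp add: algebra_simps)
    moreover have "0 < real N * x + x / 2" using x by (simp add: add_nonneg_pos)
    ultimately have "cot (real N * x + x / 2) \<ge> 0"
      unfolding cot_def by (intro divide_nonneg_nonneg cos_ge_zero sin_ge_zero) auto
    then show ?thesis using sx by (simp add: divide_right_mono)
  qed
  also have "\<dots> < csc2 x"
  proof -
    have s: "sin x \<le> sin (3 * x / 2)" using x pi_gt_zero by (intro sin_monotone_2pi_le) auto
    have "cos (3 * x / 2) < cos 0" using x pi_gt_zero by (intro cos_monotone_0_pi) auto
    then have "cos (3 * x / 2) * sin x < 1 * sin x" using sx by (intro mult_strict_right_mono) auto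
    then have "cos (3 * x / 2) * sin x < sin (3 * x / 2)" using s by simp
    then have "cot (3 * x / 2) < 1 / sin x" using s sx unfolding cot_def by (simp add: field_simps)
    then have "cot (3 * x / 2) / sin x < 1 / sin x / sin x" using sx by (intro divide_strict_right_mono) auto
    then show ?thesis by (simp add: csc2_def power2_eq_square)
  qed
  finally show ?thesis by (simp add: x_def)
qed

text \<open>The matrix with entries \<open>csc2 (j y \<pi> / d)\<close> has \<open>csc2 (\<pi> / d)\<close> in row \<open>j\<close> exactly at the inverse of
\<open>j\<close>; the other entries of the row are a permutation of the other squared cosecants.\<close>

lemma sum_csc2_off_diagonal:
  assumes d: "d \<ge> 3" and j: "j \<in> half_units d" and r: "\<And>y. y \<in> half_units d \<Longrightarrow> \<bar>a y\<bar> \<le> r"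
  shows "\<bar>(\<Sum>y\<in>half_units d. a y * csc2 (pi * real (j * y) / real d)) - a (half_inverse d j) * csc2 (pi / real d)\<bar>
     \<le> r * (\<Sum>y\<in>half_units d - {1}. csc2 (pi * real y / real d))"
proof -
  let ?U = "half_units d" and ?i = "half_inverse d j"
  let ?f = "\<lambda>y. csc2 (pi * real y / real d)"
  have d0: "d > 0" using d by simp
  have f: "csc2 (pi * real (j * y) / real d) = ?f (fold_residue d (j * y))" for y
    using csc2_fold_residue[OF d0] by simp
  have "(\<Sum>y\<in>?U. a y * csc2 (pi * real (j * y) / real d)) = 
      a ?i * csc2 (pi / real d) + (\<Sum>y\<in>?U - {?i}. a y * csc2 (pi * real (j * y) / real d))"
    using half_inverse_in[OF d j] half_inverse_eq[OF d j]
    by (subst sum.remove[of _ ?i]) (auto simp only: f finite_half_units of_nat_1 mult_1_right)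
  then have "\<bar>(\<Sum>y\<in>?U. a y * csc2 (pi * real (j * y) / real d)) - a ?i * csc2 (pi / real d)\<bar> =
    \<bar>\<Sum>y\<in>?U - {?i}. a y * csc2 (pi * real (j * y) / real d)\<bar>" by simp
  also have "\<dots> \<le> (\<Sum>y\<in>?U - {?i}. \<bar>a y * csc2 (pi * real (j * y) / real d)\<bar>)" by (rule sum_abs)
  also have "\<dots> \<le> (\<Sum>y\<in>?U - {?i}. r * ?f (fold_residue d (j * y)))"
    unfolding f abs_mult by (intro sum_mono mult_mono r) (auto simp: csc2_def order_trans[OF abs_ge_zero r])
  also have "\<dots> = r * (\<Sum>y\<in>?U - {?i}. ?f (fold_residue d (j * y)))" by (simp add: sum_distrib_left)
  also have "(\<Sum>y\<in>?U - {?i}. ?f (fold_residue d (j * y))) = (\<Sum>y\<in>?U - {1}. ?f y)"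
  proof (rule sum.reindex_bij_betw)
    show "bij_betw (\<lambda>y. fold_residue d (j * y)) (?U - {?i}) (?U - {1})"
      using bij_betw_DiffI[OF fold_residue_mult_bij[OF d j], of "{?i}" "{1}"] half_inverse_in[OF d j] half_inverse_eq[OF d j]
        one_in_half_units[OF d]
      by (simp add: bij_betw_def)
  qed
  finally show ?thesis .
qed

text \<open>A linear relation is inherited by all conjugates, so the coefficients lie in the kernel of a matrix
that is diagonally dominant up to a permutation.\<close>

lemma csc2_independent:
  assumes d: "d \<ge> 3" and z: "(\<Sum>y\<in>half_units d. of_int (n y) * csc2 (pi * real y / real d)) = 0"
    and y: "y \<in> half_units d"
  shows "n y = (0 :: int)"
proof -
  let ?U = "half_units d"
  have nd: "\<not> d dvd y" if "y \<in> ?U" for y using that by (auto simp: half_units_def dest: dvd_imp_le)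
  let ?g = "\<lambda>s. \<Sum>y\<in>?U. of_int (n y) * ((real d)\<^sup>2 * csc2 (pi * real (s * y) / real d))"
  have "conjugate_family d ?g"
    using d nd by (intro conjugate_family_sum conjugate_family_mult conjugate_family_csc2) auto
  then obtain c where c: "\<And>s. coprime s d \<Longrightarrow> ?g s = cos_sum d c s" unfolding conjugate_family_def by blast
  have g: "?g s = (real d)\<^sup>2 * (\<Sum>y\<in>?U. of_int (n y) * csc2 (pi * real (s * y) / real d))" for s
    by (simp add: sum_distrib_left mult_ac)
  have "cos_sum d c 1 = 0" using c[of 1] g[of 1] z by simp
  then have zj: "(\<Sum>y\<in>?U. of_int (n y) * csc2 (pi * real (j * y) / real d)) = 0" if "j \<in> ?U" for j
    using cos_sum_conjugate_zero[of d c j] c[of j] g[of j] that d by (simp add: half_units_def)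
  \<comment> \<open>The usual argument for diagonal dominance: look at the row whose dominant entry meets the largest
    coefficient.\<close>
  define m where "m = Max ((\<lambda>y. \<bar>n y\<bar>) ` ?U)"
  have "m \<in> (\<lambda>y. \<bar>n y\<bar>) ` ?U" unfolding m_def using y by (intro Max_in) auto
  then obtain y0 where y0: "y0 \<in> ?U" "\<bar>n y0\<bar> = m" by auto
  have m: "\<bar>n y\<bar> \<le> m" if "y \<in> ?U" for y unfolding m_def using that by (intro Max_ge) auto
  define S where "S = (\<Sum>y\<in>?U - {1}. csc2 (pi * real y / real d))"
  have "\<bar>(\<Sum>y\<in>?U. of_int (n y) * csc2 (pi * real (half_inverse d y0 * y) / real d)) 
     - of_int (n (half_inverse d (half_inverse d y0))) * csc2 (pi / real d)\<bar> \<le> of_int m * S"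
    unfolding S_def
    by (rule sum_csc2_off_diagonal[OF d half_inverse_in[OF d y0(1)]]) (metis m of_int_abs of_int_le_iff)
  then have "\<bar>of_int (n y0)\<bar> * csc2 (pi / real d) \<le> of_int m * S"
    unfolding zj[OF half_inverse_in[OF d y0(1)]] half_inverse_idem[OF d y0(1)]
    by (simp add: abs_mult csc2_def)
  then have "of_int m * csc2 (pi / real d) \<le> of_int m * S" using y0(2) by (metis of_int_abs)
  moreover have "S < csc2 (pi / real d)" unfolding S_def by (rule sum_csc2_dominated[OF d])
  ultimately have "m \<le> 0"
    by (smt (verit, best) mult_less_cancel_left_pos of_int_0_less_iff)
  then show ?thesis using m[OF y] by simp
qed

text \<open>One step of an approximation of \<open>\<phi>\<close> by the conjugate vectors of integer combinations: the
coefficient at \<open>y\<close> is obtained by rounding with respect to the dominant entry, which sits in the row of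
the inverse of \<open>y\<close>. The new error consists of the rounding error and of the off-diagonal part, which is
smaller than \<open>r\<close> by the factor \<open>S / D < 1\<close>, up to a constant.\<close>

lemma csc2_rounding_step:
  assumes d: "d \<ge> 3" and r: "\<And>j. j \<in> half_units d \<Longrightarrow> \<bar>\<phi> j\<bar> \<le> r"
  defines "D \<equiv> 2 * csc2 (pi / real d)"
  defines "S \<equiv> 2 * (\<Sum>y\<in>half_units d - {1}. csc2 (pi * real y / real d))"
  shows "\<exists>n :: nat \<Rightarrow> int. \<forall>j\<in>half_units d.
     \<bar>\<phi> j - (\<Sum>y\<in>half_units d. of_int (n y) * (2 * csc2 (pi * real (j * y) / real d)))\<bar> \<le> S / D * r + (D + S)"
proof (intro exI[of _ "\<lambda>y. \<lfloor>\<phi> (half_inverse d y) / D\<rfloor>"] ballI)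
  let ?U = "half_units d"
  let ?n = "\<lambda>y. \<lfloor>\<phi> (half_inverse d y) / D\<rfloor>"
  fix j assume j: "j \<in> ?U"
  have SD: "S < D" unfolding S_def D_def using sum_csc2_dominated[OF d] by simp
  have S0: "S \<ge> 0" unfolding S_def by (intro mult_nonneg_nonneg sum_nonneg) (auto simp: csc2_def)
  have D0: "D > 0" using SD S0 by simp
  have Dc: "csc2 (pi / real d) = D / 2" by (simp add: D_def)
  have gen: "\<bar>Q - N * D\<bar> \<le> E" if "2 * \<bar>P - N * (D / 2)\<bar> \<le> E" "Q = 2 * P" for P Q N E
  proof -
    have e: "Q - N * D = 2 * (P - N * (D / 2))" using that(2) by simp
    show ?thesis using that(1) unfolding e abs_mult by simp
  qed
  have nb: "\<bar>of_int (?n y)\<bar> \<le> r / D + 1" if "y \<in> ?U" for y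
  proof -
    have "\<bar>\<phi> (half_inverse d y) / D\<bar> \<le> r / D"
      using r[OF half_inverse_in[OF d that]] D0 by (simp add: abs_divide divide_right_mono)
    then show ?thesis by linarith
  qed
  have "\<bar>(\<Sum>y\<in>?U. of_int (?n y) * csc2 (pi * real (j * y) / real d)) - of_int (?n (half_inverse d j)) * csc2 (pi / real d)\<bar>
     \<le> (r / D + 1) * (\<Sum>y\<in>?U - {1}. csc2 (pi * real y / real d))"
    by (rule sum_csc2_off_diagonal[OF d j nb])
  then have "2 * \<bar>(\<Sum>y\<in>?U. of_int (?n y) * csc2 (pi * real (j * y) / real d)) - of_int (?n (half_inverse d j)) * csc2 (pi / real d)\<bar>
     \<le> (r / D + 1) * S" unfolding S_def by simp
  moreover have "(\<Sum>y\<in>?U. of_int (?n y) * (2 * csc2 (pi * real (j * y) / real d))) = 2 * (\<Sum>y\<in>?U. of_int (?n y) * csc2 (pi * real (j * y) / real d))"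
    by (simp add: sum_distrib_left mult_ac)
  ultimately have 1: "\<bar>(\<Sum>y\<in>?U. of_int (?n y) * (2 * csc2 (pi * real (j * y) / real d))) - of_int (?n (half_inverse d j)) * D\<bar> \<le> (r / D + 1) * S"
    unfolding Dc by (rule gen)
  have "\<phi> j / D - 1 < of_int \<lfloor>\<phi> j / D\<rfloor>" by linarith
  then have "\<phi> j - D < of_int \<lfloor>\<phi> j / D\<rfloor> * D" using D0 by (simp add: field_simps)
  moreover have "of_int \<lfloor>\<phi> j / D\<rfloor> * D \<le> \<phi> j"
    by (rule pos_le_divide_eq[OF D0, THEN iffD1, OF of_int_floor_le])
  ultimately have "\<bar>\<phi> j - of_int (?n (half_inverse d j)) * D\<bar> \<le> D" by (simp add: half_inverse_idem[OF d j])
  then have "\<bar>\<phi> j - (\<Sum>y\<in>?U. of_int (?n y) * (2 * csc2 (pi * real (j * y) / real d)))\<bar> \<le> D + (r / D + 1) * S"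
    using 1 by linarith
  also have "\<dots> = S / D * r + (D + S)" by (simp add: algebra_simps)
  finally show "\<bar>\<phi> j - (\<Sum>y\<in>?U. of_int (?n y) * (2 * csc2 (pi * real (j * y) / real d)))\<bar> \<le> S / D * r + (D + S)" .
qed

text \<open>Iterating the rounding step contracts every error to a fixed bound, so the conjugate vectors of the
span are cocompact in the space of all vectors indexed by the units modulo sign.\<close>

lemma csc2_rounding:
  assumes d: "d \<ge> 3"
  shows "\<exists>C. \<forall>\<phi>. \<exists>n :: nat \<Rightarrow> int. \<forall>j\<in>half_units d.
     \<bar>\<phi> j - (\<Sum>y\<in>half_units d. of_int (n y) * (2 * csc2 (pi * real (j * y) / real d)))\<bar> \<le> C"
proof -
  let ?U = "half_units d"
  define D where "D = 2 * csc2 (pi / real d)"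
  define S where "S = 2 * (\<Sum>y\<in>?U - {1}. csc2 (pi * real y / real d))"
  let ?A = "\<lambda>n j. \<Sum>y\<in>?U. of_int (n y) * (2 * csc2 (pi * real (j * y) / real d))"
  have SD: "S < D" unfolding S_def D_def using sum_csc2_dominated[OF d] by simp
  have S0: "S \<ge> 0" unfolding S_def by (intro mult_nonneg_nonneg sum_nonneg) (auto simp: csc2_def)
  have D0: "D > 0" using SD S0 by simp
  define \<theta> where "\<theta> = S / D"
  have \<theta>: "0 \<le> \<theta>" "\<theta> < 1" using SD S0 D0 by (auto simp: \<theta>_def)
  \<comment> \<open>The fixed point of the recursion for the error bound.\<close>
  define K where "K = (D + S) / (1 - \<theta>)"
  have K: "\<theta> * K + (D + S) = K" using \<theta> by (simp add: K_def field_simps)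
  have step: "\<exists>n. \<forall>j\<in>?U. \<bar>\<phi> j - ?A n j\<bar> \<le> \<theta> * r + (D + S)" if "\<And>j. j \<in> ?U \<Longrightarrow> \<bar>\<phi> j\<bar> \<le> r" for \<phi> r
    using csc2_rounding_step[OF d that] unfolding \<theta>_def D_def S_def .
  have iter: "\<exists>n. \<forall>j\<in>?U. \<bar>\<phi> j - ?A n j\<bar> \<le> \<theta> ^ k * r + K" if r: "\<And>j. j \<in> ?U \<Longrightarrow> \<bar>\<phi> j\<bar> \<le> r" for \<phi> r k
  proof (induction k)
    case 0
    have "K \<ge> 0" using \<theta> D0 S0 by (simp add: K_def)
    then show ?case using r by (intro exI[of _ "\<lambda>_. 0"]) (auto intro: add_increasing2)
  next
    case (Suc k)
    then obtain n where n: "\<forall>j\<in>?U. \<bar>\<phi> j - ?A n j\<bar> \<le> \<theta> ^ k * r + K" by blast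
    obtain n' where n': "\<forall>j\<in>?U. \<bar>(\<phi> j - ?A n j) - ?A n' j\<bar> \<le> \<theta> * (\<theta> ^ k * r + K) + (D + S)"
      using step[of "\<lambda>j. \<phi> j - ?A n j" "\<theta> ^ k * r + K"] n by blast
    have "?A (\<lambda>y. n y + n' y) j = ?A n j + ?A n' j" for j
      by (simp add: sum.distrib algebra_simps)
    moreover have "\<theta> * (\<theta> ^ k * r + K) + (D + S) = \<theta> ^ Suc k * r + K"
      using K by (simp add: algebra_simps)
    ultimately have "\<forall>j\<in>?U. \<bar>\<phi> j - ?A (\<lambda>y. n y + n' y) j\<bar> \<le> \<theta> ^ Suc k * r + K"
      using n' by (simp only: diff_diff_eq)
    then show ?case by (rule exI[where x = "\<lambda>y. n y + n' y"])
  qed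
  show ?thesis
  proof (intro exI[of _ "1 + K"] allI)
    fix \<phi> :: "nat \<Rightarrow> real"
    define r where "r = (\<Sum>j\<in>?U. \<bar>\<phi> j\<bar>) + 1"
    have r: "\<bar>\<phi> j\<bar> \<le> r" if "j \<in> ?U" for j
      unfolding r_def using that member_le_sum[of j ?U "\<lambda>j. \<bar>\<phi> j\<bar>"] by simp
    have r0: "r > 0" unfolding r_def by (intro add_nonneg_pos sum_nonneg) auto
    obtain k where "\<theta> ^ k < 1 / r" using real_arch_pow_inv[of "1 / r" \<theta>] \<theta> r0 by auto
    then have "\<theta> ^ k * r \<le> 1" using r0 by (simp add: field_simps)
    moreover obtain n where "\<forall>j\<in>?U. \<bar>\<phi> j - ?A n j\<bar> \<le> \<theta> ^ k * r + K" using iter[of \<phi> r k] r by blast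
    ultimately show "\<exists>n :: nat \<Rightarrow> int. \<forall>j\<in>?U. \<bar>\<phi> j - ?A n j\<bar> \<le> 1 + K" by (intro exI[of _ n]) force
  qed
qed

lemma cos_sum_reflect:
  assumes "d > 0" "j \<le> d"
  shows "cos_sum d c (d - j) = cos_sum d c j"
  unfolding cos_sum_def
proof (intro sum.cong refl)
  fix m
  have "2 * pi * real (d - j) * real m / real d = 2 * pi * of_int (int m) - 2 * pi * real j * real m / real d"
    using assms by (simp add: of_nat_diff field_simps)
  then have "cos (2 * pi * real (d - j) * real m / real d) = cos (2 * pi * real j * real m / real d)"
    by (simp only: cos_diff cos_int_2pin sin_int_2pin)
  then show "of_int (c m) * cos (2 * pi * real (d - j) * real m / real d) = of_int (c m) * cos (2 * pi * real j * real m / real d)"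
    by simp
qed

text \<open>The trace of the product of the number \<open>cos_sum d c 1\<close> with \<open>2 cos (2 \<pi> k / d)\<close>, taken over the
cyclotomic field.\<close>

definition cos_trace :: "nat \<Rightarrow> (nat \<Rightarrow> int) \<Rightarrow> nat \<Rightarrow> real" where
  "cos_trace d c k = (\<Sum>j\<in>totatives d. cos_sum d c j * (2 * cos (2 * pi * real j * real k / real d)))"

text \<open>Products of cosines are half sums of cosines, which turns the trace into an integer combination of
Ramanujan sums.\<close>

lemma cos_trace_Ints:
  assumes "d > 0"
  shows "cos_trace d c k \<in> \<int>"
proof -
  have e: "cos (2 * pi * real j * real m / real d) * (2 * cos (2 * pi * real j * real k / real d)) =
     cos (2 * pi * real j * of_int (int m + int k) / real d) + cos (2 * pi * real j * of_int (int m - int k) / real d)" for j m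
  proof -
    have "2 * pi * real j * of_int (int m + int k) / real d = 2 * pi * real j * real m / real d + 2 * pi * real j * real k / real d"
     "2 * pi * real j * of_int (int m - int k) / real d = 2 * pi * real j * real m / real d - 2 * pi * real j * real k / real d"
      by (simp_all add: algebra_simps add_divide_distrib diff_divide_distrib)
    then show ?thesis by (simp only: cos_add cos_diff)
  qed
  have "cos_trace d c k = (\<Sum>j\<in>totatives d. \<Sum>m<d. of_int (c m) * (cos (2 * pi * real j * real m / real d) * (2 * cos (2 * pi * real j * real k / real d))))"
    unfolding cos_trace_def cos_sum_def by (simp add: sum_distrib_right mult.assoc)
  also have "\<dots> = (\<Sum>m<d. \<Sum>j\<in>totatives d. of_int (c m) * (cos (2 * pi * real j * real m / real d) * (2 * cos (2 * pi * real j * real k / real d))))"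
    by (rule sum.swap)
  also have "\<dots> = (\<Sum>m<d. of_int (c m) * ((\<Sum>j\<in>totatives d. cos (2 * pi * real j * of_int (int m + int k) / real d)) +
      (\<Sum>j\<in>totatives d. cos (2 * pi * real j * of_int (int m - int k) / real d))))"
    unfolding e by (simp only: sum_distrib_left[symmetric] sum.distrib)
  also have "\<dots> \<in> \<int>"
    using assms by (intro Ints_sum Ints_mult Ints_add ramanujan_sum_Ints) auto
  finally show ?thesis .
qed

text \<open>The trace form is nondegenerate: the trace of the square of a real number is the sum of the squares of
its conjugates.\<close>

lemma cos_trace_inj:
  assumes d: "d > 0" and e: "\<And>k. k < d \<Longrightarrow> cos_trace d c k = cos_trace d c' k"
  shows "cos_sum d c 1 = cos_sum d c' 1"
proof -
  define b where "b = (\<lambda>m. c m - c' m)"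
  have diff: "cos_sum d b j = cos_sum d c j - cos_sum d c' j" for j
    unfolding cos_sum_def b_def by (simp add: sum_subtractf algebra_simps)
  have "cos_trace d b k = 0" if "k < d" for k
    using e[OF that] unfolding cos_trace_def diff by (simp add: sum_subtractf algebra_simps)
  then have "0 = (\<Sum>k<d. of_int (b k) * cos_trace d b k)" by simp
  also have "\<dots> = (\<Sum>k<d. \<Sum>j\<in>totatives d. of_int (b k) * (cos_sum d b j * (2 * cos (2 * pi * real j * real k / real d))))"
    unfolding cos_trace_def by (simp add: sum_distrib_left)
  also have "\<dots> = (\<Sum>j\<in>totatives d. \<Sum>k<d. of_int (b k) * (cos_sum d b j * (2 * cos (2 * pi * real j * real k / real d))))"
    by (rule sum.swap)
  also have "\<dots> = (\<Sum>j\<in>totatives d. 2 * (cos_sum d b j)\<^sup>2)"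
  proof (intro sum.cong refl)
    fix j
    have "(\<Sum>k<d. of_int (b k) * (cos_sum d b j * (2 * cos (2 * pi * real j * real k / real d)))) =
      2 * cos_sum d b j * (\<Sum>k<d. of_int (b k) * cos (2 * pi * real j * real k / real d))"
      unfolding sum_distrib_left by (intro sum.cong refl) simp
    then show "(\<Sum>k<d. of_int (b k) * (cos_sum d b j * (2 * cos (2 * pi * real j * real k / real d)))) = 2 * (cos_sum d b j)\<^sup>2"
      by (simp add: cos_sum_def power2_eq_square)
  qed
  finally have "\<forall>j\<in>totatives d. 2 * (cos_sum d b j)\<^sup>2 = 0"
    by (subst (asm) eq_commute, subst (asm) sum_nonneg_eq_0_iff) auto
  then have "cos_sum d b 1 = 0" using d one_in_totatives[of d] by fastforce
  then show ?thesis using diff[of 1] by simp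
qed

text \<open>An integer combination of cosines is determined by its traces against the generators, which are
integers, and a bound on the conjugates bounds these traces.\<close>

lemma finite_bounded_cos_sums:
  assumes d: "d \<ge> 3"
  shows "finite {cos_sum d c 1 | c. \<forall>j\<in>half_units d. \<bar>cos_sum d c j\<bar> \<le> C}"
proof -
  define S where "S = {c. \<forall>j\<in>half_units d. \<bar>cos_sum d c j\<bar> \<le> C}"
  have bd: "\<bar>cos_sum d c j\<bar> \<le> C" if "c \<in> S" "j \<in> totatives d" for c j
    using totatives_cases[OF d that(2)] that(1) cos_sum_reflect[of d j c] d unfolding S_def by auto
  define M where "M = real (card (totatives d)) * (2 * C)"
  define T where "T = (\<lambda>c. \<lambda>k\<in>{..<d}. \<lfloor>cos_trace d c k\<rfloor>)"
  have T: "of_int (T c k) = cos_trace d c k" if "k < d" for c k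
    using cos_trace_Ints[of d c k] d that by (auto simp: T_def elim: Ints_cases)
  \<comment> \<open>The bound \<open>C\<close> passes from \<open>half_units d\<close> to all units, since \<open>j\<close> and \<open>d - j\<close> give the same conjugate.\<close>
  have "T ` S \<subseteq> PiE {..<d} (\<lambda>_. {- \<lceil>M\<rceil>..\<lceil>M\<rceil>})"
  proof (intro subsetI)
    fix t assume "t \<in> T ` S"
    then obtain c where c: "c \<in> S" "t = T c" by blast
    have "T c k \<in> {- \<lceil>M\<rceil>..\<lceil>M\<rceil>}" if k: "k < d" for k
    proof -
      have "\<bar>cos_trace d c k\<bar> \<le> (\<Sum>j\<in>totatives d. 2 * C)"
        unfolding cos_trace_def
      proof (rule order_trans[OF sum_abs sum_mono])
        fix j assume j: "j \<in> totatives d"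
        have "\<bar>cos_sum d c j\<bar> * \<bar>2 * cos (2 * pi * real j * real k / real d)\<bar> \<le> C * 2"
          using bd[OF c(1) j] order_trans[OF abs_ge_zero bd[OF c(1) j]] by (intro mult_mono) (auto simp: abs_mult)
        then show "\<bar>cos_sum d c j * (2 * cos (2 * pi * real j * real k / real d))\<bar> \<le> 2 * C" by (simp add: abs_mult)
      qed
      then have "\<bar>of_int (T c k)\<bar> \<le> M" unfolding T[OF k] M_def by simp
      then show ?thesis by (simp add: abs_le_iff) linarith
    qed
    then show "t \<in> PiE {..<d} (\<lambda>_. {- \<lceil>M\<rceil>..\<lceil>M\<rceil>})" unfolding c(2) by (auto simp: T_def)
  qed
  then have fin: "finite (T ` S)" by (rule finite_subset) (auto intro: finite_PiE)
  have inj: "cos_sum d c 1 = cos_sum d c' 1" if "T c = T c'" for c c'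
    using d that by (intro cos_trace_inj) (auto simp flip: T)
  have "{cos_sum d c 1 | c. c \<in> S} \<subseteq> (\<lambda>t. cos_sum d (SOME c. T c = t) 1) ` T ` S"
  proof (intro subsetI)
    fix x assume "x \<in> {cos_sum d c 1 | c. c \<in> S}"
    then obtain c where c: "c \<in> S" "x = cos_sum d c 1" by blast
    have "T (SOME c'. T c' = T c) = T c" by (rule someI[where x = c]) (rule refl)
    then have "x = cos_sum d (SOME c'. T c' = T c) 1" unfolding c(2) by (intro inj) simp
    then show "x \<in> (\<lambda>t. cos_sum d (SOME c. T c = t) 1) ` T ` S" using c(1) by blast
  qed
  then have "finite {cos_sum d c 1 | c. c \<in> S}" using fin by (rule finite_subset[OF _ finite_imageI])
  then show ?thesis unfolding S_def by simp
qed

text \<open>Subtract from \<open>a\<close> the integer combination that approximates all its conjugates at once. The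
remainder, scaled by \<open>d\<^sup>2\<close>, is an integer combination of cosines with bounded conjugates, so it
takes only finitely many values. The factor \<open>2\<close> matches the translation lengths to which this
is applied.\<close>

theorem csc2_span_finite_index:
  assumes d: "d \<ge> 3"
  shows "\<exists>F. finite F \<and> (\<forall>a. (real d)\<^sup>2 * a \<in> cos_lattice d \<longrightarrow>
     (\<exists>n :: nat \<Rightarrow> int. a - (\<Sum>y\<in>half_units d. of_int (n y) * (2 * csc2 (pi * real y / real d))) \<in> F))"
proof -
  let ?U = "half_units d"
  have nd: "\<not> d dvd y" if "y \<in> ?U" for y using that by (auto simp: half_units_def dest: dvd_imp_le)
  have d0: "(real d)\<^sup>2 > 0" using d by simp
  obtain C where C: "\<And>\<phi>. \<exists>n :: nat \<Rightarrow> int. \<forall>j\<in>?U.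
     \<bar>\<phi> j - (\<Sum>y\<in>?U. of_int (n y) * (2 * csc2 (pi * real (j * y) / real d)))\<bar> \<le> C"
    using csc2_rounding[OF d] by blast
  define F where "F = (\<lambda>x. x / (real d)\<^sup>2) ` {cos_sum d c 1 | c. \<forall>j\<in>?U. \<bar>cos_sum d c j\<bar> \<le> (real d)\<^sup>2 * C}"
  have "finite F" unfolding F_def by (intro finite_imageI finite_bounded_cos_sums d)
  moreover have "\<exists>n :: nat \<Rightarrow> int. a - (\<Sum>y\<in>?U. of_int (n y) * (2 * csc2 (pi * real y / real d))) \<in> F"
    if "(real d)\<^sup>2 * a \<in> cos_lattice d" for a
  proof -
    obtain g where g: "conjugate_family d g" "g 1 = (real d)\<^sup>2 * a" using \<open>_ \<in> cos_lattice d\<close> unfolding cos_lattice_iff by blast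
    obtain n :: "nat \<Rightarrow> int" where n: "\<forall>j\<in>?U. \<bar>g j / (real d)\<^sup>2 - (\<Sum>y\<in>?U. of_int (n y) * (2 * csc2 (pi * real (j * y) / real d)))\<bar> \<le> C"
      using C[of "\<lambda>j. g j / (real d)\<^sup>2"] by blast
    let ?h = "\<lambda>s. g s - (\<Sum>y\<in>?U. of_int (2 * n y) * ((real d)\<^sup>2 * csc2 (pi * real (s * y) / real d)))"
    have "conjugate_family d ?h"
      using d nd by (intro conjugate_family_diff conjugate_family_sum conjugate_family_mult conjugate_family_csc2 g) auto
    then obtain c where c: "\<And>s. coprime s d \<Longrightarrow> ?h s = cos_sum d c s" unfolding conjugate_family_def by blast
    have h: "?h s = (real d)\<^sup>2 * (g s / (real d)\<^sup>2 - (\<Sum>y\<in>?U. of_int (n y) * (2 * csc2 (pi * real (s * y) / real d))))" for s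
      using d0 by (simp add: right_diff_distrib sum_distrib_left mult_ac)
    have "\<bar>cos_sum d c j\<bar> \<le> (real d)\<^sup>2 * C" if "j \<in> ?U" for j
    proof -
      have "coprime j d" using that by (simp add: half_units_def)
      then have "\<bar>cos_sum d c j\<bar> = (real d)\<^sup>2 * \<bar>g j / (real d)\<^sup>2 - (\<Sum>y\<in>?U. of_int (n y) * (2 * csc2 (pi * real (j * y) / real d)))\<bar>"
        using d0 by (simp only: c[symmetric] h abs_mult)
      then show ?thesis using n that d0 by (simp add: mult_left_mono)
    qed
    then have "cos_sum d c 1 / (real d)\<^sup>2 \<in> F" unfolding F_def by blast
    moreover have "cos_sum d c 1 / (real d)\<^sup>2 = a - (\<Sum>y\<in>?U. of_int (n y) * (2 * csc2 (pi * real y / real d)))"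
      using c[of 1] h[of 1] g(2) d0 by simp
    ultimately show ?thesis by metis
  qed
  ultimately show ?thesis by blast
qed

section \<open>Seeds, relabelling and seeds of ordered triples\<close>

definition reflect_in :: "aff \<Rightarrow> aff \<Rightarrow> aff" where
  "reflect_in k v = v - aff_form v k *\<^sub>R k"

lemma aff_form_simps:
  "aff_form (f + g) h = aff_form f h + aff_form g h"
  "aff_form h (f + g) = aff_form h f + aff_form h g"
  "aff_form (f - g) h = aff_form f h - aff_form g h"
  "aff_form h (f - g) = aff_form h f - aff_form h g"
  "aff_form (- f) h = - aff_form f h"
  "aff_form h (- f) = - aff_form h f"
  "aff_form (c *\<^sub>R f) h = c * aff_form f h"
  "aff_form h (c *\<^sub>R f) = c * aff_form h f"
  by (simp_all add: aff_form_def inner_add_left inner_add_right inner_diff_left inner_diff_right)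

lemma aff_form_commute: "aff_form f g = aff_form g f"
  by (simp add: aff_form_def inner_commute)

lemma reflect_in_zero: "aff_form v k = 0 \<Longrightarrow> reflect_in k v = v"
  by (simp add: reflect_in_def)

lemma aff_translate_simps:
  "aff_form (aff_translate w f) g = aff_form f g"
  "aff_form f (aff_translate w g) = aff_form f g"
  "aff_translate w (- f) = - aff_translate w f"
  "reflect_in (aff_translate w k) (aff_translate w v) = aff_translate w (reflect_in k v)"
  by (simp_all add: aff_translate_def aff_form_def reflect_in_def prod_eq_iff inner_diff_left inner_add_left algebra_simps)

lemma not_positive_and_negative: "\<not> (positive u v \<and> negative u v)"
proof (cases u)
  case (Point p)
  then show ?thesis by (auto simp: negative_def half_plane_def aff_val_def)
next
  case (Infinitely_far p e)
  show ?thesis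
  proof
    assume "positive u v \<and> negative u v"
    then have "\<forall>\<^sub>F t in at_top. p + t *\<^sub>R e \<in> half_plane v \<and> p + t *\<^sub>R e \<in> half_plane (- v)"
      unfolding Infinitely_far negative_def by (simp add: eventually_conj)
    then have "\<forall>\<^sub>F t in (at_top :: real filter). False"
      by (rule eventually_mono) (auto simp: half_plane_def aff_val_def)
    then show False by (simp add: eventually_False)
  qed
qed

lemma positive_minus: "positive u (- v) = negative u v" "negative u (- v) = positive u v"
  by (simp_all add: negative_def)

lemma relabel_nth [simp]:
  "fst (relabel \<sigma> s) $ i = fst s $ \<sigma> i" "snd (relabel \<sigma> s) $ i $ j = snd s $ \<sigma> i $ \<sigma> j"
  by (simp_all add: relabel_def)

lemma seed_eqI:
  assumes "\<And>i. fst s $ i = fst t $ i" "\<And>i j. snd s $ i $ j = snd t $ i $ j"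
  shows "s = t"
  using assms by (simp add: prod_eq_iff vec_eq_iff)

lemma relabel_relabel: "relabel \<sigma> (relabel \<tau> s) = relabel (\<tau> \<circ> \<sigma>) s"
  by (rule seed_eqI) simp_all

lemma relabel_id: "relabel (\<lambda>i. i) s = s"
  by (rule seed_eqI) simp_all

lemma unlabelled_relabel:
  assumes "bij \<sigma>"
  shows "unlabelled (relabel \<sigma> s) = unlabelled s"
proof (intro equalityI subsetI)
  fix t assume "t \<in> unlabelled (relabel \<sigma> s)"
  then obtain \<tau> where "bij \<tau>" "t = relabel \<tau> (relabel \<sigma> s)" by (auto simp: unlabelled_def)
  then show "t \<in> unlabelled s" using assms by (auto simp: unlabelled_def relabel_relabel intro: bij_comp)
next
  fix t assume "t \<in> unlabelled s"
  then obtain \<tau> where \<tau>: "bij \<tau>" "t = relabel \<tau> s" by (auto simp: unlabelled_def)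
  have "t = relabel (inv \<sigma> \<circ> \<tau>) (relabel \<sigma> s)"
    using \<tau> assms by (simp add: relabel_relabel o_def surj_f_inv_f bij_is_surj)
  moreover have "bij (inv \<sigma> \<circ> \<tau>)" using \<tau> assms by (simp add: bij_comp bij_imp_bij_inv)
  ultimately show "t \<in> unlabelled (relabel \<sigma> s)" by (auto simp: unlabelled_def)
qed

lemma mutate_nth:
  "fst (mutate u k s) $ i = (if i = k then - fst s $ k
      else if (positive u (fst s $ k) \<and> snd s $ i $ k < 0) \<or> (negative u (fst s $ k) \<and> snd s $ i $ k > 0)
           then reflect_in (fst s $ k) (fst s $ i) else fst s $ i)"
  "snd (mutate u k s) $ i $ j = (if i = k \<or> j = k then - snd s $ i $ j
     else snd s $ i $ j + (snd s $ i $ k * \<bar>snd s $ k $ j\<bar> + \<bar>snd s $ i $ k\<bar> * snd s $ k $ j) / 2)"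
  by (auto simp: mutate_def Let_def mutate_matrix_def reflect_in_def)

text \<open>Mutation is natural in the labelling, which allows vertices of the exchange graph to be studied on
any convenient labelling.\<close>

lemma mutate_relabel:
  assumes "bij \<sigma>"
  shows "mutate u k (relabel \<sigma> s) = relabel \<sigma> (mutate u (\<sigma> k) s)"
proof -
  have "\<sigma> i = \<sigma> j \<longleftrightarrow> i = j" for i j using assms by (metis bij_is_inj injD)
  then show ?thesis by (intro seed_eqI) (simp_all add: mutate_nth)
qed

text \<open>The mutated vector changes its sign and so do the entries of its row and column; the reflection
is therefore applied to the same vectors as before and undoes itself.\<close>

lemma mutate_involutive:
  assumes "aff_form (fst s $ k) (fst s $ k) = 2"
  shows "mutate u k (mutate u k s) = s"
proof (rule seed_eqI)
  fix i
  have r: "reflect_in (- k) (reflect_in k v) = v" if "aff_form k k = 2" for k v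
    using that by (simp add: reflect_in_def aff_form_simps algebra_simps)
  show "fst (mutate u k (mutate u k s)) $ i = fst s $ i"
    by (auto simp: mutate_nth positive_minus r[OF assms])
next
  fix i j
  show "snd (mutate u k (mutate u k s)) $ i $ j = snd s $ i $ j"
    by (simp add: mutate_nth field_simps)
qed

lemma seed_translate_nth [simp]:
  "fst (seed_translate w s) $ i = aff_translate w (fst s $ i)"
  "snd (seed_translate w s) = snd s"
  by (simp_all add: seed_translate_def)

lemma seed_translate_relabel: "seed_translate w (relabel \<sigma> s) = relabel \<sigma> (seed_translate w s)"
  by (rule seed_eqI) simp_all

text \<open>Apart from the reference point every ingredient of a mutation is invariant under translations, and the
reference point enters only by the sign of the \<open>k\<close>-th vector.\<close>

lemma mutate_translate:
  assumes "positive u (aff_translate w (fst s $ k)) = positive u (fst s $ k)"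
    and "negative u (aff_translate w (fst s $ k)) = negative u (fst s $ k)"
  shows "mutate u k (seed_translate w s) = seed_translate w (mutate u k s)"
  by (rule seed_eqI) (simp_all add: mutate_nth aff_translate_simps assms)

lemma seed_translate_add: "seed_translate w (seed_translate w' s) = seed_translate (w + w') s"
  by (rule seed_eqI) (simp_all add: aff_translate_def inner_add_right)

lemma seed_translate_zero [simp]: "seed_translate 0 s = s"
  by (rule seed_eqI) (simp_all add: aff_translate_def)

lemma seed_translate_unlabelled: "seed_translate w ` unlabelled s = unlabelled (seed_translate w s)"
  unfolding unlabelled_def by (auto simp: seed_translate_relabel[symmetric])

text \<open>The seed of an ordered triple whose matrix is read off from the form: the entry at
\<open>i < j\<close> is the negated value of the form. All seeds of the orbit have this shape after relabelling.\<close>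

definition triple_seed :: "aff \<Rightarrow> aff \<Rightarrow> aff \<Rightarrow> 3 seed" where
  "triple_seed p q r = ((\<chi> i. if i = 1 then p else if i = 2 then q else r),
     (\<chi> i j. if i = 1 \<and> j = 2 then - aff_form p q else if i = 2 \<and> j = 1 then aff_form p q
        else if i = 2 \<and> j = 3 then - aff_form q r else if i = 3 \<and> j = 2 then aff_form q r
        else if i = 1 \<and> j = 3 then - aff_form p r else if i = 3 \<and> j = 1 then aff_form p r else 0))"

definition perm3 :: "3 \<Rightarrow> 3 \<Rightarrow> 3 \<Rightarrow> 3 \<Rightarrow> 3" where
  "perm3 a b c i = (if i = 1 then a else if i = 2 then b else c)"

lemma bij_perm3:
  assumes "a \<noteq> b" "a \<noteq> c" "b \<noteq> c"
  shows "bij (perm3 a b c)"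
proof -
  have "inj (perm3 a b c)"
  proof (rule injI)
    fix x y assume "perm3 a b c x = perm3 a b c y"
    then show "x = y" using assms exhaust_3[of x] exhaust_3[of y] by (auto simp: perm3_def split: if_splits)
  qed
  then show ?thesis by (simp add: bij_def finite_UNIV_inj_surj)
qed

lemma translate_triple_seed:
  "seed_translate w (triple_seed p q r) = triple_seed (aff_translate w p) (aff_translate w q) (aff_translate w r)"
  by (rule seed_eqI) (simp_all add: triple_seed_def aff_translate_simps)

lemma triple_seed_nth [simp]:
  "fst (triple_seed p q r) $ 1 = p" "fst (triple_seed p q r) $ 2 = q" "fst (triple_seed p q r) $ 3 = r"
  by (simp_all add: triple_seed_def)

lemma triple_seed_entries [simp]:
  "snd (triple_seed p q r) $ 1 $ 1 = 0" "snd (triple_seed p q r) $ 2 $ 2 = 0" "snd (triple_seed p q r) $ 3 $ 3 = 0"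
  "snd (triple_seed p q r) $ 1 $ 2 = - aff_form p q" "snd (triple_seed p q r) $ 2 $ 1 = aff_form p q"
  "snd (triple_seed p q r) $ 2 $ 3 = - aff_form q r" "snd (triple_seed p q r) $ 3 $ 2 = aff_form q r"
  "snd (triple_seed p q r) $ 1 $ 3 = - aff_form p r" "snd (triple_seed p q r) $ 3 $ 1 = aff_form p r"
  by (simp_all add: triple_seed_def)

lemma seed3_eqI:
  fixes s t :: "3 seed"
  assumes "fst s $ 1 = fst t $ 1" "fst s $ 2 = fst t $ 2" "fst s $ 3 = fst t $ 3"
    "snd s $ 1 $ 1 = snd t $ 1 $ 1" "snd s $ 1 $ 2 = snd t $ 1 $ 2" "snd s $ 1 $ 3 = snd t $ 1 $ 3"
    "snd s $ 2 $ 1 = snd t $ 2 $ 1" "snd s $ 2 $ 2 = snd t $ 2 $ 2" "snd s $ 2 $ 3 = snd t $ 2 $ 3"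
    "snd s $ 3 $ 1 = snd t $ 3 $ 1" "snd s $ 3 $ 2 = snd t $ 3 $ 2" "snd s $ 3 $ 3 = snd t $ 3 $ 3"
  shows "s = t"
proof -
  have "\<forall>i. fst s $ i = fst t $ i" "\<forall>i j. snd s $ i $ j = snd t $ i $ j"
    unfolding forall_3 using assms by simp_all
  then show ?thesis by (intro seed_eqI) simp_all
qed

lemma reflect_forms:
  assumes "aff_form k k = 2"
  shows "aff_form (reflect_in k f) g = aff_form f g - aff_form f k * aff_form k g"
    and "aff_form g (reflect_in k f) = aff_form f g - aff_form f k * aff_form k g"
  by (simp_all add: reflect_in_def aff_form_simps aff_form_commute[of g])

context
  fixes p q r :: aff
  assumes norms: "aff_form p p = 2" "aff_form q q = 2" "aff_form r r = 2"
    and pq: "aff_form p q \<le> 0" and qr: "aff_form q r \<le> 0"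
begin

text \<open>The six lemmas from here on describe mutation of an ordered triple, depending on the mutated vector and
its sign. Each time the result is again an ordered triple, written in the order in
which the product of the three reflections is the old one: the mutations are Hurwitz moves, possibly two
of them, on this factorisation.\<close>

lemma mutate_middle_positive:
  assumes "positive u q"
  shows "mutate u 2 (triple_seed p q r) = relabel (perm3 1 3 2) (triple_seed p (reflect_in q r) (- q))"
proof -
  have n: "\<not> negative u q" using assms not_positive_and_negative by blast
  have z: "aff_form q r = 0 \<Longrightarrow> reflect_in q r = r"
    by (auto intro: reflect_in_zero simp: aff_form_commute)
  have c: "aff_form r q = aff_form q r" by (rule aff_form_commute)+
  show ?thesis
    by (rule seed3_eqI)
      (use assms n pq qr z in \<open>simp_all add: mutate_nth perm3_def reflect_forms norms aff_form_simps
         aff_form_commute[of r q] aff_form_commute[of r p] aff_form_commute[of q p] abs_of_nonpos abs_of_nonneg algebra_simps not_less\<close>)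
qed

lemma mutate_middle_negative:
  assumes "negative u q"
  shows "mutate u 2 (triple_seed p q r) = relabel (perm3 2 1 3) (triple_seed (- q) (reflect_in q p) r)"
proof -
  have n: "\<not> positive u q" using assms not_positive_and_negative by blast
  have z: "aff_form q p = 0 \<Longrightarrow> reflect_in q p = p"
    by (auto intro: reflect_in_zero simp: aff_form_commute)
  have c: "aff_form p q = aff_form q p" by (rule aff_form_commute)+
  show ?thesis
    by (rule seed3_eqI)
      (use assms n pq qr z in \<open>simp_all add: mutate_nth perm3_def reflect_forms norms aff_form_simps
         aff_form_commute[of r q] aff_form_commute[of r p] aff_form_commute[of q p] abs_of_nonpos abs_of_nonneg algebra_simps not_less\<close>)
qed

lemma mutate_first_acute:
  assumes "positive u p" "aff_form p r \<le> 0"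
  shows "mutate u 1 (triple_seed p q r) = relabel (perm3 3 1 2) (triple_seed (reflect_in p q) (reflect_in p r) (- p))"
proof -
  have n: "\<not> negative u p" using assms not_positive_and_negative by blast
  have z: "aff_form p q = 0 \<Longrightarrow> reflect_in p q = q" "aff_form p r = 0 \<Longrightarrow> reflect_in p r = r"
    by (auto intro: reflect_in_zero simp: aff_form_commute)
  have c: "aff_form q p = aff_form p q" "aff_form r p = aff_form p r" by (rule aff_form_commute)+
  show ?thesis
    by (rule seed3_eqI)
      (use assms n pq qr z in \<open>simp_all add: mutate_nth perm3_def reflect_forms norms aff_form_simps
         aff_form_commute[of r q] aff_form_commute[of r p] aff_form_commute[of q p] abs_of_nonpos abs_of_nonneg algebra_simps not_less\<close>)
qed

lemma mutate_first_obtuse: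
  assumes "positive u p" "aff_form p r \<ge> 0"
  shows "mutate u 1 (triple_seed p q r) = relabel (perm3 2 1 3) (triple_seed (reflect_in p q) (- p) r)"
proof -
  have n: "\<not> negative u p" using assms not_positive_and_negative by blast
  have z: "aff_form p q = 0 \<Longrightarrow> reflect_in p q = q"
    by (auto intro: reflect_in_zero simp: aff_form_commute)
  have c: "aff_form q p = aff_form p q" by (rule aff_form_commute)+
  show ?thesis
    by (rule seed3_eqI)
      (use assms n pq qr z in \<open>simp_all add: mutate_nth perm3_def reflect_forms norms aff_form_simps
         aff_form_commute[of r q] aff_form_commute[of r p] aff_form_commute[of q p] abs_of_nonpos abs_of_nonneg algebra_simps not_less\<close>)
qed

lemma mutate_last_acute:
  assumes "negative u r" "aff_form p r \<le> 0"
  shows "mutate u 3 (triple_seed p q r) = relabel (perm3 2 3 1) (triple_seed (- r) (reflect_in r p) (reflect_in r q))"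
proof -
  have n: "\<not> positive u r" using assms not_positive_and_negative by blast
  have z: "aff_form r p = 0 \<Longrightarrow> reflect_in r p = p" "aff_form r q = 0 \<Longrightarrow> reflect_in r q = q"
    by (auto intro: reflect_in_zero simp: aff_form_commute)
  have c: "aff_form p r = aff_form r p" "aff_form q r = aff_form r q" by (rule aff_form_commute)+
  show ?thesis
    by (rule seed3_eqI)
      (use assms n pq qr z in \<open>simp_all add: mutate_nth perm3_def reflect_forms norms aff_form_simps
         aff_form_commute[of r q] aff_form_commute[of r p] aff_form_commute[of q p] abs_of_nonpos abs_of_nonneg algebra_simps not_less\<close>)
qed

lemma mutate_last_obtuse:
  assumes "negative u r" "aff_form p r \<ge> 0"
  shows "mutate u 3 (triple_seed p q r) = relabel (perm3 1 3 2) (triple_seed p (- r) (reflect_in r q))"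
proof -
  have n: "\<not> positive u r" using assms not_positive_and_negative by blast
  have z: "aff_form r q = 0 \<Longrightarrow> reflect_in r q = q"
    by (auto intro: reflect_in_zero simp: aff_form_commute)
  have c: "aff_form q r = aff_form r q" by (rule aff_form_commute)+
  show ?thesis
    by (rule seed3_eqI)
      (use assms n pq qr z in \<open>simp_all add: mutate_nth perm3_def reflect_forms norms aff_form_simps
         aff_form_commute[of r q] aff_form_commute[of r p] aff_form_commute[of q p] abs_of_nonpos abs_of_nonneg algebra_simps not_less\<close>)
qed

end

section \<open>Triples in normal form and the signs forced by the domains\<close>

lemma aff_val_simps:
  "aff_val (- f) z = - aff_val f z"
  "aff_val (reflect_in k f) z = aff_val f z - aff_form f k * aff_val k z"
  by (simp_all add: aff_val_def reflect_in_def algebra_simps inner_diff_right)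

lemma coprime_gcd_iff:
  "coprime (gcd x y) d \<longleftrightarrow> (\<forall>g. g dvd x \<and> g dvd y \<and> g dvd d \<longrightarrow> g = (1::nat))"
  unfolding coprime_def by auto

text \<open>The normal vectors lie in no open half-plane. Triangles and half-strips have this property because they
are bounded in some direction.\<close>

definition in_no_cone :: "('n::finite) seed \<Rightarrow> bool" where
  "in_no_cone s \<longleftrightarrow> (\<nexists>z. \<forall>i. fst (fst s $ i) \<bullet> z < 0)"

text \<open>The axis of the glide reflection is the line through \<open>z0\<close> directed by \<open>e\<close>, and the glide is the
translation by \<open>sqrt 2 * \<Delta>\<close> along \<open>e\<close>.\<close>

locale affine_frame =
  fixes e n z0 :: "real^2" and \<Delta> :: real and d :: nat
  assumes e1: "e \<bullet> e = 1" and n1: "n \<bullet> n = 1" and en: "e \<bullet> n = 0" and d3: "d \<ge> 3"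
begin

text \<open>The vector of square length \<open>2\<close> at the angle \<open>\<theta>\<close> from \<open>n\<close> towards \<open>e\<close>; for \<open>\<epsilon> = -1\<close> it is
mirrored in the axis.\<close>

definition normal :: "real \<Rightarrow> real \<Rightarrow> real^2" where
  "normal \<epsilon> \<theta> = sqrt 2 *\<^sub>R ((\<epsilon> * cos \<theta>) *\<^sub>R n + sin \<theta> *\<^sub>R e)"

definition ang :: "nat \<Rightarrow> real" where
  "ang k = pi * real k / real d"

text \<open>The normal form of an ordered triple. The normal vectors are those for which the linear part
of the product of the reflections in \<open>p\<close>, \<open>q\<close>, \<open>r\<close> is the reflection in the direction of the axis. The
last two equations say that the axis of this product passes through \<open>z0\<close> and that the signed length of
its glide is \<open>sqrt 2 * \<Delta>\<close>. The numerators \<open>x\<close> and \<open>y\<close> may vanish, namely for half-strips,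
and their common divisors are coprime to \<open>d\<close> because \<open>d\<close> is the least common
denominator of the angles.\<close>

definition formatted :: "real \<Rightarrow> nat \<Rightarrow> nat \<Rightarrow> aff \<Rightarrow> aff \<Rightarrow> aff \<Rightarrow> bool" where
  "formatted \<epsilon> x y p q r \<longleftrightarrow> (\<epsilon> = 1 \<or> \<epsilon> = -1) \<and> 2 * x \<le> d \<and> 2 * y \<le> d \<and> coprime (gcd x y) d \<and>
     fst p = normal \<epsilon> (pi + ang y) \<and> fst q = normal \<epsilon> (ang y - ang x) \<and> fst r = normal \<epsilon> (pi - ang x) \<and>
     cos (ang y) * aff_val p z0 + cos (ang x + ang y) * aff_val q z0 + cos (ang x) * aff_val r z0 = 0 \<and>
     sin (ang y) * aff_val p z0 + sin (ang x + ang y) * aff_val q z0 + sin (ang x) * aff_val r z0 = \<Delta>"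

lemma d0: "d > 0" using d3 by simp

lemma ang_simps:
  "ang (x + y) = ang x + ang y" "y \<le> x \<Longrightarrow> ang (x - y) = ang x - ang y"
  "ang d = pi" "ang 0 = 0" "ang x \<ge> 0"
  using d0 by (auto simp: ang_def field_simps of_nat_diff)

lemma ang_le: "2 * x \<le> d \<Longrightarrow> ang x \<le> pi / 2"
proof -
  assume "2 * x \<le> d"
  then have "real (2 * x) \<le> real d" by (simp only: of_nat_le_iff)
  then show ?thesis using d0 by (simp add: ang_def field_simps)
qed

lemma ang_less_iff: "ang x < ang y \<longleftrightarrow> x < y"
  using d0 by (simp add: ang_def field_simps)

lemma ang_half_iff: "ang x + ang y < pi / 2 \<longleftrightarrow> 2 * (x + y) < d"
proof -
  have "ang x + ang y < pi / 2 \<longleftrightarrow> pi * (2 * (real x + real y)) < pi * real d"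
    using d0 by (simp add: ang_def field_simps)
  also have "\<dots> \<longleftrightarrow> real (2 * (x + y)) < real d" by simp
  also have "\<dots> \<longleftrightarrow> 2 * (x + y) < d" by (simp only: of_nat_less_iff)
  finally show ?thesis .
qed

lemma inner_normal:
  assumes "\<epsilon> = 1 \<or> \<epsilon> = -1"
  shows "normal \<epsilon> \<theta> \<bullet> normal \<epsilon> \<phi> = 2 * cos (\<theta> - \<phi>)"
  using assms e1 n1 en by (auto simp: normal_def inner_add_left inner_add_right inner_commute[of n e] cos_diff algebra_simps)

lemma normal_neg: "- normal \<epsilon> \<theta> = normal \<epsilon> (\<theta> + pi)"
  by (simp add: normal_def algebra_simps)

lemma normal_periodic: "normal \<epsilon> (\<theta> + 2 * pi) = normal \<epsilon> \<theta>"
  by (simp add: normal_def)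

lemma normal_flip: "normal (- \<epsilon>) \<theta> = normal \<epsilon> (pi - \<theta>)"
  by (simp add: normal_def)

lemma normal_reflect:
  "normal \<epsilon> \<theta> - (2 * cos (\<theta> - \<phi>)) *\<^sub>R normal \<epsilon> \<phi> = normal \<epsilon> (2 * \<phi> - \<theta> + pi)"
proof -
  have 1: "cos \<theta> - 2 * cos (\<theta> - \<phi>) * cos \<phi> = cos (2 * \<phi> - \<theta> + pi)"
    unfolding cos_periodic_pi using cos_add[of "\<theta> - \<phi>" \<phi>] cos_diff[of "\<theta> - \<phi>" \<phi>] cos_minus[of "2 * \<phi> - \<theta>"]
    by (simp add: algebra_simps)
  have 2: "sin \<theta> - 2 * cos (\<theta> - \<phi>) * sin \<phi> = sin (2 * \<phi> - \<theta> + pi)"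
    unfolding sin_periodic_pi using sin_add[of "\<theta> - \<phi>" \<phi>] sin_diff[of "\<theta> - \<phi>" \<phi>] sin_minus[of "2 * \<phi> - \<theta>"]
    by (simp add: algebra_simps)
  have "normal \<epsilon> \<theta> - (2 * cos (\<theta> - \<phi>)) *\<^sub>R normal \<epsilon> \<phi> =
     sqrt 2 *\<^sub>R ((\<epsilon> * (cos \<theta> - 2 * cos (\<theta> - \<phi>) * cos \<phi>)) *\<^sub>R n + (sin \<theta> - 2 * cos (\<theta> - \<phi>) * sin \<phi>) *\<^sub>R e)"
    by (simp add: normal_def algebra_simps)
  then show ?thesis unfolding 1 2 normal_def .
qed

lemma fst_reflect:
  assumes "\<epsilon> = 1 \<or> \<epsilon> = -1" "fst k = normal \<epsilon> \<phi>" "fst f = normal \<epsilon> \<theta>"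
  shows "fst (reflect_in k f) = normal \<epsilon> (2 * \<phi> - \<theta> + pi)"
  using assms by (simp add: reflect_in_def aff_form_def inner_normal normal_reflect)

lemma formatted_forms:
  assumes "formatted \<epsilon> x y p q r"
  shows "aff_form p p = 2" "aff_form q q = 2" "aff_form r r = 2"
    "aff_form p q = - 2 * cos (ang x)" "aff_form q r = - 2 * cos (ang y)" "aff_form p r = 2 * cos (ang x + ang y)"
  using assms unfolding formatted_def aff_form_def by (auto simp: inner_normal algebra_simps cos_diff)

lemma formatted_nonpos:
  assumes "formatted \<epsilon> x y p q r"
  shows "aff_form p q \<le> 0" "aff_form q r \<le> 0"
  using assms ang_le[of x] ang_le[of y] ang_simps(5)[of x] ang_simps(5)[of y]
  by (auto simp: formatted_forms[OF assms] formatted_def intro!: cos_ge_zero)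

lemma trig_product:
  "2 * cos a * cos b = cos (a + b) + cos (a - b)" "2 * sin a * cos b = sin (a + b) + sin (a - b)" for a b :: real
  by (simp_all add: cos_add cos_diff sin_add sin_diff)

text \<open>This lemma and the following five verify that the normal form survives the six kinds of mutation. The
middle mutations perform a step of the subtractive Euclidean algorithm on \<open>(x, y)\<close>, the outer ones at an
obtuse or right third angle undo such a step, and the outer ones at an acute or right third angle permute
the three angles cyclically and move the triangle to the other side of the axis.\<close>

lemma formatted_middle_pos:
  assumes f: "formatted \<epsilon> x y p q r" and le: "y \<le> x"
  shows "formatted \<epsilon> (x - y) y p (reflect_in q r) (- q)"
proof -
  note F = f[unfolded formatted_def]
  have 1: "fst (reflect_in q r) = normal \<epsilon> (2 * (ang y - ang x) - (pi - ang x) + pi)"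
    using F by (intro fst_reflect) auto
  have 2: "fst (- q) = normal \<epsilon> (ang y - ang x + pi)"
    using F by (simp add: normal_neg)
  have "coprime (gcd (x - y) y) d" using F le by (simp add: gcd_diff1_nat)
  moreover have "cos (ang y) * aff_val p z0 + cos (ang x) * (aff_val r z0 - - 2 * cos (ang y) * aff_val q z0) + cos (ang x - ang y) * (- aff_val q z0) = 0"
    using F by (simp add: cos_add cos_diff algebra_simps)
  moreover have "sin (ang y) * aff_val p z0 + sin (ang x) * (aff_val r z0 - - 2 * cos (ang y) * aff_val q z0) + sin (ang x - ang y) * (- aff_val q z0) = \<Delta>"
    using F by (simp add: sin_add sin_diff algebra_simps)
  ultimately show ?thesis
    unfolding formatted_def 1 2 aff_val_simps aff_form_commute[of r q] formatted_forms[OF f] ang_simps(2)[OF le]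
    using F le by (auto simp: algebra_simps)
qed

lemma formatted_middle_neg:
  assumes f: "formatted \<epsilon> x y p q r" and le: "x \<le> y"
  shows "formatted \<epsilon> x (y - x) (- q) (reflect_in q p) r"
proof -
  note F = f[unfolded formatted_def]
  have "fst (reflect_in q p) = normal \<epsilon> (2 * (ang y - ang x) - (pi + ang y) + pi)"
    using F by (intro fst_reflect) auto
  then have 1: "fst (reflect_in q p) = normal \<epsilon> (ang y - ang x - ang x)"
    by (simp add: algebra_simps)
  have 2: "fst (- q) = normal \<epsilon> (pi + (ang y - ang x))"
    using F by (simp add: normal_neg algebra_simps)
  have "coprime (gcd x (y - x)) d" using F le by (simp add: gcd.commute[of x] gcd_diff1_nat)
  moreover have "cos (ang y - ang x) * (- aff_val q z0) + cos (ang y) * (aff_val p z0 - - 2 * cos (ang x) * aff_val q z0) + cos (ang x) * aff_val r z0 = 0"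
    using F by (simp add: cos_add cos_diff algebra_simps)
  moreover have "sin (ang y - ang x) * (- aff_val q z0) + sin (ang y) * (aff_val p z0 - - 2 * cos (ang x) * aff_val q z0) + sin (ang x) * aff_val r z0 = \<Delta>"
    using F by (simp add: sin_add sin_diff algebra_simps)
  ultimately show ?thesis
    unfolding formatted_def 1 2 aff_val_simps formatted_forms[OF f] ang_simps(2)[OF le]
    using F le by (auto simp: algebra_simps)
qed

lemma formatted_first_obtuse:
  assumes f: "formatted \<epsilon> x y p q r" and le: "2 * (x + y) \<le> d"
  shows "formatted \<epsilon> x (x + y) (reflect_in p q) (- p) r"
proof -
  note F = f[unfolded formatted_def]
  have "fst (reflect_in p q) = normal \<epsilon> (2 * (pi + ang y) - (ang y - ang x) + pi)"
    using F by (intro fst_reflect) auto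
  also have "\<dots> = normal \<epsilon> (pi + (ang x + ang y) + 2 * pi)" by (simp add: algebra_simps)
  finally have 1: "fst (reflect_in p q) = normal \<epsilon> (pi + (ang x + ang y))" unfolding normal_periodic .
  have "fst (- p) = normal \<epsilon> (ang x + ang y - ang x + 2 * pi)"
    using F by (simp add: normal_neg algebra_simps)
  then have 2: "fst (- p) = normal \<epsilon> (ang x + ang y - ang x)" unfolding normal_periodic .
  have "coprime (gcd x (x + y)) d" using F by (simp add: gcd_add2)
  moreover have "cos (ang x + ang y) * (aff_val q z0 - - 2 * cos (ang x) * aff_val p z0) + cos (ang x + (ang x + ang y)) * (- aff_val p z0) + cos (ang x) * aff_val r z0 = 0"
    using F trig_product(1)[of "ang x + ang y" "ang x"] by (simp add: algebra_simps)
  moreover have "sin (ang x + ang y) * (aff_val q z0 - - 2 * cos (ang x) * aff_val p z0) + sin (ang x + (ang x + ang y)) * (- aff_val p z0) + sin (ang x) * aff_val r z0 = \<Delta>"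
    using F trig_product(2)[of "ang x + ang y" "ang x"] by (simp add: algebra_simps)
  ultimately show ?thesis
    unfolding formatted_def 1 2 aff_val_simps aff_form_commute[of q p] formatted_forms[OF f] ang_simps(1)
    using F le by (auto simp: algebra_simps)
qed

lemma formatted_last_obtuse:
  assumes f: "formatted \<epsilon> x y p q r" and le: "2 * (x + y) \<le> d"
  shows "formatted \<epsilon> (x + y) y p (- r) (reflect_in r q)"
proof -
  note F = f[unfolded formatted_def]
  have "fst (reflect_in r q) = normal \<epsilon> (2 * (pi - ang x) - (ang y - ang x) + pi)"
    using F by (intro fst_reflect) auto
  also have "\<dots> = normal \<epsilon> (pi - (ang x + ang y) + 2 * pi)" by (simp add: algebra_simps)
  finally have 1: "fst (reflect_in r q) = normal \<epsilon> (pi - (ang x + ang y))" unfolding normal_periodic .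
  have "fst (- r) = normal \<epsilon> (ang y - (ang x + ang y) + 2 * pi)"
    using F by (simp add: normal_neg algebra_simps)
  then have 2: "fst (- r) = normal \<epsilon> (ang y - (ang x + ang y))" unfolding normal_periodic .
  have "coprime (gcd (x + y) y) d" using F by (simp add: gcd_add1)
  moreover have "cos (ang y) * aff_val p z0 + cos (ang x + ang y + ang y) * (- aff_val r z0) + cos (ang x + ang y) * (aff_val q z0 - - 2 * cos (ang y) * aff_val r z0) = 0"
    using F trig_product(1)[of "ang x + ang y" "ang y"] by (simp add: algebra_simps)
  moreover have "sin (ang y) * aff_val p z0 + sin (ang x + ang y + ang y) * (- aff_val r z0) + sin (ang x + ang y) * (aff_val q z0 - - 2 * cos (ang y) * aff_val r z0) = \<Delta>"
    using F trig_product(2)[of "ang x + ang y" "ang y"] by (simp add: algebra_simps)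
  ultimately show ?thesis
    unfolding formatted_def 1 2 aff_val_simps formatted_forms[OF f] ang_simps(1)
    using F le by (auto simp: algebra_simps)
qed

text \<open>Excludes parallel outer sides and half-strips with right angles: in both cases some numerator \<open>k\<close> with
\<open>2 k = d\<close> would be coprime to \<open>d\<close>, which is possible for \<open>d = 2\<close> only.\<close>

lemma shape_bounds:
  assumes "2 * x \<le> d" "2 * y \<le> d" "coprime (gcd x y) d"
  shows "x + y < d" "0 < x + y" "x = 0 \<Longrightarrow> 2 * y < d" "y = 0 \<Longrightarrow> 2 * x < d"
proof -
  have half: False if "2 * k = d" "coprime k d" for k
  proof -
    from that(1) have "k dvd d" by auto
    then have "k = 1" using that(2) by (metis coprime_common_divisor_nat dvd_refl)
    then show False using that(1) d3 by simp
  qed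
  show "x + y < d"
  proof (rule ccontr)
    assume "\<not> x + y < d"
    then have "2 * x = d" "x = y" using assms by auto
    then show False using half[of x] assms(3) by simp
  qed
  show "0 < x + y" using assms(3) d3 by (auto intro: ccontr)
  show "x = 0 \<Longrightarrow> 2 * y < d" using half[of y] assms by (auto intro: ccontr simp: le_less)
  show "y = 0 \<Longrightarrow> 2 * x < d" using half[of x] assms by (auto intro: ccontr simp: le_less)
qed

lemma formatted_bounds:
  assumes "formatted \<epsilon> x y p q r"
  shows "x + y < d" "0 < x + y" "x = 0 \<Longrightarrow> 2 * y < d" "y = 0 \<Longrightarrow> 2 * x < d"
  using shape_bounds[of x y] assms unfolding formatted_def by auto

lemma ang_rest: "x + y < d \<Longrightarrow> ang (d - x - y) = pi - (ang x + ang y)"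
  using ang_simps(2)[of "x + y" d] by (simp add: ang_simps)

lemma formatted_first_acute:
  assumes f: "formatted \<epsilon> x y p q r" and le: "d \<le> 2 * (x + y)"
  shows "formatted (- \<epsilon>) y (d - x - y) (reflect_in p q) (reflect_in p r) (- p)"
proof -
  note F = f[unfolded formatted_def]
  note w = ang_rest[OF formatted_bounds(1)[OF f]]
  have "fst (reflect_in p q) = normal \<epsilon> (2 * (pi + ang y) - (ang y - ang x) + pi)"
    using F by (intro fst_reflect) auto
  also have "\<dots> = normal \<epsilon> (pi - (pi + (pi - (ang x + ang y))) + 2 * pi + 2 * pi)" by (simp add: algebra_simps)
  finally have 1: "fst (reflect_in p q) = normal (- \<epsilon>) (pi + (pi - (ang x + ang y)))" unfolding normal_periodic normal_flip .
  have "fst (reflect_in p r) = normal \<epsilon> (2 * (pi + ang y) - (pi - ang x) + pi)"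
    using F by (intro fst_reflect) auto
  also have "\<dots> = normal \<epsilon> (pi - ((pi - (ang x + ang y)) - ang y) + 2 * pi)" by (simp add: algebra_simps)
  finally have 2: "fst (reflect_in p r) = normal (- \<epsilon>) ((pi - (ang x + ang y)) - ang y)" unfolding normal_periodic normal_flip .
  have "fst (- p) = normal \<epsilon> (pi - (pi - ang y) + 2 * pi)"
    using F by (simp add: normal_neg algebra_simps)
  then have 3: "fst (- p) = normal (- \<epsilon>) (pi - ang y)" unfolding normal_periodic normal_flip .
  have "coprime (gcd y (d - x - y)) d"
  proof -
    have "g dvd x" if "g dvd y" "g dvd d - x - y" "g dvd d" for g
    proof -
      have "d = (d - x - y) + y + x" using formatted_bounds(1)[OF f] by simp
      then have "g dvd (d - x - y) + y + x" using that(3) by simp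
      then show ?thesis using that(1,2) by (metis dvd_add dvd_add_right_iff)
    qed
    then show ?thesis using F unfolding coprime_gcd_iff by blast
  qed
  moreover have "cos (pi - (ang x + ang y)) * (aff_val q z0 - - 2 * cos (ang x) * aff_val p z0)
     + cos (ang y + (pi - (ang x + ang y))) * (aff_val r z0 - 2 * cos (ang x + ang y) * aff_val p z0) + cos (ang y) * (- aff_val p z0) = 0"
  proof -
    have "ang y + (pi - (ang x + ang y)) = pi - ang x" by simp
    then show ?thesis using F by (simp only: cos_pi_minus) (simp add: algebra_simps)
  qed
  moreover have "sin (pi - (ang x + ang y)) * (aff_val q z0 - - 2 * cos (ang x) * aff_val p z0)
     + sin (ang y + (pi - (ang x + ang y))) * (aff_val r z0 - 2 * cos (ang x + ang y) * aff_val p z0) + sin (ang y) * (- aff_val p z0) = \<Delta>"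
  proof -
    have *: "ang y + (pi - (ang x + ang y)) = pi - ang x" by simp
    have "sin (ang y) = sin (ang x + ang y) * cos (ang x) - cos (ang x + ang y) * sin (ang x)"
      using sin_diff[of "ang x + ang y" "ang x"] by simp
    then have "2 * (sin (ang y) * aff_val p z0) = 2 * (sin (ang x + ang y) * cos (ang x) - cos (ang x + ang y) * sin (ang x)) * aff_val p z0"
      by simp
    then show ?thesis using F unfolding * sin_pi_minus by (simp add: algebra_simps)
  qed
  ultimately show ?thesis
    unfolding formatted_def 1 2 3 aff_val_simps aff_form_commute[of q p] aff_form_commute[of r p] formatted_forms[OF f] w
    using F le by (auto simp: algebra_simps)
qed

lemma formatted_last_acute:
  assumes f: "formatted \<epsilon> x y p q r" and le: "d \<le> 2 * (x + y)"
  shows "formatted (- \<epsilon>) (d - x - y) x (- r) (reflect_in r p) (reflect_in r q)"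
proof -
  note F = f[unfolded formatted_def]
  note w = ang_rest[OF formatted_bounds(1)[OF f]]
  have "fst (reflect_in r q) = normal \<epsilon> (2 * (pi - ang x) - (ang y - ang x) + pi)"
    using F by (intro fst_reflect) auto
  also have "\<dots> = normal \<epsilon> (pi - (pi - (pi - (ang x + ang y))) + 2 * pi)" by (simp add: algebra_simps)
  finally have 1: "fst (reflect_in r q) = normal (- \<epsilon>) (pi - (pi - (ang x + ang y)))" unfolding normal_periodic normal_flip .
  have "fst (reflect_in r p) = normal \<epsilon> (2 * (pi - ang x) - (pi + ang y) + pi)"
    using F by (intro fst_reflect) auto
  also have "\<dots> = normal \<epsilon> (pi - (ang x - (pi - (ang x + ang y))))" by (simp add: algebra_simps)
  finally have 2: "fst (reflect_in r p) = normal (- \<epsilon>) (ang x - (pi - (ang x + ang y)))" unfolding normal_flip .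
  have "fst (- r) = normal \<epsilon> (pi - (pi + ang x) + 2 * pi)"
    using F by (simp add: normal_neg algebra_simps)
  then have 3: "fst (- r) = normal (- \<epsilon>) (pi + ang x)" unfolding normal_periodic normal_flip .
  have "coprime (gcd (d - x - y) x) d"
  proof -
    have "g dvd y" if "g dvd x" "g dvd d - x - y" "g dvd d" for g
    proof -
      have "d = (d - x - y) + x + y" using formatted_bounds(1)[OF f] by simp
      then have "g dvd (d - x - y) + x + y" using that(3) by simp
      then show ?thesis using that(1,2) by (metis dvd_add dvd_add_right_iff)
    qed
    then show ?thesis using F unfolding coprime_gcd_iff by blast
  qed
  moreover have "cos (ang x) * (- aff_val r z0) + cos ((pi - (ang x + ang y)) + ang x) * (aff_val p z0 - 2 * cos (ang x + ang y) * aff_val r z0)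
     + cos (pi - (ang x + ang y)) * (aff_val q z0 - - 2 * cos (ang y) * aff_val r z0) = 0"
  proof -
    have "(pi - (ang x + ang y)) + ang x = pi - ang y" by simp
    then show ?thesis using F by (simp only: cos_pi_minus) (simp add: algebra_simps)
  qed
  moreover have "sin (ang x) * (- aff_val r z0) + sin ((pi - (ang x + ang y)) + ang x) * (aff_val p z0 - 2 * cos (ang x + ang y) * aff_val r z0)
     + sin (pi - (ang x + ang y)) * (aff_val q z0 - - 2 * cos (ang y) * aff_val r z0) = \<Delta>"
  proof -
    have *: "(pi - (ang x + ang y)) + ang x = pi - ang y" by simp
    have "sin (ang x) = sin (ang x + ang y) * cos (ang y) - cos (ang x + ang y) * sin (ang y)"
      using sin_diff[of "ang x + ang y" "ang y"] by simp
    then have "2 * (sin (ang x) * aff_val r z0) = 2 * (sin (ang x + ang y) * cos (ang y) - cos (ang x + ang y) * sin (ang y)) * aff_val r z0"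
      by simp
    then show ?thesis using F unfolding * sin_pi_minus by (simp add: algebra_simps)
  qed
  ultimately show ?thesis
    unfolding formatted_def 1 2 3 aff_val_simps formatted_forms[OF f] w
    using F le by (auto simp: algebra_simps)
qed

text \<open>Three normal vectors within a right angle of a common direction lie in an open half-plane.\<close>

lemma cone_contradiction:
  fixes s :: "3 seed"
  assumes \<epsilon>: "\<epsilon> = 1 \<or> \<epsilon> = -1" and s: "in_no_cone s"
    and "fst (fst s $ 1) = normal \<epsilon> a" "fst (fst s $ 2) = normal \<epsilon> b" "fst (fst s $ 3) = normal \<epsilon> c"
    and "\<bar>a - m\<bar> < pi / 2" "\<bar>b - m\<bar> < pi / 2" "\<bar>c - m\<bar> < pi / 2"
  shows False
proof -
  have pos: "cos (t - m) > 0" if "\<bar>t - m\<bar> < pi / 2" for t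
    using that by (intro cos_gt_zero_pi; linarith)
  have "\<forall>i. fst (fst s $ i) \<bullet> (- normal \<epsilon> m) < 0"
    unfolding forall_3 using assms pos by (simp add: inner_normal[OF \<epsilon>])
  then show False using s unfolding in_no_cone_def by blast
qed

text \<open>If \<open>p\<close> were negative, its mutation would leave normal vectors at the angles \<open>ang y\<close>,
\<open>ang y - ang x\<close> and either \<open>2 * ang y + ang x\<close> or \<open>pi - ang x\<close>, spread over less than \<open>pi\<close>. Here, and
in the next three lemmas, the common direction is the bisector of the two extreme normal
vectors.\<close>

lemma first_positive:
  assumes f: "formatted \<epsilon> x y p q r" and m: "positive u p \<or> negative u p"
    and cone: "in_no_cone (mutate u 1 (triple_seed p q r))"
  shows "positive u p"
proof (rule ccontr)
  assume np: "\<not> positive u p"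
  then have neg: "negative u p" using m by simp
  note F = f[unfolded formatted_def]
  note b = ang_simps(5)[of x] ang_simps(5)[of y] ang_le[of x] ang_le[of y]
  let ?s = "mutate u 1 (triple_seed p q r)"
  have "fst (- p) = normal \<epsilon> (ang y + 2 * pi)" using F by (simp add: normal_neg algebra_simps)
  then have 1: "fst (fst ?s $ 1) = normal \<epsilon> (ang y)" by (simp add: mutate_nth normal_periodic)
  have 2: "fst (fst ?s $ 2) = normal \<epsilon> (ang y - ang x)"
    using np F formatted_nonpos[OF f] by (simp add: mutate_nth)
  show False
  proof (cases "2 * (x + y) < d")
    case True
    then have lt: "ang x + ang y < pi / 2" by (simp only: ang_half_iff)
    then have "cos (ang x + ang y) > 0" using b by (intro cos_gt_zero_pi) auto
    then have "aff_form p r > 0" by (simp add: formatted_forms[OF f])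
    then have "fst (fst ?s $ 3) = fst (reflect_in p r)" using neg by (simp add: mutate_nth)
    also have "\<dots> = normal \<epsilon> (2 * (pi + ang y) - (pi - ang x) + pi)"
      using F by (intro fst_reflect) auto
    also have "\<dots> = normal \<epsilon> (2 * ang y + ang x + 2 * pi)" by (simp add: algebra_simps)
    finally have 3: "fst (fst ?s $ 3) = normal \<epsilon> (2 * ang y + ang x)" unfolding normal_periodic .
    show False
      by (rule cone_contradiction[OF _ cone 1 2 3, of "3 * ang y / 2"]) (use F b lt in auto)
  next
    case False
    then have ge: "ang x + ang y \<ge> pi / 2" using ang_half_iff[of x y] by linarith
    have "y \<noteq> 0" using False formatted_bounds(4)[OF f] by auto
    then have y0: "ang y > 0" using d0 by (simp add: ang_def)
    have "ang x + ang y \<le> pi" using b F by auto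
    then have "cos (ang x + ang y) \<le> 0" using ge cos_monotone_0_pi_le[of "pi / 2" "ang x + ang y"] by simp
    then have "aff_form p r \<le> 0" by (simp add: formatted_forms[OF f])
    then have 3: "fst (fst ?s $ 3) = normal \<epsilon> (pi - ang x)" using np F by (simp add: mutate_nth)
    show False
      by (rule cone_contradiction[OF _ cone 1 2 3, of "(pi + ang y) / 2 - ang x"]) (use F b y0 in \<open>auto simp: abs_less_iff field_simps\<close>)
  qed
qed

lemma last_negative:
  assumes f: "formatted \<epsilon> x y p q r" and m: "positive u r \<or> negative u r"
    and cone: "in_no_cone (mutate u 3 (triple_seed p q r))"
  shows "negative u r"
proof (rule ccontr)
  assume np: "\<not> negative u r"
  then have pos: "positive u r" using m by simp
  note F = f[unfolded formatted_def]
  note b = ang_simps(5)[of x] ang_simps(5)[of y] ang_le[of x] ang_le[of y]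
  let ?s = "mutate u 3 (triple_seed p q r)"
  have "fst (- r) = normal \<epsilon> (- ang x + 2 * pi)" using F by (simp add: normal_neg algebra_simps)
  then have 3: "fst (fst ?s $ 3) = normal \<epsilon> (- ang x)" by (simp only: normal_periodic) (simp add: mutate_nth)
  have 2: "fst (fst ?s $ 2) = normal \<epsilon> (ang y - ang x)"
    using np F formatted_nonpos[OF f] by (simp add: mutate_nth)
  show False
  proof (cases "2 * (x + y) < d")
    case True
    then have lt: "ang x + ang y < pi / 2" by (simp only: ang_half_iff)
    then have "cos (ang x + ang y) > 0" using b by (intro cos_gt_zero_pi) auto
    then have "aff_form p r > 0" by (simp add: formatted_forms[OF f])
    then have "fst (fst ?s $ 1) = fst (reflect_in r p)" using pos by (simp add: mutate_nth)
    also have "\<dots> = normal \<epsilon> (2 * (pi - ang x) - (pi + ang y) + pi)"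
      using F by (intro fst_reflect) auto
    also have "\<dots> = normal \<epsilon> (- 2 * ang x - ang y + 2 * pi)" by (simp add: algebra_simps)
    finally have 1: "fst (fst ?s $ 1) = normal \<epsilon> (- 2 * ang x - ang y)" unfolding normal_periodic .
    show False
      by (rule cone_contradiction[OF _ cone 1 2 3, of "- (3 * ang x / 2)"]) (use F b lt in auto)
  next
    case False
    then have ge: "ang x + ang y \<ge> pi / 2" using ang_half_iff[of x y] by linarith
    have "x \<noteq> 0" using False formatted_bounds(3)[OF f] by auto
    then have x0: "ang x > 0" using d0 by (simp add: ang_def)
    have "ang x + ang y \<le> pi" using b F by auto
    then have "cos (ang x + ang y) \<le> 0" using ge cos_monotone_0_pi_le[of "pi / 2" "ang x + ang y"] by simp
    then have "aff_form p r \<le> 0" by (simp add: formatted_forms[OF f])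
    then have "fst (fst ?s $ 1) = normal \<epsilon> (ang y - pi + 2 * pi)" using np F by (simp add: mutate_nth algebra_simps)
    then have 1: "fst (fst ?s $ 1) = normal \<epsilon> (ang y - pi)" unfolding normal_periodic .
    show False
      by (rule cone_contradiction[OF _ cone 1 2 3, of "ang y - (pi + ang x) / 2"]) (use F b x0 in \<open>auto simp: abs_less_iff field_simps\<close>)
  qed
qed

text \<open>The wrong sign would spread the normal vectors over the angles from \<open>- pi - ang x\<close> to
\<open>ang y - 2 * ang x\<close>, which is less than \<open>pi\<close> because \<open>y < x\<close>.\<close>

lemma middle_positive:
  assumes f: "formatted \<epsilon> x y p q r" and m: "positive u q \<or> negative u q" and lt: "y < x"
    and cone: "in_no_cone (mutate u 2 (triple_seed p q r))"
  shows "positive u q"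
proof (rule ccontr)
  assume np: "\<not> positive u q"
  then have neg: "negative u q" using m by simp
  note F = f[unfolded formatted_def]
  note b = ang_simps(5)[of x] ang_simps(5)[of y] ang_le[of x] ang_le[of y]
  have lt': "ang y < ang x" using lt by (simp add: ang_less_iff)
  let ?s = "mutate u 2 (triple_seed p q r)"
  have "fst (- q) = normal \<epsilon> (ang y - ang x - pi + 2 * pi)" using F by (simp add: normal_neg algebra_simps)
  then have 2: "fst (fst ?s $ 2) = normal \<epsilon> (ang y - ang x - pi)" by (simp only: normal_periodic) (simp add: mutate_nth)
  have "fst (fst ?s $ 3) = normal \<epsilon> (- pi - ang x + 2 * pi)"
    using np F formatted_nonpos[OF f] by (simp add: mutate_nth algebra_simps)
  then have 3: "fst (fst ?s $ 3) = normal \<epsilon> (- pi - ang x)" unfolding normal_periodic .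
  have "reflect_in q p = p" if "aff_form p q = 0" using that by (rule reflect_in_zero)
  then have "fst (fst ?s $ 1) = fst (reflect_in q p)" using neg formatted_nonpos[OF f] by (auto simp: mutate_nth)
  also have "\<dots> = normal \<epsilon> (2 * (ang y - ang x) - (pi + ang y) + pi)"
    using F by (intro fst_reflect) auto
  also have "\<dots> = normal \<epsilon> (ang y - 2 * ang x)" by (simp add: algebra_simps)
  finally have 1: "fst (fst ?s $ 1) = normal \<epsilon> (ang y - 2 * ang x)" .
  show False
    by (rule cone_contradiction[OF _ cone 1 2 3, of "(ang y - 3 * ang x - pi) / 2"]) (use F b lt' in \<open>auto simp: abs_less_iff field_simps\<close>)
qed

lemma middle_negative:
  assumes f: "formatted \<epsilon> x y p q r" and m: "positive u q \<or> negative u q" and lt: "x < y"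
    and cone: "in_no_cone (mutate u 2 (triple_seed p q r))"
  shows "negative u q"
proof (rule ccontr)
  assume np: "\<not> negative u q"
  then have pos: "positive u q" using m by simp
  note F = f[unfolded formatted_def]
  note b = ang_simps(5)[of x] ang_simps(5)[of y] ang_le[of x] ang_le[of y]
  have lt': "ang x < ang y" using lt by (simp add: ang_less_iff)
  let ?s = "mutate u 2 (triple_seed p q r)"
  have 2: "fst (fst ?s $ 2) = normal \<epsilon> (ang y - ang x + pi)" using F by (simp add: normal_neg mutate_nth)
  have 1: "fst (fst ?s $ 1) = normal \<epsilon> (pi + ang y)"
    using np F formatted_nonpos[OF f] by (simp add: mutate_nth)
  have "reflect_in q r = r" if "aff_form q r = 0" using that by (intro reflect_in_zero) (simp add: aff_form_commute)
  then have "fst (fst ?s $ 3) = fst (reflect_in q r)" using pos formatted_nonpos[OF f] by (auto simp: mutate_nth)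
  also have "\<dots> = normal \<epsilon> (2 * (ang y - ang x) - (pi - ang x) + pi)"
    using F by (intro fst_reflect) auto
  also have "\<dots> = normal \<epsilon> (2 * ang y - ang x)" by (simp add: algebra_simps)
  finally have 3: "fst (fst ?s $ 3) = normal \<epsilon> (2 * ang y - ang x)" .
  show False
    by (rule cone_contradiction[OF _ cone 1 2 3, of "(3 * ang y - ang x + pi) / 2"]) (use F b lt' in \<open>auto simp: abs_less_iff field_simps\<close>)
qed

end

section \<open>The orbit, its translations and its shapes\<close>

context affine_frame
begin

lemma normal_inner_e: "normal \<epsilon> \<theta> \<bullet> e = sqrt 2 * sin \<theta>"
  using e1 en by (simp add: normal_def inner_add_left inner_commute[of n e])

lemma aff_val_translate_e: "aff_val (aff_translate (\<tau> *\<^sub>R e) f) z = aff_val f z - \<tau> * (fst f \<bullet> e)"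
  by (simp add: aff_val_def aff_translate_def)

lemma formatted_inner_e:
  assumes "formatted \<epsilon> x y p q r"
  shows "fst p \<bullet> e = - sqrt 2 * sin (ang y)" "fst q \<bullet> e = sqrt 2 * sin (ang y - ang x)" "fst r \<bullet> e = sqrt 2 * sin (ang x)"
  using assms unfolding formatted_def by (simp_all add: normal_inner_e)

text \<open>Translations along the axis commute with the glide reflection.\<close>

lemma formatted_translate:
  assumes f: "formatted \<epsilon> x y p q r"
  shows "formatted \<epsilon> x y (aff_translate (\<tau> *\<^sub>R e) p) (aff_translate (\<tau> *\<^sub>R e) q) (aff_translate (\<tau> *\<^sub>R e) r)"
proof -
  have fst: "fst (aff_translate w g) = fst g" for w g by (simp add: aff_translate_def)
  have c: "cos (ang y) * sin (ang y) - cos (ang x + ang y) * sin (ang y - ang x) - cos (ang x) * sin (ang x) = 0"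
  proof -
    have "(ang y - ang x) + (ang x + ang y) = 2 * ang y" "(ang y - ang x) - (ang x + ang y) = - (2 * ang x)" by simp_all
    then have "2 * sin (ang y - ang x) * cos (ang x + ang y) = sin (2 * ang y) - sin (2 * ang x)"
      using trig_product(2)[of "ang y - ang x" "ang x + ang y"] by simp
    then show ?thesis unfolding sin_double by (simp add: algebra_simps)
  qed
  have "cos (ang x + ang y) * sin (ang y - ang x) = cos (ang y) * sin (ang y) - cos (ang x) * sin (ang x)"
    using c by simp
  then have 1: "sqrt 2 * \<tau> * (cos (ang x + ang y) * sin (ang y - ang x)) = sqrt 2 * \<tau> * (cos (ang y) * sin (ang y) - cos (ang x) * sin (ang x))"
    by simp
  have "sin (ang x + ang y) * sin (ang y - ang x) = (sin (ang y))\<^sup>2 * (cos (ang x))\<^sup>2 - (sin (ang x))\<^sup>2 * (cos (ang y))\<^sup>2"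
    by (simp add: sin_add sin_diff algebra_simps power2_eq_square)
  also have "\<dots> = sin (ang y) * sin (ang y) - sin (ang x) * sin (ang x)"
    unfolding cos_squared_eq by (simp add: algebra_simps power2_eq_square)
  finally have 2: "sqrt 2 * \<tau> * (sin (ang x + ang y) * sin (ang y - ang x)) = sqrt 2 * \<tau> * (sin (ang y) * sin (ang y) - sin (ang x) * sin (ang x))"
    by simp
  show ?thesis using f 1 2
    unfolding formatted_def fst aff_val_translate_e formatted_inner_e[OF f]
    by (simp add: algebra_simps)
qed

lemma ang_sin_pos: "0 < x \<Longrightarrow> x < d \<Longrightarrow> sin (ang x) > 0"
  using d0 by (intro sin_gt_zero) (auto simp: ang_def field_simps)

lemma formatted_sin_nonzero:
  assumes "formatted \<epsilon> x y p q r"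
  shows "y \<noteq> 0 \<Longrightarrow> sin (ang y) > 0" "x \<noteq> 0 \<Longrightarrow> sin (ang x) > 0"
  using formatted_bounds(1)[OF assms] by (auto intro!: ang_sin_pos)

text \<open>Equal \<open>\<epsilon>\<close>, \<open>x\<close>, \<open>y\<close> give equal normal vectors, so only the constant terms can differ. The two
equations of the normal form leave a one-dimensional space of differences, which the translations along
the axis fill.\<close>

lemma formatted_unique_translate:
  assumes f: "formatted \<epsilon> x y p q r" and f': "formatted \<epsilon> x y p' q' r'"
  shows "\<exists>\<tau>. p' = aff_translate (\<tau> *\<^sub>R e) p \<and> q' = aff_translate (\<tau> *\<^sub>R e) q \<and> r' = aff_translate (\<tau> *\<^sub>R e) r"
proof -
  note F = f[unfolded formatted_def] and F' = f'[unfolded formatted_def]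
  define a b c where abc: "a = aff_val p' z0 - aff_val p z0" "b = aff_val q' z0 - aff_val q z0" "c = aff_val r' z0 - aff_val r z0"
  have C: "cos (ang y) * a + cos (ang x + ang y) * b + cos (ang x) * c = 0"
    and S: "sin (ang y) * a + sin (ang x + ang y) * b + sin (ang x) * c = 0"
    using F F' unfolding abc by (simp_all add: algebra_simps)
  have 0: "sin (ang x + ang y) * (cos (ang y) * a + cos (ang x + ang y) * b + cos (ang x) * c)
      - cos (ang x + ang y) * (sin (ang y) * a + sin (ang x + ang y) * b + sin (ang x) * c) =
      sin ((ang x + ang y) - ang y) * a + sin ((ang x + ang y) - ang x) * c"
    unfolding sin_diff by (simp add: algebra_simps)
  then have 1: "sin (ang x) * a + sin (ang y) * c = 0" using C S by simp
  have "cos (ang y) * (sin (ang y) * a + sin (ang x + ang y) * b + sin (ang x) * c) 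
     - sin (ang y) * (cos (ang y) * a + cos (ang x + ang y) * b + cos (ang x) * c) =
     sin ((ang x + ang y) - ang y) * b - sin (ang y - ang x) * c"
    unfolding sin_diff by (simp add: algebra_simps)
  then have 2: "sin (ang x) * b = sin (ang y - ang x) * c" using C S by simp
  have "cos (ang x) * (sin (ang y) * a + sin (ang x + ang y) * b + sin (ang x) * c) 
     - sin (ang x) * (cos (ang y) * a + cos (ang x + ang y) * b + cos (ang x) * c) =
     sin (ang y - ang x) * a + sin ((ang x + ang y) - ang x) * b"
    unfolding sin_diff by (simp add: algebra_simps)
  then have 3: "sin (ang y) * b = - sin (ang y - ang x) * a" using C S by simp
  have "\<exists>\<tau>. a = sqrt 2 * sin (ang y) * \<tau> \<and> b = - sqrt 2 * sin (ang y - ang x) * \<tau> \<and> c = - sqrt 2 * sin (ang x) * \<tau>"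
  proof (cases "y = 0")
    case False
    then have s: "sin (ang y) \<noteq> 0" using formatted_sin_nonzero[OF f] by simp
    show ?thesis
      by (rule exI[of _ "a / (sqrt 2 * sin (ang y))"]) (use s 1 3 in \<open>simp add: field_simps\<close>)
  next
    case True
    then have "x \<noteq> 0" using formatted_bounds(2)[OF f] by simp
    then have s: "sin (ang x) \<noteq> 0" using formatted_sin_nonzero[OF f] by simp
    have "a = 0" using 1 s True by (simp add: ang_simps)
    moreover have "sin (ang x) * b = sin (ang x) * (- c)" using 2 True by (simp add: ang_simps)
    then have "b = - c" using s by (simp only: mult_cancel_left) simp
    ultimately show ?thesis
      by (intro exI[of _ "- c / (sqrt 2 * sin (ang x))"]) (use s True in \<open>simp add: ang_simps\<close>)
  qed
  then obtain \<tau> where \<tau>: "a = sqrt 2 * sin (ang y) * \<tau>" "b = - sqrt 2 * sin (ang y - ang x) * \<tau>" "c = - sqrt 2 * sin (ang x) * \<tau>"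
    by blast
  have eq: "g' = aff_translate (\<tau> *\<^sub>R e) g" if "fst g' = fst g" "aff_val g' z0 - aff_val g z0 = - \<tau> * (fst g \<bullet> e)" for g g' :: aff
    using that by (simp add: prod_eq_iff aff_translate_def aff_val_def)
  show ?thesis
    by (intro exI[of _ \<tau>] conjI eq) (use F F' \<tau> abc formatted_inner_e[OF f] in simp_all)
qed

end

text \<open>The orbit of a seed in normal form. The assumption on the initial seed allows \<open>x\<close> or \<open>y\<close> to vanish.\<close>

locale formatted_orbit = affine_frame +
  fixes u :: reference_point and s0 :: "3 seed"
  assumes mutable: "\<And>s. s \<in> mutation_orbit u s0 \<Longrightarrow> mutable u s"
    and no_cone: "\<And>s. s \<in> mutation_orbit u s0 \<Longrightarrow> in_no_cone s"
    and init: "\<exists>\<sigma> \<epsilon> x y p q r. bij \<sigma> \<and> s0 = relabel \<sigma> (triple_seed p q r) \<and> formatted \<epsilon> x y p q r"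
    and \<Delta>0: "\<Delta> \<noteq> 0"
begin

text \<open>The orbit closed under relabelling: the seeds that represent the vertices of the exchange graph.\<close>

definition orb :: "3 seed set" where
  "orb = {relabel \<sigma> s | \<sigma> s. bij \<sigma> \<and> s \<in> mutation_orbit u s0}"

lemma orb_I: "s \<in> mutation_orbit u s0 \<Longrightarrow> s \<in> orb"
  unfolding orb_def using bij_id[unfolded id_def] relabel_id by (metis (mono_tags, lifting) mem_Collect_eq)

lemma orb_relabel: "s \<in> orb \<Longrightarrow> bij \<sigma> \<Longrightarrow> relabel \<sigma> s \<in> orb"
  unfolding orb_def using bij_comp by (fastforce simp: relabel_relabel)

lemma orb_relabel_iff:
  assumes "bij \<sigma>"
  shows "relabel \<sigma> s \<in> orb \<longleftrightarrow> s \<in> orb"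
proof
  assume "relabel \<sigma> s \<in> orb"
  then have "relabel (inv \<sigma>) (relabel \<sigma> s) \<in> orb" using assms by (intro orb_relabel[of "relabel \<sigma> s"] bij_imp_bij_inv)
  moreover have "\<sigma> \<circ> inv \<sigma> = (\<lambda>i. i)" using assms by (auto simp: fun_eq_iff surj_f_inv_f bij_is_surj)
  ultimately show "s \<in> orb" by (simp add: relabel_relabel relabel_id)
qed (use assms orb_relabel in blast)

lemma orb_E:
  assumes "s \<in> orb"
  obtains \<sigma> s' where "s = relabel \<sigma> s'" "bij \<sigma>" "s' \<in> mutation_orbit u s0"
  using assms unfolding orb_def by blast

lemma orb_mutate:
  assumes "s \<in> orb"
  shows "mutate u k s \<in> orb"
proof -
  obtain \<sigma> s' where s: "s = relabel \<sigma> s'" "bij \<sigma>" "s' \<in> mutation_orbit u s0" using assms by (rule orb_E)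
  then show ?thesis
    by (simp add: mutate_relabel orb_relabel_iff orb_I mutation_orbit.step)
qed

lemma orb_mutable:
  assumes "s \<in> orb" shows "positive u (fst s $ k) \<or> negative u (fst s $ k)"
proof -
  obtain \<sigma> s' where s: "s = relabel \<sigma> s'" "bij \<sigma>" "s' \<in> mutation_orbit u s0" using assms by (rule orb_E)
  then show ?thesis using mutable[OF s(3)] by (simp add: mutable_def)
qed

lemma orb_no_cone:
  assumes "s \<in> orb" shows "in_no_cone s"
proof -
  obtain \<sigma> s' where s: "s = relabel \<sigma> s'" "bij \<sigma>" "s' \<in> mutation_orbit u s0" using assms by (rule orb_E)
  have "(\<forall>i. fst (fst s' $ \<sigma> i) \<bullet> z < 0) \<longleftrightarrow> (\<forall>i. fst (fst s' $ i) \<bullet> z < 0)" for z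
    using s(2) by (metis bij_pointE)
  then show ?thesis using no_cone[OF s(3)] unfolding in_no_cone_def s(1) by simp
qed

definition shape :: "real \<Rightarrow> nat \<Rightarrow> nat \<Rightarrow> aff \<Rightarrow> aff \<Rightarrow> aff \<Rightarrow> bool" where
  "shape \<epsilon> x y p q r \<longleftrightarrow> formatted \<epsilon> x y p q r \<and> triple_seed p q r \<in> orb"

lemma shape_signs:
  assumes "shape \<epsilon> x y p q r"
  shows "positive u p" "negative u r" "y < x \<Longrightarrow> positive u q" "x < y \<Longrightarrow> negative u q" "positive u q \<or> negative u q"
proof -
  have f: "formatted \<epsilon> x y p q r" and o: "triple_seed p q r \<in> orb" using assms by (auto simp: shape_def)
  have m: "positive u p \<or> negative u p" "positive u q \<or> negative u q" "positive u r \<or> negative u r"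
    using orb_mutable[OF o, of 1] orb_mutable[OF o, of 2] orb_mutable[OF o, of 3] by simp_all
  have c: "in_no_cone (mutate u k (triple_seed p q r))" for k by (intro orb_no_cone orb_mutate o)
  show "positive u p" by (rule first_positive[OF f m(1) c])
  show "negative u r" by (rule last_negative[OF f m(3) c])
  show "y < x \<Longrightarrow> positive u q" by (rule middle_positive[OF f m(2) _ c])
  show "x < y \<Longrightarrow> negative u q" by (rule middle_negative[OF f m(2) _ c])
  show "positive u q \<or> negative u q" by (rule m(2))
qed

lemma shape_I:
  assumes "triple_seed p q r \<in> orb" "mutate u k (triple_seed p q r) = relabel (perm3 a b c) (triple_seed p' q' r')"
    "a \<noteq> b" "a \<noteq> c" "b \<noteq> c" "formatted \<epsilon> x y p' q' r'"
  shows "shape \<epsilon> x y p' q' r'"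
  using assms orb_mutate[of "triple_seed p q r" k] unfolding shape_def by (simp add: orb_relabel_iff bij_perm3)

lemma shape_middle_pos:
  assumes s: "shape \<epsilon> x y p q r" and pos: "positive u q"
  shows "y \<le> x" "shape \<epsilon> (x - y) y p (reflect_in q r) (- q)"
    "mutate u 2 (triple_seed p q r) = relabel (perm3 1 3 2) (triple_seed p (reflect_in q r) (- q))"
proof -
  have f: "formatted \<epsilon> x y p q r" and o: "triple_seed p q r \<in> orb" using s by (auto simp: shape_def)
  show le: "y \<le> x" using shape_signs(4)[OF s] pos not_positive_and_negative[of u q] by (meson not_le)
  show m: "mutate u 2 (triple_seed p q r) = relabel (perm3 1 3 2) (triple_seed p (reflect_in q r) (- q))"
    by (rule mutate_middle_positive) (use formatted_forms[OF f] formatted_nonpos[OF f] pos in auto)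
  show "shape \<epsilon> (x - y) y p (reflect_in q r) (- q)"
    by (rule shape_I[OF o m]) (use formatted_middle_pos[OF f le] in auto)
qed

lemma shape_middle_neg:
  assumes s: "shape \<epsilon> x y p q r" and neg: "negative u q"
  shows "x \<le> y" "shape \<epsilon> x (y - x) (- q) (reflect_in q p) r"
    "mutate u 2 (triple_seed p q r) = relabel (perm3 2 1 3) (triple_seed (- q) (reflect_in q p) r)"
proof -
  have f: "formatted \<epsilon> x y p q r" and o: "triple_seed p q r \<in> orb" using s by (auto simp: shape_def)
  show le: "x \<le> y" using shape_signs(3)[OF s] neg not_positive_and_negative[of u q] by (meson not_le)
  show m: "mutate u 2 (triple_seed p q r) = relabel (perm3 2 1 3) (triple_seed (- q) (reflect_in q p) r)"
    by (rule mutate_middle_negative) (use formatted_forms[OF f] formatted_nonpos[OF f] neg in auto)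
  show "shape \<epsilon> x (y - x) (- q) (reflect_in q p) r"
    by (rule shape_I[OF o m]) (use formatted_middle_neg[OF f le] in auto)
qed

lemma formatted_pr_sign:
  assumes f: "formatted \<epsilon> x y p q r"
  shows "d \<le> 2 * (x + y) \<Longrightarrow> aff_form p r \<le> 0" "2 * (x + y) \<le> d \<Longrightarrow> aff_form p r \<ge> 0"
proof -
  have b: "0 \<le> ang x + ang y" "ang x + ang y \<le> pi"
    using ang_simps(5)[of x] ang_simps(5)[of y] ang_le[of x] ang_le[of y] f by (auto simp: formatted_def)
  assume "d \<le> 2 * (x + y)"
  then have "pi / 2 \<le> ang x + ang y" using ang_half_iff[of x y] by linarith
  then have "cos (ang x + ang y) \<le> cos (pi / 2)" using b by (intro cos_monotone_0_pi_le) auto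
  then show "aff_form p r \<le> 0" by (simp add: formatted_forms[OF f])
next
  have b: "0 \<le> ang x + ang y"
    using ang_simps(5)[of x] ang_simps(5)[of y] by linarith
  assume "2 * (x + y) \<le> d"
  then have "ang (x + y) \<le> pi / 2" by (rule ang_le)
  then have "ang x + ang y \<le> pi / 2" by (simp only: ang_simps)
  moreover have "- (pi / 2) \<le> ang x + ang y" using b pi_gt_zero by linarith
  ultimately have "0 \<le> cos (ang x + ang y)" by (intro cos_ge_zero)
  then show "aff_form p r \<ge> 0" by (simp add: formatted_forms[OF f])
qed

lemma shape_first_acute:
  assumes s: "shape \<epsilon> x y p q r" and le: "d \<le> 2 * (x + y)"
  shows "shape (- \<epsilon>) y (d - x - y) (reflect_in p q) (reflect_in p r) (- p)"
    "mutate u 1 (triple_seed p q r) = relabel (perm3 3 1 2) (triple_seed (reflect_in p q) (reflect_in p r) (- p))"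
proof -
  have f: "formatted \<epsilon> x y p q r" and o: "triple_seed p q r \<in> orb" using s by (auto simp: shape_def)
  show m: "mutate u 1 (triple_seed p q r) = relabel (perm3 3 1 2) (triple_seed (reflect_in p q) (reflect_in p r) (- p))"
    by (rule mutate_first_acute) (use formatted_forms[OF f] formatted_nonpos[OF f] shape_signs[OF s] formatted_pr_sign[OF f] le in auto)
  show "shape (- \<epsilon>) y (d - x - y) (reflect_in p q) (reflect_in p r) (- p)"
    by (rule shape_I[OF o m]) (use formatted_first_acute[OF f le] in auto)
qed

lemma shape_first_obtuse:
  assumes s: "shape \<epsilon> x y p q r" and le: "2 * (x + y) \<le> d"
  shows "shape \<epsilon> x (x + y) (reflect_in p q) (- p) r"
    "mutate u 1 (triple_seed p q r) = relabel (perm3 2 1 3) (triple_seed (reflect_in p q) (- p) r)"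
proof -
  have f: "formatted \<epsilon> x y p q r" and o: "triple_seed p q r \<in> orb" using s by (auto simp: shape_def)
  show m: "mutate u 1 (triple_seed p q r) = relabel (perm3 2 1 3) (triple_seed (reflect_in p q) (- p) r)"
    by (rule mutate_first_obtuse) (use formatted_forms[OF f] formatted_nonpos[OF f] shape_signs[OF s] formatted_pr_sign[OF f] le in auto)
  show "shape \<epsilon> x (x + y) (reflect_in p q) (- p) r"
    by (rule shape_I[OF o m]) (use formatted_first_obtuse[OF f le] in auto)
qed

lemma shape_last_acute:
  assumes s: "shape \<epsilon> x y p q r" and le: "d \<le> 2 * (x + y)"
  shows "shape (- \<epsilon>) (d - x - y) x (- r) (reflect_in r p) (reflect_in r q)"
    "mutate u 3 (triple_seed p q r) = relabel (perm3 2 3 1) (triple_seed (- r) (reflect_in r p) (reflect_in r q))"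
proof -
  have f: "formatted \<epsilon> x y p q r" and o: "triple_seed p q r \<in> orb" using s by (auto simp: shape_def)
  show m: "mutate u 3 (triple_seed p q r) = relabel (perm3 2 3 1) (triple_seed (- r) (reflect_in r p) (reflect_in r q))"
    by (rule mutate_last_acute) (use formatted_forms[OF f] formatted_nonpos[OF f] shape_signs[OF s] formatted_pr_sign[OF f] le in auto)
  show "shape (- \<epsilon>) (d - x - y) x (- r) (reflect_in r p) (reflect_in r q)"
    by (rule shape_I[OF o m]) (use formatted_last_acute[OF f le] in auto)
qed

lemma shape_last_obtuse:
  assumes s: "shape \<epsilon> x y p q r" and le: "2 * (x + y) \<le> d"
  shows "shape \<epsilon> (x + y) y p (- r) (reflect_in r q)"
    "mutate u 3 (triple_seed p q r) = relabel (perm3 1 3 2) (triple_seed p (- r) (reflect_in r q))"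
proof -
  have f: "formatted \<epsilon> x y p q r" and o: "triple_seed p q r \<in> orb" using s by (auto simp: shape_def)
  show m: "mutate u 3 (triple_seed p q r) = relabel (perm3 1 3 2) (triple_seed p (- r) (reflect_in r q))"
    by (rule mutate_last_obtuse) (use formatted_forms[OF f] formatted_nonpos[OF f] shape_signs[OF s] formatted_pr_sign[OF f] le in auto)
  show "shape \<epsilon> (x + y) y p (- r) (reflect_in r q)"
    by (rule shape_I[OF o m]) (use formatted_last_obtuse[OF f le] in auto)
qed

text \<open>To follow a property along the orbit it suffices to follow it along the six moves of ordered triples.
The signs of the vectors leave no other mutations.\<close>

lemma orb_induct:
  assumes s: "s \<in> orb"
    and base: "\<exists>\<sigma> \<epsilon> x y p q r. bij \<sigma> \<and> s0 = relabel \<sigma> (triple_seed p q r) \<and> formatted \<epsilon> x y p q r \<and> P x y p q r"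
    and mp: "\<And>\<epsilon> x y p q r. shape \<epsilon> x y p q r \<Longrightarrow> P x y p q r \<Longrightarrow> y \<le> x \<Longrightarrow> P (x - y) y p (reflect_in q r) (- q)"
    and mn: "\<And>\<epsilon> x y p q r. shape \<epsilon> x y p q r \<Longrightarrow> P x y p q r \<Longrightarrow> x \<le> y \<Longrightarrow> P x (y - x) (- q) (reflect_in q p) r"
    and fa: "\<And>\<epsilon> x y p q r. shape \<epsilon> x y p q r \<Longrightarrow> P x y p q r \<Longrightarrow> d \<le> 2 * (x + y) \<Longrightarrow> P y (d - x - y) (reflect_in p q) (reflect_in p r) (- p)"
    and fo: "\<And>\<epsilon> x y p q r. shape \<epsilon> x y p q r \<Longrightarrow> P x y p q r \<Longrightarrow> 2 * (x + y) \<le> d \<Longrightarrow> P x (x + y) (reflect_in p q) (- p) r"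
    and la: "\<And>\<epsilon> x y p q r. shape \<epsilon> x y p q r \<Longrightarrow> P x y p q r \<Longrightarrow> d \<le> 2 * (x + y) \<Longrightarrow> P (d - x - y) x (- r) (reflect_in r p) (reflect_in r q)"
    and lo: "\<And>\<epsilon> x y p q r. shape \<epsilon> x y p q r \<Longrightarrow> P x y p q r \<Longrightarrow> 2 * (x + y) \<le> d \<Longrightarrow> P (x + y) y p (- r) (reflect_in r q)"
  shows "\<exists>\<sigma> \<epsilon> x y p q r. bij \<sigma> \<and> s = relabel \<sigma> (triple_seed p q r) \<and> shape \<epsilon> x y p q r \<and> P x y p q r"
proof -
  let ?Q = "\<lambda>s. \<exists>\<sigma> \<epsilon> x y p q r. bij \<sigma> \<and> s = relabel \<sigma> (triple_seed p q r) \<and> shape \<epsilon> x y p q r \<and> P x y p q r"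
  have Q: "?Q (relabel (perm3 a b c) (triple_seed p q r))"
    if "shape \<epsilon> x y p q r" "P x y p q r" "a \<noteq> b" "a \<noteq> c" "b \<noteq> c" for a b c \<epsilon> x y p q r
    using that bij_perm3 by blast
  have rel: "?Q (relabel \<sigma> s)" if "?Q s" "bij \<sigma>" for \<sigma> s
  proof -
    obtain \<tau> \<epsilon> x y p q r where "bij \<tau>" "s = relabel \<tau> (triple_seed p q r)" "shape \<epsilon> x y p q r" "P x y p q r"
      using \<open>?Q s\<close> by blast
    then show ?thesis using bij_comp[OF \<open>bij \<sigma>\<close> \<open>bij \<tau>\<close>]
      by (intro exI[of _ "\<tau> \<circ> \<sigma>"] exI[of _ \<epsilon>] exI[of _ x] exI[of _ y] exI[of _ p] exI[of _ q] exI[of _ r]) (simp add: relabel_relabel)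
  qed
  have mut: "?Q (mutate u k (triple_seed p q r))" if sh: "shape \<epsilon> x y p q r" and P: "P x y p q r" for k \<epsilon> x y p q r
  proof -
    consider "k = 1" "d \<le> 2 * (x + y)" | "k = 1" "2 * (x + y) \<le> d" | "k = 2" "positive u q" | "k = 2" "negative u q"
      | "k = 3" "d \<le> 2 * (x + y)" | "k = 3" "2 * (x + y) \<le> d"
      using exhaust_3[of k] shape_signs(5)[OF sh] by linarith
    then show ?thesis
    proof cases
      case 1
      show ?thesis unfolding 1(1) shape_first_acute(2)[OF sh 1(2)]
        by (rule Q[OF shape_first_acute(1)[OF sh 1(2)] fa[OF sh P 1(2)]]) simp_all
    next
      case 2
      show ?thesis unfolding 2(1) shape_first_obtuse(2)[OF sh 2(2)]
        by (rule Q[OF shape_first_obtuse(1)[OF sh 2(2)] fo[OF sh P 2(2)]]) simp_all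
    next
      case 3
      show ?thesis unfolding 3(1) shape_middle_pos(3)[OF sh 3(2)]
        by (rule Q[OF shape_middle_pos(2)[OF sh 3(2)] mp[OF sh P shape_middle_pos(1)[OF sh 3(2)]]]) simp_all
    next
      case 4
      show ?thesis unfolding 4(1) shape_middle_neg(3)[OF sh 4(2)]
        by (rule Q[OF shape_middle_neg(2)[OF sh 4(2)] mn[OF sh P shape_middle_neg(1)[OF sh 4(2)]]]) simp_all
    next
      case 5
      show ?thesis unfolding 5(1) shape_last_acute(2)[OF sh 5(2)]
        by (rule Q[OF shape_last_acute(1)[OF sh 5(2)] la[OF sh P 5(2)]]) simp_all
    next
      case 6
      show ?thesis unfolding 6(1) shape_last_obtuse(2)[OF sh 6(2)]
        by (rule Q[OF shape_last_obtuse(1)[OF sh 6(2)] lo[OF sh P 6(2)]]) simp_all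
    qed
  qed
  have main: "?Q s'" if "s' \<in> mutation_orbit u s0" for s'
    using that
  proof induction
    case base
    obtain \<sigma> \<epsilon> x y p q r where b: "bij \<sigma>" "s0 = relabel \<sigma> (triple_seed p q r)" "formatted \<epsilon> x y p q r" "P x y p q r"
      using assms(2) by blast
    have "s0 \<in> orb" by (intro orb_I mutation_orbit.base)
    then have "relabel \<sigma> (triple_seed p q r) \<in> orb" using b(2) by metis
    then have "triple_seed p q r \<in> orb" unfolding orb_relabel_iff[OF b(1)] .
    then have "shape \<epsilon> x y p q r" using b(3) by (simp add: shape_def)
    then show ?case using b by blast
  next
    case (step s' k)
    then obtain \<tau> \<epsilon> x y p q r where b: "bij \<tau>" "s' = relabel \<tau> (triple_seed p q r)" "shape \<epsilon> x y p q r" "P x y p q r"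
      by blast
    show ?case unfolding b(2) mutate_relabel[OF b(1)] by (rule rel[OF mut[OF b(3,4)] b(1)])
  qed
  obtain \<sigma> s' where s': "s = relabel \<sigma> s'" "bij \<sigma>" "s' \<in> mutation_orbit u s0" using s by (rule orb_E)
  show ?thesis unfolding s'(1) by (rule rel[OF main[OF s'(3)] s'(2)])
qed

lemma orb_shape:
  assumes "s \<in> orb"
  obtains \<sigma> \<epsilon> x y p q r where "bij \<sigma>" "s = relabel \<sigma> (triple_seed p q r)" "shape \<epsilon> x y p q r"
proof -
  have "\<exists>\<sigma> \<epsilon> x y p q r. bij \<sigma> \<and> s = relabel \<sigma> (triple_seed p q r) \<and> shape \<epsilon> x y p q r \<and> True"
    by (rule orb_induct[OF assms]) (use init in auto)
  then show ?thesis using that by blast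
qed

lemma orb_norm:
  assumes "s \<in> orb"
  shows "aff_form (fst s $ k) (fst s $ k) = 2"
proof -
  obtain \<sigma> \<epsilon> x y p q r where s: "bij \<sigma>" "s = relabel \<sigma> (triple_seed p q r)" "shape \<epsilon> x y p q r"
    using assms by (rule orb_shape)
  have "aff_form p p = 2" "aff_form q q = 2" "aff_form r r = 2"
    using s(3) formatted_forms unfolding shape_def by blast+
  then have "aff_form (fst (triple_seed p q r) $ k) (fst (triple_seed p q r) $ k) = 2" for k
    using exhaust_3[of k] by auto
  then show ?thesis by (simp add: s(2))
qed

text \<open>A property that mutation preserves is also reflected by it, because mutation is an involution; hence it
is constant on the orbit.\<close>

lemma orb_invariant_iff:
  assumes mut: "\<And>s k. s \<in> orb \<Longrightarrow> P s \<Longrightarrow> P (mutate u k s)"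
    and rel: "\<And>s \<sigma>. s \<in> orb \<Longrightarrow> bij \<sigma> \<Longrightarrow> P (relabel \<sigma> s) \<longleftrightarrow> P s"
    and s: "s \<in> orb"
  shows "P s = P s0"
proof -
  have *: "P s' \<longleftrightarrow> P s0" if "s' \<in> mutation_orbit u s0" for s'
    using that
  proof induction
    case (step s' k)
    have o: "s' \<in> orb" using step.hyps by (rule orb_I)
    have "P (mutate u k s') \<longleftrightarrow> P s'"
      using mut[OF o, of k] mut[OF orb_mutate[OF o, of k], of k] mutate_involutive[OF orb_norm[OF o], of u k] by metis
    then show ?case using step.IH by simp
  qed simp
  obtain \<sigma> s' where "s = relabel \<sigma> s'" "bij \<sigma>" "s' \<in> mutation_orbit u s0" using s by (rule orb_E)
  then show ?thesis using * rel orb_I by metis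
qed

abbreviation shift :: "real \<Rightarrow> 3 seed \<Rightarrow> 3 seed" where
  "shift \<tau> \<equiv> seed_translate (\<tau> *\<^sub>R e)"

text \<open>The signs of \<open>p\<close> and \<open>r\<close> are the same in all seeds of the orbit, and so is that of \<open>q\<close> when
\<open>x \<noteq> y\<close>. When \<open>x = y\<close> the vector \<open>q\<close> is orthogonal to \<open>e\<close> and is not moved at all.\<close>

lemma mutate_shift:
  assumes s: "s \<in> orb" and s': "shift \<tau> s \<in> orb"
  shows "mutate u k (shift \<tau> s) = shift \<tau> (mutate u k s)"
proof -
  let ?T = "aff_translate (\<tau> *\<^sub>R e)"
  obtain \<sigma> \<epsilon> x y p q r where r: "bij \<sigma>" "s = relabel \<sigma> (triple_seed p q r)" "shape \<epsilon> x y p q r"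
    using s by (rule orb_shape)
  have f: "formatted \<epsilon> x y p q r" using r(3) by (simp add: shape_def)
  have "shift \<tau> s = relabel \<sigma> (triple_seed (?T p) (?T q) (?T r))"
    by (simp add: r(2) seed_translate_relabel translate_triple_seed)
  then have "triple_seed (?T p) (?T q) (?T r) \<in> orb" using s' r(1) by (simp add: orb_relabel_iff)
  then have sh: "shape \<epsilon> x y (?T p) (?T q) (?T r)" using formatted_translate[OF f] by (simp add: shape_def)
  note S = shape_signs[OF r(3)] and S' = shape_signs[OF sh]
  have q: "?T q = q" if "x = y"
    using that formatted_inner_e(2)[OF f] by (simp add: aff_translate_def prod_eq_iff)
  have sg: "positive u (?T v) = positive u v \<and> negative u (?T v) = negative u v" if "v = p \<or> v = q \<or> v = r" for v
    using S S' q not_positive_and_negative that by (metis linorder_neqE_nat)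
  have "fst s $ k = p \<or> fst s $ k = q \<or> fst s $ k = r"
    using exhaust_3[of "\<sigma> k"] by (auto simp: r(2))
  then show ?thesis using sg by (intro mutate_translate) auto
qed

text \<open>Lengths, along \<open>e\<close>, of the translations that act on the exchange graph.\<close>

definition translation_group :: "real set" where
  "translation_group = {\<tau>. \<forall>s\<in>orb. shift \<tau> s \<in> orb}"

text \<open>By the commutation of mutation with translations, the property of staying in the orbit spreads from one
seed to all.\<close>

lemma translation_group_I:
  assumes s: "s \<in> orb" and s': "shift \<tau> s \<in> orb"
  shows "\<tau> \<in> translation_group"
proof -
  have "shift \<tau> s1 \<in> orb \<longleftrightarrow> shift \<tau> s0 \<in> orb" if "s1 \<in> orb" for s1
    by (rule orb_invariant_iff[OF _ _ that])
      (metis mutate_shift orb_mutate, simp add: seed_translate_relabel orb_relabel_iff)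
  then show ?thesis using s s' by (auto simp: translation_group_def)
qed

lemma s0_orb: "s0 \<in> orb" by (intro orb_I mutation_orbit.base)

lemma translation_group_add: "a \<in> translation_group \<Longrightarrow> b \<in> translation_group \<Longrightarrow> a + b \<in> translation_group"
  unfolding translation_group_def by (simp add: scaleR_add_left flip: seed_translate_add)

lemma translation_group_minus:
  assumes "a \<in> translation_group" shows "- a \<in> translation_group"
proof -
  have "shift a s0 \<in> orb" using assms s0_orb by (simp add: translation_group_def)
  moreover have "shift (- a) (shift a s0) = s0" by (simp add: seed_translate_add)
  ultimately show ?thesis using s0_orb by (intro translation_group_I[of "shift a s0"]) simp_all
qed

lemma translation_group_zero: "0 \<in> translation_group"
  by (simp add: translation_group_def)

lemma translation_group_sum: "(\<And>i. i \<in> S \<Longrightarrow> f i \<in> translation_group) \<Longrightarrow> sum f S \<in> translation_group"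
  by (induction S rule: infinite_finite_induct) (auto simp: translation_group_zero translation_group_add)

lemma translation_group_of_int: "a \<in> translation_group \<Longrightarrow> of_int k * a \<in> translation_group"
proof (induction k rule: int_induct[where k = 0])
  case (step1 i)
  then show ?case using translation_group_add[of "of_int i * a" a] by (simp add: algebra_simps)
next
  case (step2 i)
  then show ?case using translation_group_add[of "of_int i * a" "- a"] translation_group_minus[of a] by (simp add: algebra_simps)
qed (simp add: translation_group_zero)

lemma shape_translate:
  assumes "shape \<epsilon> x y p q r" "shape \<epsilon> x y p' q' r'"
  shows "\<exists>\<tau>\<in>translation_group. triple_seed p' q' r' = shift \<tau> (triple_seed p q r)"
proof -
  obtain \<tau> where "triple_seed p' q' r' = shift \<tau> (triple_seed p q r)"
    using formatted_unique_translate[of \<epsilon> x y p q r p' q' r'] assms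
    unfolding shape_def translate_triple_seed by metis
  then show ?thesis using assms translation_group_I[of "triple_seed p q r" \<tau>] unfolding shape_def by auto
qed

text \<open>Only the numerators matter for the question which half-strips occur.\<close>

definition reachable :: "nat \<Rightarrow> nat \<Rightarrow> bool" where
  "reachable x y \<longleftrightarrow> (\<exists>\<epsilon> p q r. shape \<epsilon> x y p q r)"

lemma reachable_bounds:
  assumes "reachable x y"
  shows "2 * x \<le> d" "2 * y \<le> d" "coprime (gcd x y) d" "x + y < d" "0 < x + y"
  using assms formatted_bounds unfolding reachable_def shape_def formatted_def by blast+

lemma reachable_middle_gt: "reachable x y \<Longrightarrow> y < x \<Longrightarrow> reachable (x - y) y"
  unfolding reachable_def using shape_middle_pos(2) shape_signs(3) by blast

lemma reachable_middle_lt: "reachable x y \<Longrightarrow> x < y \<Longrightarrow> reachable x (y - x)"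
  unfolding reachable_def using shape_middle_neg(2) shape_signs(4) by blast

lemma reachable_middle_eq: "reachable x x \<Longrightarrow> reachable x 0 \<or> reachable 0 x"
  unfolding reachable_def using shape_middle_pos(2)[of _ x x] shape_middle_neg(2)[of _ x x] shape_signs(5)[of _ x x]
  by (metis cancel_comm_monoid_add_class.diff_cancel)

lemma reachable_first_obtuse: "reachable x y \<Longrightarrow> 2 * (x + y) \<le> d \<Longrightarrow> reachable x (x + y)"
  unfolding reachable_def using shape_first_obtuse(1) by blast

lemma reachable_last_obtuse: "reachable x y \<Longrightarrow> 2 * (x + y) \<le> d \<Longrightarrow> reachable (x + y) y"
  unfolding reachable_def using shape_last_obtuse(1) by blast

lemma reachable_first_acute: "reachable x y \<Longrightarrow> d \<le> 2 * (x + y) \<Longrightarrow> reachable y (d - x - y)"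
  unfolding reachable_def using shape_first_acute(1) by blast

lemma reachable_last_acute: "reachable x y \<Longrightarrow> d \<le> 2 * (x + y) \<Longrightarrow> reachable (d - x - y) x"
  unfolding reachable_def using shape_last_acute(1) by blast

text \<open>A half-strip with angle \<open>t \<pi> / d\<close> between the parallel sides and the third side occurs in the orbit; the
parallel sides are \<open>q\<close> and \<open>r\<close> or \<open>p\<close> and \<open>q\<close>.\<close>

definition reaches_strip :: "nat \<Rightarrow> bool" where
  "reaches_strip t \<longleftrightarrow> reachable t 0 \<or> reachable 0 t"

text \<open>Mutating in the middle runs the Euclidean algorithm to its end.\<close>

lemma reachable_strip_gcd: "reachable x y \<Longrightarrow> reaches_strip (gcd x y)"
proof (induction "x + y" arbitrary: x y rule: less_induct)
  case less
  consider "x = 0" | "y = 0" | "0 < y" "y < x" | "0 < x" "x < y" | "x = y" by linarith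
  then show ?case
  proof cases
    case 3
    then have "reaches_strip (gcd (x - y) y)" using less reachable_middle_gt by simp
    then show ?thesis using 3 by (simp add: gcd_diff1_nat)
  next
    case 4
    then have "reaches_strip (gcd x (y - x))" using less reachable_middle_lt by simp
    then show ?thesis using 4 by (simp add: gcd.commute[of x] gcd_diff1_nat)
  next
    case 5
    then show ?thesis using less reachable_middle_eq by (auto simp: reaches_strip_def)
  qed (use less in \<open>auto simp: reaches_strip_def\<close>)
qed

lemma strip_bounds:
  assumes "reaches_strip t" shows "0 < t" "2 * t \<le> d" "coprime t d"
  using assms reachable_bounds[of t 0] reachable_bounds[of 0 t] by (auto simp: reaches_strip_def)

text \<open>The point of this choice of \<open>m\<close> is that the triangle with numerators \<open>m t\<close> and \<open>t\<close> has an acute third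
angle, while its first angle is still acute or right.\<close>

lemma max_multiple:
  assumes "0 < t" "2 * t \<le> d"
  obtains m where "0 < m" "2 * (m * t) \<le> d" "d < 2 * (m * t + t)"
proof (rule that[of "d div (2 * t)"])
  define e where "e = d mod (2 * t)"
  define m where "m = d div (2 * t)"
  have "e < 2 * t" "2 * t * m + e = d" using assms(1) by (simp_all add: e_def m_def)
  then show "2 * (d div (2 * t) * t) \<le> d" "d < 2 * (d div (2 * t) * t + t)"
    unfolding m_def[symmetric] by (simp_all add: algebra_simps)
  show "0 < d div (2 * t)" using assms by (simp add: div_greater_zero_iff)
qed

lemma strip_reachable_multiple:
  assumes t: "reaches_strip t" and m: "0 < m" "2 * (m * t) \<le> d"
  shows "reachable (m * t) t"
  using m
proof (induction m rule: nat_induct_non_zero)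
  case 1
  then show ?case using t reachable_first_obtuse[of t 0] reachable_last_obtuse[of 0 t] by (auto simp: reaches_strip_def)
next
  case (Suc m)
  have e: "m * t + t = Suc m * t" by simp
  then have "2 * (m * t + t) \<le> d" using Suc.prems by simp
  moreover from this have "reachable (m * t) t" using Suc.IH by simp
  ultimately show ?case using reachable_last_obtuse unfolding e[symmetric] by blast
qed

text \<open>Starting from any half-strip, say of numerator \<open>t\<close>, pass to the acute triangle with
numerators \<open>m t\<close>, \<open>t\<close>, \<open>d - (m + 1) t\<close>. The last two have the greatest common divisor \<open>1\<close>, as
\<open>t\<close> is coprime to \<open>d\<close>, and the Euclidean algorithm on them ends in the numerator \<open>1\<close>.\<close>

lemma strip_one: "reaches_strip 1"
proof -
  obtain \<sigma> \<epsilon> x y p q r where "shape \<epsilon> x y p q r" using orb_shape[OF s0_orb] by metis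
  then have "reaches_strip (gcd x y)" by (intro reachable_strip_gcd) (unfold reachable_def, blast)
  then obtain t where t: "reaches_strip t" by blast
  note b = strip_bounds[OF t]
  obtain m where m: "0 < m" "2 * (m * t) \<le> d" "d < 2 * (m * t + t)"
    using max_multiple[OF b(1,2)] by blast
  have r: "reachable (m * t) t" by (rule strip_reachable_multiple[OF t m(1,2)])
  then have "reachable t (d - m * t - t)" using m(3) by (intro reachable_first_acute) auto
  then have "reaches_strip (gcd t (d - m * t - t))" by (rule reachable_strip_gcd)
  moreover have "gcd t (d - m * t - t) = 1"
  proof -
    have "gcd t (d - (m * t + t)) dvd d"
    proof (rule dvd_diffD)
      show "gcd t (d - (m * t + t)) dvd d - (m * t + t)" by simp
      show "gcd t (d - (m * t + t)) dvd m * t + t" by (intro dvd_add dvd_mult gcd_dvd1)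
      show "m * t + t \<le> d" using reachable_bounds(4)[OF r] by simp
    qed
    then have "gcd t (d - m * t - t) dvd d" by simp
    then show ?thesis using b(3) by (metis coprime_common_divisor_nat gcd_dvd1)
  qed
  ultimately show ?thesis by simp
qed

text \<open>The Euclidean algorithm run backwards from the half-strip of numerator \<open>1\<close>.\<close>

lemma reachable_coprime:
  "0 < x \<Longrightarrow> 0 < y \<Longrightarrow> coprime x y \<Longrightarrow> 2 * x \<le> d \<Longrightarrow> 2 * y \<le> d \<Longrightarrow> reachable x y"
proof (induction "x + y" arbitrary: x y rule: less_induct)
  case less
  consider "y < x" | "x < y" | "x = y" by linarith
  then show ?case
  proof cases
    case 1
    then have "coprime (x - y) y" using less.prems by (metis coprime_iff_gcd_eq_1 gcd_diff1_nat less_imp_le)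
    then have "reachable (x - y) y" using less 1 by simp
    then show ?thesis using reachable_last_obtuse[of "x - y" y] 1 less.prems by simp
  next
    case 2
    then have "coprime x (y - x)" using less.prems by (metis coprime_iff_gcd_eq_1 gcd_diff1_nat less_imp_le gcd.commute)
    then have "reachable x (y - x)" using less 2 by simp
    then show ?thesis using reachable_first_obtuse[of x "y - x"] 2 less.prems by simp
  next
    case 3
    then have "x = 1" using less.prems by simp
    then show ?thesis using 3 strip_reachable_multiple[OF strip_one, of 1] d3 by simp
  qed
qed

text \<open>The acute triangle with numerators \<open>m k\<close>, \<open>k\<close>, \<open>d - (m + 1) k\<close> again: its last two numerators are
coprime, so it is reachable, and the Euclidean algorithm on the first two ends in \<open>k\<close>.\<close>

lemma strip_coprime:
  assumes k: "0 < k" "2 * k < d" "coprime k d"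
  shows "reaches_strip k"
proof (cases "k = 1")
  case False
  obtain m where m0: "0 < m" and m: "2 * (m * k) \<le> d" "d < 2 * (m * k + k)"
    using max_multiple[OF k(1) less_imp_le[OF k(2)]] by blast
  have "k \<le> m * k" using m0 by simp
  then have lt: "m * k + k < d" using m(1) k(2) by linarith
  define w where "w = d - (m * k + k)"
  have "gcd k w dvd d"
  proof (rule dvd_diffD)
    show "gcd k w dvd d - (m * k + k)" unfolding w_def[symmetric] by simp
    show "gcd k w dvd m * k + k" by (intro dvd_add dvd_mult gcd_dvd1)
    show "m * k + k \<le> d" using lt by simp
  qed
  then have "coprime k w" using k(3) by (metis coprime_common_divisor_nat coprime_iff_gcd_eq_1 gcd_dvd1)
  then have "reachable k w" using lt k m by (intro reachable_coprime) (auto simp: w_def)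
  then have "reachable (d - k - w) k" using m(1) lt by (intro reachable_last_acute) (auto simp: w_def)
  moreover have "d - k - w = m * k" using lt by (simp add: w_def)
  ultimately have "reaches_strip (gcd (m * k) k)" using reachable_strip_gcd by metis
  then show ?thesis by simp
qed (use strip_one in simp)

end

section \<open>The lattice of translations\<close>

lemma module_int_scale: "module (\<lambda>(m::int) (x::real^2). of_int m *\<^sub>R x)"
  by unfold_locales (simp_all add: scaleR_add_right scaleR_add_left)

text \<open>Linear independence of an indexed family, stated by coefficients, is the independence of its
set of values together with injectivity.\<close>

lemma lattice_of_rank_image:
  fixes f :: "'a \<Rightarrow> real^2"
  assumes U: "finite U" and ind: "\<And>n :: 'a \<Rightarrow> int. (\<Sum>y\<in>U. of_int (n y) *\<^sub>R f y) = 0 \<Longrightarrow> \<forall>y\<in>U. n y = 0"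
  shows "lattice_of_rank {\<Sum>y\<in>U. of_int (n y) *\<^sub>R f y | n :: 'a \<Rightarrow> int. True} (card U)"
proof -
  interpret M: module "\<lambda>(m::int) (x::real^2). of_int m *\<^sub>R x" by (rule module_int_scale)
  have inj: "inj_on f U"
  proof (rule inj_onI, rule ccontr)
    fix a b assume ab: "a \<in> U" "b \<in> U" "f a = f b" "a \<noteq> b"
    define n :: "'a \<Rightarrow> int" where "n = (\<lambda>y. if y = a then 1 else if y = b then -1 else 0)"
    have "(\<Sum>y\<in>U. of_int (n y) *\<^sub>R f y) = (\<Sum>y\<in>{a, b}. of_int (n y) *\<^sub>R f y)"
      by (rule sum.mono_neutral_right) (use U ab in \<open>auto simp: n_def\<close>)
    also have "\<dots> = 0" using ab by (simp add: n_def)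
    finally show False using ind[of n] ab by (auto simp: n_def)
  qed
  have sum: "(\<Sum>v\<in>f ` U. of_int (g v) *\<^sub>R v) = (\<Sum>y\<in>U. of_int (g (f y)) *\<^sub>R f y)" for g :: "real^2 \<Rightarrow> int"
    by (rule sum.reindex_cong[OF inj]) auto
  have "\<not> M.dependent (f ` U)"
    unfolding M.dependent_finite[OF finite_imageI[OF U]] sum using ind by fastforce
  moreover have "M.span (f ` U) = {\<Sum>y\<in>U. of_int (n y) *\<^sub>R f y | n :: 'a \<Rightarrow> int. True}"
    unfolding M.span_finite[OF finite_imageI[OF U]] sum
  proof (intro equalityI subsetI)
    fix x assume "x \<in> {\<Sum>y\<in>U. of_int (n y) *\<^sub>R f y | n :: 'a \<Rightarrow> int. True}"
    then obtain n :: "'a \<Rightarrow> int" where n: "x = (\<Sum>y\<in>U. of_int (n y) *\<^sub>R f y)" by blast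
    have "x = (\<Sum>y\<in>U. of_int (n (the_inv_into U f (f y))) *\<^sub>R f y)"
      unfolding n by (intro sum.cong) (simp_all add: the_inv_into_f_f[OF inj])
    then show "x \<in> range (\<lambda>g :: real^2 \<Rightarrow> int. \<Sum>y\<in>U. of_int (g (f y)) *\<^sub>R f y)"
      by (intro image_eqI[of _ _ "\<lambda>v. n (the_inv_into U f v)"]) auto
  qed auto
  moreover have "card (f ` U) = card U" by (rule card_image[OF inj])
  ultimately show ?thesis unfolding lattice_of_rank_def using U by (intro exI[of _ "f ` U"]) simp
qed

context formatted_orbit
begin

text \<open>The coordinate on the axis, from \<open>z0\<close> and in units of \<open>\<Delta> / (sqrt 2 * d\<^sup>2)\<close>, of the point where the line of
\<open>p\<close> crosses the axis.\<close>

definition first_position :: "nat \<Rightarrow> aff \<Rightarrow> real" where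
  "first_position y p = (real d)\<^sup>2 * (aff_val p z0 / (\<Delta> * sin (ang y)))"

text \<open>The corresponding coordinate for the line of \<open>r\<close>; the opposite sign comes from the opposite
direction of \<open>r\<close> relative to the axis.\<close>

definition last_position :: "nat \<Rightarrow> aff \<Rightarrow> real" where
  "last_position x r = - ((real d)\<^sup>2 * (aff_val r z0 / (\<Delta> * sin (ang x))))"

text \<open>A line parallel to the axis has no crossing point, hence the two provisos.\<close>

definition positions_in :: "real \<Rightarrow> nat \<Rightarrow> nat \<Rightarrow> aff \<Rightarrow> aff \<Rightarrow> bool" where
  "positions_in K x y p r \<longleftrightarrow> (y \<noteq> 0 \<longrightarrow> first_position y p - K \<in> cos_lattice d) \<and> (x \<noteq> 0 \<longrightarrow> last_position x r - K \<in> cos_lattice d)"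

lemma cos_lattice_cot_cot:
  assumes "0 < x" "x < d" "0 < y" "y < d"
  shows "(real d)\<^sup>2 * (cot (ang x) * cot (ang y)) \<in> cos_lattice d"
proof -
  have "\<not> d dvd x" "\<not> d dvd y" using assms by (auto dest: dvd_imp_le)
  from conjugate_family_cot_cot[OF d0 this] show ?thesis
    unfolding cos_lattice_iff ang_def by (intro exI conjI, assumption) simp
qed

lemma cos_lattice_one: "(real d)\<^sup>2 \<in> cos_lattice d"
proof -
  have "conjugate_family d (\<lambda>s. of_int (int d * int d) * cos (2 * pi * real s * of_int 0 / real d))"
    by (intro conjugate_family_mult conjugate_family_cos d0)
  then show ?thesis unfolding cos_lattice_iff by (intro exI conjI, assumption) (simp add: power2_eq_square)
qed

lemma cos_lattice_zero: "0 \<in> cos_lattice d"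
  using cos_lattice_diff[OF cos_lattice_one cos_lattice_one] by simp

lemma cos_lattice_csc2:
  assumes "0 < x" "x < d"
  shows "(real d)\<^sup>2 * csc2 (ang x) \<in> cos_lattice d"
proof -
  have "\<not> d dvd x" using assms by (auto dest: dvd_imp_le)
  from conjugate_family_csc2[OF d0 this] show ?thesis
    unfolding cos_lattice_iff ang_def by (intro exI conjI, assumption) simp
qed

text \<open>Eliminating \<open>q\<close> from the two equations of the normal form gives
\<open>1 - cot (ang x) * cot (ang y)\<close> for the distance of the two crossing points, up to the
unit of length.\<close>

lemma position_link:
  assumes f: "formatted \<epsilon> x y p q r" and xy: "x \<noteq> 0" "y \<noteq> 0"
  shows "first_position y p - last_position x r \<in> cos_lattice d"
proof -
  note F = f[unfolded formatted_def]
  let ?P = "aff_val p z0" and ?Q = "aff_val q z0" and ?R = "aff_val r z0"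
  have s: "sin (ang x) \<noteq> 0" "sin (ang y) \<noteq> 0" using formatted_sin_nonzero[OF f] xy by auto
  have "sin (ang x + ang y) * (cos (ang y) * ?P + cos (ang x + ang y) * ?Q + cos (ang x) * ?R)
      - cos (ang x + ang y) * (sin (ang y) * ?P + sin (ang x + ang y) * ?Q + sin (ang x) * ?R) =
      sin ((ang x + ang y) - ang y) * ?P + sin ((ang x + ang y) - ang x) * ?R"
    unfolding sin_diff by (simp add: algebra_simps)
  then have e: "sin (ang x) * ?P + sin (ang y) * ?R = - cos (ang x + ang y) * \<Delta>" using F by simp
  have "first_position y p - last_position x r = (real d)\<^sup>2 * ((sin (ang x) * ?P + sin (ang y) * ?R) / (\<Delta> * sin (ang x) * sin (ang y)))"
    unfolding first_position_def last_position_def using s \<Delta>0 by (simp add: field_simps)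
  also have "\<dots> = (real d)\<^sup>2 - (real d)\<^sup>2 * (cot (ang x) * cot (ang y))"
    unfolding e cos_add cot_def using s \<Delta>0 by (simp add: field_simps)
  also have "\<dots> \<in> cos_lattice d"
    using xy formatted_bounds(1)[OF f] by (intro cos_lattice_diff cos_lattice_one cos_lattice_cot_cot) auto
  finally show ?thesis .
qed

lemma positions_from_first:
  assumes f: "formatted \<epsilon> x y p q r" and y: "y \<noteq> 0" and g: "first_position y p - K \<in> cos_lattice d"
  shows "positions_in K x y p r"
proof -
  have "last_position x r - K \<in> cos_lattice d" if "x \<noteq> 0"
    using cos_lattice_diff[OF g position_link[OF f that y]] by simp
  then show ?thesis using g by (simp add: positions_in_def)
qed

lemma positions_from_last:
  assumes f: "formatted \<epsilon> x y p q r" and x: "x \<noteq> 0" and g: "last_position x r - K \<in> cos_lattice d"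
  shows "positions_in K x y p r"
proof -
  have "first_position y p - K \<in> cos_lattice d" if "y \<noteq> 0"
    using cos_lattice_add[OF g position_link[OF f x that]] by simp
  then show ?thesis using g by (simp add: positions_in_def)
qed

text \<open>The widths of half-strips, in terms of the length of the glide.\<close>

lemma strip_values:
  assumes f: "formatted \<epsilon> x y p q r"
  shows "y = 0 \<Longrightarrow> aff_val q z0 + aff_val r z0 = \<Delta> / sin (ang x)"
    and "x = 0 \<Longrightarrow> aff_val p z0 + aff_val q z0 = \<Delta> / sin (ang y)"
proof -
  note F = f[unfolded formatted_def]
  show "aff_val q z0 + aff_val r z0 = \<Delta> / sin (ang x)" if "y = 0"
  proof -
    have "sin (ang x) > 0" using that formatted_bounds(2)[OF f] formatted_sin_nonzero(2)[OF f] by simp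
    then show ?thesis using F that by (simp add: ang_simps field_simps)
  qed
  show "aff_val p z0 + aff_val q z0 = \<Delta> / sin (ang y)" if "x = 0"
  proof -
    have "sin (ang y) > 0" using that formatted_bounds(2)[OF f] formatted_sin_nonzero(1)[OF f] by simp
    then show ?thesis using F that by (simp add: ang_simps field_simps)
  qed
qed

lemma last_position_strip_step:
  assumes "aff_val r' z0 = aff_val r z0 - c * (\<Delta> / sin (ang x))" "0 < x" "x < d"
  shows "last_position x r' = last_position x r + c * ((real d)\<^sup>2 * csc2 (ang x))"
proof -
  have "sin (ang x) \<noteq> 0" using ang_sin_pos[of x] assms by simp
  then show ?thesis unfolding last_position_def assms(1) csc2_def using \<Delta>0 by (simp add: field_simps power2_eq_square)
qed

lemma first_position_strip_step:
  assumes "aff_val p' z0 = aff_val p z0 - c * (\<Delta> / sin (ang x))" "0 < x" "x < d"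
  shows "first_position x p' = first_position x p - c * ((real d)\<^sup>2 * csc2 (ang x))"
proof -
  have "sin (ang x) \<noteq> 0" using ang_sin_pos[of x] assms by simp
  then show ?thesis unfolding first_position_def assms(1) csc2_def using \<Delta>0 by (simp add: field_simps power2_eq_square)
qed

text \<open>Except for half-strips, each mutation keeps one of the lines of \<open>p\<close> and \<open>r\<close> that cross the
axis, as the first or the last line of the new triple, and the other crossing point follows from
\<open>position_link\<close>. For half-strips that lose their only crossing line, the new line is parallel to the old
one, and the crossing point moves by a squared cosecant.\<close>

lemma orb_positions:
  "\<exists>K. \<forall>s\<in>orb. \<exists>\<sigma> \<epsilon> x y p q r. bij \<sigma> \<and> s = relabel \<sigma> (triple_seed p q r) \<and> shape \<epsilon> x y p q r \<and> positions_in K x y p r"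
proof -
  obtain \<sigma> \<epsilon> x y p q r where i: "bij \<sigma>" "s0 = relabel \<sigma> (triple_seed p q r)" "formatted \<epsilon> x y p q r"
    using init by blast
  \<comment> \<open>At least one of the two lines crosses the axis, as \<open>x\<close> and \<open>y\<close> do not both vanish.\<close>
  define K where "K = (if y \<noteq> 0 then first_position y p else last_position x r)"
  have g0: "positions_in K x y p r"
  proof (cases "y = 0")
    case False
    then show ?thesis using i(3) cos_lattice_zero by (intro positions_from_first[OF i(3)]) (auto simp: K_def)
  next
    case True
    then show ?thesis using i(3) cos_lattice_zero formatted_bounds(2)[OF i(3)] by (intro positions_from_last[OF i(3)]) (auto simp: K_def)
  qed
  note C = cos_lattice_csc2
  have "\<exists>\<sigma> \<epsilon> x y p q r. bij \<sigma> \<and> s = relabel \<sigma> (triple_seed p q r) \<and> shape \<epsilon> x y p q r \<and> positions_in K x y p r" if "s \<in> orb" for s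
  proof (rule orb_induct[OF that])
    show "\<exists>\<sigma> \<epsilon> x y p q r. bij \<sigma> \<and> s0 = relabel \<sigma> (triple_seed p q r) \<and> formatted \<epsilon> x y p q r \<and> positions_in K x y p r"
      using i g0 by blast
  next
    fix \<epsilon> x y p q r assume sh: "shape \<epsilon> x y p q r" and g: "positions_in K x y p r" and le: "y \<le> x"
    have f: "formatted \<epsilon> x y p q r" using sh by (simp add: shape_def)
    note f' = formatted_middle_pos[OF f le]
    show "positions_in K (x - y) y p (- q)"
    proof (cases "y = 0")
      case False
      then show ?thesis using g by (intro positions_from_first[OF f']) (auto simp: positions_in_def)
    next
      case True
      then have x: "0 < x" "x < d" using formatted_bounds[OF f] by auto
      have step: "aff_val (- q) z0 = aff_val r z0 - 1 * (\<Delta> / sin (ang x))"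
        using strip_values(1)[OF f True] by (simp add: aff_val_simps)
      have "last_position x (- q) - K = (last_position x r - K) + (real d)\<^sup>2 * csc2 (ang x)"
        using last_position_strip_step[OF step x] by simp
      moreover have "(last_position x r - K) + (real d)\<^sup>2 * csc2 (ang x) \<in> cos_lattice d"
        using cos_lattice_add[OF _ C[OF x]] g x by (simp add: positions_in_def)
      ultimately have "last_position x (- q) - K \<in> cos_lattice d" by (simp only:)
      then show ?thesis using x True by (intro positions_from_last[OF f']) simp_all
    qed
  next
    fix \<epsilon> x y p q r assume sh: "shape \<epsilon> x y p q r" and g: "positions_in K x y p r" and le: "x \<le> y"
    have f: "formatted \<epsilon> x y p q r" using sh by (simp add: shape_def)
    note f' = formatted_middle_neg[OF f le]
    show "positions_in K x (y - x) (- q) r"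
    proof (cases "x = 0")
      case False
      then show ?thesis using g by (intro positions_from_last[OF f']) (auto simp: positions_in_def)
    next
      case True
      then have y: "0 < y" "y < d" using formatted_bounds[OF f] by auto
      have step: "aff_val (- q) z0 = aff_val p z0 - 1 * (\<Delta> / sin (ang y))"
        using strip_values(2)[OF f True] by (simp add: aff_val_simps)
      have "first_position y (- q) - K = (first_position y p - K) - (real d)\<^sup>2 * csc2 (ang y)"
        using first_position_strip_step[OF step y] by simp
      moreover have "(first_position y p - K) - (real d)\<^sup>2 * csc2 (ang y) \<in> cos_lattice d"
        using cos_lattice_diff[OF _ C[OF y]] g y by (simp add: positions_in_def)
      ultimately have "first_position y (- q) - K \<in> cos_lattice d" by (simp only:)
      then show ?thesis using y True by (intro positions_from_first[OF f']) simp_all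
    qed
  next
    fix \<epsilon> x y p q r assume sh: "shape \<epsilon> x y p q r" and g: "positions_in K x y p r" and le: "d \<le> 2 * (x + y)"
    have f: "formatted \<epsilon> x y p q r" using sh by (simp add: shape_def)
    have "y \<noteq> 0" using formatted_bounds[OF f] le by auto
    moreover have "last_position y (- p) = first_position y p" by (simp add: last_position_def first_position_def aff_val_simps)
    ultimately show "positions_in K y (d - x - y) (reflect_in p q) (- p)"
      using g by (intro positions_from_last[OF formatted_first_acute[OF f le]]) (auto simp: positions_in_def)
  next
    fix \<epsilon> x y p q r assume sh: "shape \<epsilon> x y p q r" and g: "positions_in K x y p r" and le: "d \<le> 2 * (x + y)"
    have f: "formatted \<epsilon> x y p q r" using sh by (simp add: shape_def)
    have "x \<noteq> 0" using formatted_bounds[OF f] le by auto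
    moreover have "first_position x (- r) = last_position x r" by (simp add: last_position_def first_position_def aff_val_simps)
    ultimately show "positions_in K (d - x - y) x (- r) (reflect_in r q)"
      using g by (intro positions_from_first[OF formatted_last_acute[OF f le]]) (auto simp: positions_in_def)
  next
    fix \<epsilon> x y p q r assume sh: "shape \<epsilon> x y p q r" and g: "positions_in K x y p r" and le: "2 * (x + y) \<le> d"
    have f: "formatted \<epsilon> x y p q r" using sh by (simp add: shape_def)
    note f' = formatted_first_obtuse[OF f le]
    show "positions_in K x (x + y) (reflect_in p q) r"
    proof (cases "x = 0")
      case False
      then show ?thesis using g by (intro positions_from_last[OF f']) (auto simp: positions_in_def)
    next
      case True
      then have y: "0 < y" "y < d" using formatted_bounds[OF f] by auto
      have step: "aff_val (reflect_in p q) z0 = aff_val p z0 - (- 1) * (\<Delta> / sin (ang y))"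
        using strip_values(2)[OF f True] True
        by (simp add: aff_val_simps aff_form_commute[of q p] formatted_forms[OF f] ang_simps)
      have "first_position y (reflect_in p q) - K = (first_position y p - K) + (real d)\<^sup>2 * csc2 (ang y)"
        using first_position_strip_step[OF step y] by simp
      moreover have "(first_position y p - K) + (real d)\<^sup>2 * csc2 (ang y) \<in> cos_lattice d"
        using cos_lattice_add[OF _ C[OF y]] g y by (simp add: positions_in_def)
      ultimately have "first_position y (reflect_in p q) - K \<in> cos_lattice d" by (simp only:)
      then show ?thesis using y True by (intro positions_from_first[OF f']) simp_all
    qed
  next
    fix \<epsilon> x y p q r assume sh: "shape \<epsilon> x y p q r" and g: "positions_in K x y p r" and le: "2 * (x + y) \<le> d"
    have f: "formatted \<epsilon> x y p q r" using sh by (simp add: shape_def)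
    note f' = formatted_last_obtuse[OF f le]
    show "positions_in K (x + y) y p (reflect_in r q)"
    proof (cases "y = 0")
      case False
      then show ?thesis using g by (intro positions_from_first[OF f']) (auto simp: positions_in_def)
    next
      case True
      then have x: "0 < x" "x < d" using formatted_bounds[OF f] by auto
      have step: "aff_val (reflect_in r q) z0 = aff_val r z0 - (- 1) * (\<Delta> / sin (ang x))"
        using strip_values(1)[OF f True] True by (simp add: aff_val_simps formatted_forms[OF f] ang_simps)
      have "last_position x (reflect_in r q) - K = (last_position x r - K) - (real d)\<^sup>2 * csc2 (ang x)"
        using last_position_strip_step[OF step x] by simp
      moreover have "(last_position x r - K) - (real d)\<^sup>2 * csc2 (ang x) \<in> cos_lattice d"
        using cos_lattice_diff[OF _ C[OF x]] g x by (simp add: positions_in_def)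
      ultimately have "last_position x (reflect_in r q) - K \<in> cos_lattice d" by (simp only:)
      then show ?thesis using x True by (intro positions_from_last[OF f']) simp_all
    qed
  qed
  then show ?thesis by blast
qed

text \<open>A seed might have several normal forms. If the third angle is obtuse, or the domain is a half-strip
with an acute angle, the positive value of the form at \<open>(p, r)\<close> identifies \<open>q\<close>, and the signs with
respect to the reference point tell \<open>p\<close> from \<open>r\<close>.\<close>

lemma obtuse_shape_unique:
  assumes sh: "shape \<epsilon> x y p q r" and lt: "2 * (x + y) < d"
    and sh': "shape \<epsilon>' x' y' p' q' r'" and \<sigma>: "bij \<sigma>" and eq: "triple_seed p q r = relabel \<sigma> (triple_seed p' q' r')"
  shows "p' = p" "r' = r" "x' = x" "y' = y"
proof -
  have f: "formatted \<epsilon> x y p q r" and f': "formatted \<epsilon>' x' y' p' q' r'" using sh sh' by (auto simp: shape_def)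
  note F = f[unfolded formatted_def] and F' = f'[unfolded formatted_def]
  let ?t = "triple_seed p' q' r'"
  have v: "p = fst ?t $ \<sigma> 1" "q = fst ?t $ \<sigma> 2" "r = fst ?t $ \<sigma> 3"
    using eq by (metis relabel_nth(1) triple_seed_nth)+
  have ne: "\<sigma> 1 \<noteq> \<sigma> 2" "\<sigma> 1 \<noteq> \<sigma> 3" "\<sigma> 2 \<noteq> \<sigma> 3" using \<sigma> by (auto dest!: bij_is_inj injD)
  have "ang x + ang y < pi / 2" using lt by (simp only: ang_half_iff)
  then have "cos (ang x + ang y) > 0" using ang_simps(5)[of x] ang_simps(5)[of y] by (intro cos_gt_zero_pi) auto
  then have pr: "aff_form p r > 0" by (simp add: formatted_forms[OF f])
  note N = formatted_nonpos[OF f']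
  have "\<sigma> 1 \<noteq> 3" using shape_signs(1)[OF sh] shape_signs(2)[OF sh'] v(1) not_positive_and_negative[of u r'] by auto
  moreover have "\<sigma> 1 \<noteq> 2"
    using pr v N exhaust_3[of "\<sigma> 3"] ne by (auto simp: aff_form_commute[of q' p'] not_le[symmetric])
  ultimately have 1: "\<sigma> 1 = 1" using exhaust_3[of "\<sigma> 1"] by auto
  have "\<sigma> 3 \<noteq> 2" using pr v N 1 by auto
  then have 3: "\<sigma> 3 = 3" using exhaust_3[of "\<sigma> 3"] 1 ne by auto
  have 2: "\<sigma> 2 = 2" using exhaust_3[of "\<sigma> 2"] 1 3 ne by auto
  show pp: "p' = p" "r' = r" using v 1 3 by auto
  have qq: "q' = q" using v 2 by simp
  have b: "ang z \<le> pi" if "2 * z \<le> d" for z using ang_le[OF that] pi_gt_zero by linarith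
  have inj: "z = z'" if "cos (ang z) = cos (ang z')" "2 * z \<le> d" "2 * z' \<le> d" for z z'
  proof -
    have "ang z = ang z'" by (rule cos_inj_pi[OF ang_simps(5) b[OF that(2)] ang_simps(5) b[OF that(3)] that(1)])
    then have "\<not> z < z'" "\<not> z' < z" using ang_less_iff[of z z'] ang_less_iff[of z' z] by linarith+
    then show ?thesis by linarith
  qed
  have "cos (ang x') = cos (ang x)" "cos (ang y') = cos (ang y)"
    using formatted_forms(4,5)[OF f] formatted_forms(4,5)[OF f'] unfolding pp qq by simp_all
  then show "x' = x" "y' = y" using F F' inj by blast+
qed

text \<open>Compare the crossing points of the half-strip of numerator \<open>1\<close> and of its translate. Its normal form
is unique, so both crossing points belong to the coset that \<open>orb_positions\<close> provides.\<close>

lemma translation_group_upper: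
  assumes \<tau>: "\<tau> \<in> translation_group"
  shows "(real d)\<^sup>2 * (sqrt 2 * \<tau> / \<Delta>) \<in> cos_lattice d"
proof -
  let ?T = "aff_translate (\<tau> *\<^sub>R e)"
  obtain K where K: "\<forall>s\<in>orb. \<exists>\<sigma> \<epsilon> x y p q r. bij \<sigma> \<and> s = relabel \<sigma> (triple_seed p q r) \<and> shape \<epsilon> x y p q r \<and> positions_in K x y p r"
    using orb_positions by blast
  have positions_in: "positions_in K x y p r" if sh: "shape \<epsilon> x y p q r" and lt: "2 * (x + y) < d" for \<epsilon> x y p q r
  proof -
    have "triple_seed p q r \<in> orb" using sh by (simp add: shape_def)
    then obtain \<sigma> \<epsilon>' x' y' p' q' r' where *: "bij \<sigma>" "triple_seed p q r = relabel \<sigma> (triple_seed p' q' r')"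
      "shape \<epsilon>' x' y' p' q' r'" "positions_in K x' y' p' r'" using K by blast
    show ?thesis using obtuse_shape_unique[OF sh lt *(3,1,2)] *(4) by simp
  qed
  \<comment> \<open>Any normal form with \<open>2 * (x + y) < d\<close> would do; this one is known to occur.\<close>
  obtain \<epsilon> x y p q r where sh: "shape \<epsilon> x y p q r" and xy: "(x = 1 \<and> y = 0) \<or> (x = 0 \<and> y = 1)"
    using strip_one unfolding reaches_strip_def reachable_def by blast
  have lt: "2 * (x + y) < d" using xy d3 by auto
  have f: "formatted \<epsilon> x y p q r" using sh by (simp add: shape_def)
  have "shift \<tau> (triple_seed p q r) \<in> orb" using \<tau> sh by (simp add: translation_group_def shape_def)
  then have sh': "shape \<epsilon> x y (?T p) (?T q) (?T r)"
    using formatted_translate[OF f] by (simp add: shape_def translate_triple_seed)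
  note g = positions_in[OF sh lt] positions_in[OF sh' lt]
  have s: "sin (ang 1) > 0" using ang_sin_pos[of 1] d3 by simp
  show ?thesis
    using xy
  proof
    assume xy: "x = 1 \<and> y = 0"
    have "last_position 1 (?T r) - last_position 1 r = (real d)\<^sup>2 * (sqrt 2 * \<tau> / \<Delta>)"
      unfolding last_position_def aff_val_translate_e formatted_inner_e[OF f] using s \<Delta>0 xy by (simp add: field_simps)
    then show ?thesis using g xy cos_lattice_diff[of "last_position 1 (?T r) - K" d "last_position 1 r - K"] by (simp add: positions_in_def)
  next
    assume xy: "x = 0 \<and> y = 1"
    have "first_position 1 (?T p) - first_position 1 p = (real d)\<^sup>2 * (sqrt 2 * \<tau> / \<Delta>)"
      unfolding first_position_def aff_val_translate_e formatted_inner_e[OF f] using s \<Delta>0 xy by (simp add: field_simps)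
    then show ?thesis using g xy cos_lattice_diff[of "first_position 1 (?T p) - K" d "first_position 1 p - K"] by (simp add: positions_in_def)
  qed
qed

text \<open>Mutating twice at the middle of a half-strip replaces the two parallel sides by their mirror images and
returns to the same numerators. The translation that results is read off from the displacement of an
outer parallel side, which is twice the width of the half-strip.\<close>

lemma translation_group_lower:
  assumes t: "reaches_strip t"
  shows "sqrt 2 * \<Delta> * csc2 (ang t) \<in> translation_group"
proof -
  note b = strip_bounds[OF t]
  have s: "sin (ang t) > 0" using b by (intro ang_sin_pos) auto
  have sq: "sqrt 2 * sqrt 2 = (2 :: real)" by simp
  show ?thesis
    using t unfolding reaches_strip_def
  proof
    assume "reachable t 0"
    then obtain \<epsilon> p q r where sh: "shape \<epsilon> t 0 p q r" unfolding reachable_def by blast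
    have f: "formatted \<epsilon> t 0 p q r" using sh by (simp add: shape_def)
    let ?q = "reflect_in q r" and ?r = "- q"
    have sh1: "shape \<epsilon> t 0 p ?q ?r"
      using shape_middle_pos(2)[OF sh shape_signs(3)[OF sh]] b by simp
    have sh2: "shape \<epsilon> t 0 p (reflect_in ?q ?r) (- ?q)"
      using shape_middle_pos(2)[OF sh1 shape_signs(3)[OF sh1]] b by simp
    have f2: "formatted \<epsilon> t 0 p (reflect_in ?q ?r) (- ?q)" using sh2 by (simp add: shape_def)
    obtain \<tau> where \<tau>: "triple_seed p (reflect_in ?q ?r) (- ?q) = shift \<tau> (triple_seed p q r)" 
        "\<tau> \<in> translation_group" using shape_translate[OF sh sh2] by blast
    have "- ?q = aff_translate (\<tau> *\<^sub>R e) r" using \<tau>(1) by (metis translate_triple_seed triple_seed_nth(3))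
    then have "aff_val (- ?q) z0 = aff_val r z0 - \<tau> * (sqrt 2 * sin (ang t))"
      by (simp add: aff_val_translate_e formatted_inner_e[OF f])
    moreover have "aff_val (- ?q) z0 = - aff_val r z0 - 2 * aff_val q z0"
      by (simp add: aff_val_simps aff_form_commute[of r q] formatted_forms[OF f] ang_simps)
    ultimately have "\<tau> * (sqrt 2 * sin (ang t)) = 2 * (aff_val q z0 + aff_val r z0)" by simp
    then have "\<tau> * sin (ang t) * sqrt 2 = sqrt 2 * (\<Delta> / sin (ang t)) * sqrt 2"
      using strip_values(1)[OF f] by (simp add: mult_ac)
    then have "\<tau> * sin (ang t) = sqrt 2 * (\<Delta> / sin (ang t))" by (simp only: mult_cancel_right) simp
    then have "\<tau> = sqrt 2 * \<Delta> * csc2 (ang t)"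
      unfolding csc2_def using s by (simp add: field_simps power2_eq_square)
    then show ?thesis using \<tau>(2) by simp
  next
    assume "reachable 0 t"
    then obtain \<epsilon> p q r where sh: "shape \<epsilon> 0 t p q r" unfolding reachable_def by blast
    have f: "formatted \<epsilon> 0 t p q r" using sh by (simp add: shape_def)
    let ?q = "reflect_in q p" and ?p = "- q"
    have sh1: "shape \<epsilon> 0 t ?p ?q r"
      using shape_middle_neg(2)[OF sh shape_signs(4)[OF sh]] b by simp
    have sh2: "shape \<epsilon> 0 t (- ?q) (reflect_in ?q ?p) r"
      using shape_middle_neg(2)[OF sh1 shape_signs(4)[OF sh1]] b by simp
    obtain \<tau> where \<tau>: "triple_seed (- ?q) (reflect_in ?q ?p) r = shift \<tau> (triple_seed p q r)" 
        "\<tau> \<in> translation_group" using shape_translate[OF sh sh2] by blast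
    have "- ?q = aff_translate (\<tau> *\<^sub>R e) p" using \<tau>(1) by (metis translate_triple_seed triple_seed_nth(1))
    then have "aff_val (- ?q) z0 = aff_val p z0 + \<tau> * (sqrt 2 * sin (ang t))"
      by (simp add: aff_val_translate_e formatted_inner_e[OF f])
    moreover have "aff_val (- ?q) z0 = - aff_val p z0 - 2 * aff_val q z0"
      by (simp add: aff_val_simps formatted_forms[OF f] ang_simps)
    ultimately have "- \<tau> * (sqrt 2 * sin (ang t)) = 2 * (aff_val p z0 + aff_val q z0)" by simp
    then have "- \<tau> * sin (ang t) * sqrt 2 = sqrt 2 * (\<Delta> / sin (ang t)) * sqrt 2"
      using strip_values(2)[OF f] by (simp add: mult_ac)
    then have "- \<tau> * sin (ang t) = sqrt 2 * (\<Delta> / sin (ang t))" by (simp only: mult_cancel_right) simp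
    then have "- \<tau> = sqrt 2 * \<Delta> * csc2 (ang t)"
      unfolding csc2_def using s by (simp add: field_simps power2_eq_square)
    then show ?thesis using translation_group_minus[OF \<tau>(2)] by simp
  qed
qed

text \<open>The translation lengths provided by the half-strips.\<close>

definition shift_lattice :: "real set" where
  "shift_lattice = {\<Sum>y\<in>half_units d. of_int (n y) * (sqrt 2 * \<Delta> * csc2 (ang y)) | n :: nat \<Rightarrow> int. True}"

lemma lattice_translations: "shift_lattice \<subseteq> translation_group"
  unfolding shift_lattice_def
  by (auto intro!: translation_group_sum translation_group_of_int translation_group_lower strip_coprime simp: half_units_def)

lemma lattice_add: "a \<in> shift_lattice \<Longrightarrow> b \<in> shift_lattice \<Longrightarrow> a + b \<in> shift_lattice"
proof -
  assume "a \<in> shift_lattice" "b \<in> shift_lattice"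
  then obtain n m :: "nat \<Rightarrow> int" where "a = (\<Sum>y\<in>half_units d. of_int (n y) * (sqrt 2 * \<Delta> * csc2 (ang y)))"
    "b = (\<Sum>y\<in>half_units d. of_int (m y) * (sqrt 2 * \<Delta> * csc2 (ang y)))" unfolding shift_lattice_def by blast
  then have "a + b = (\<Sum>y\<in>half_units d. of_int (n y + m y) * (sqrt 2 * \<Delta> * csc2 (ang y)))"
    by (simp add: sum.distrib algebra_simps)
  then show ?thesis unfolding shift_lattice_def by (intro CollectI exI[of _ "\<lambda>y. n y + m y"]) simp
qed

lemma lattice_minus: "a \<in> shift_lattice \<Longrightarrow> - a \<in> shift_lattice"
proof -
  assume "a \<in> shift_lattice"
  then obtain n :: "nat \<Rightarrow> int" where "a = (\<Sum>y\<in>half_units d. of_int (n y) * (sqrt 2 * \<Delta> * csc2 (ang y)))" unfolding shift_lattice_def by blast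
  then have "- a = (\<Sum>y\<in>half_units d. of_int (- n y) * (sqrt 2 * \<Delta> * csc2 (ang y)))"
    by (simp add: sum_negf)
  then show ?thesis unfolding shift_lattice_def by (intro CollectI exI[of _ "\<lambda>y. - n y"]) simp
qed

lemma lattice_finite_index: "\<exists>F. finite F \<and> (\<forall>\<tau>\<in>translation_group. \<exists>l\<in>shift_lattice. \<tau> - l \<in> F)"
proof -
  obtain F where F: "finite F" "\<And>a. (real d)\<^sup>2 * a \<in> cos_lattice d \<Longrightarrow>
     (\<exists>n :: nat \<Rightarrow> int. a - (\<Sum>y\<in>half_units d. of_int (n y) * (2 * csc2 (pi * real y / real d))) \<in> F)"
    using csc2_span_finite_index[OF d3] by blast
  have "\<exists>l\<in>shift_lattice. \<tau> - l \<in> (\<lambda>f. \<Delta> / sqrt 2 * f) ` F" if \<tau>: "\<tau> \<in> translation_group" for \<tau>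
  proof -
    obtain n :: "nat \<Rightarrow> int" where n: "sqrt 2 * \<tau> / \<Delta> - (\<Sum>y\<in>half_units d. of_int (n y) * (2 * csc2 (ang y))) \<in> F"
      using F(2)[OF translation_group_upper[OF \<tau>]] unfolding ang_def by blast
    let ?l = "\<Sum>y\<in>half_units d. of_int (n y) * (sqrt 2 * \<Delta> * csc2 (ang y))"
    have 2: "\<Delta> / sqrt 2 * 2 = sqrt 2 * \<Delta>" by (simp add: field_simps)
    have c: "\<Delta> / sqrt 2 * (k * (2 * z)) = k * (sqrt 2 * \<Delta> * z)" for k z
    proof -
      have "\<Delta> / sqrt 2 * (k * (2 * z)) = (\<Delta> / sqrt 2 * 2) * (k * z)" by (simp only: mult_ac)
      then show ?thesis unfolding 2 by (simp only: mult_ac)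
    qed
    have e1: "?l = \<Delta> / sqrt 2 * (\<Sum>y\<in>half_units d. of_int (n y) * (2 * csc2 (ang y)))"
      unfolding sum_distrib_left c ..
    have e2: "\<Delta> / sqrt 2 * (sqrt 2 * \<tau> / \<Delta>) = \<tau>" using \<Delta>0 by simp
    have "\<tau> - ?l = \<Delta> / sqrt 2 * (sqrt 2 * \<tau> / \<Delta> - (\<Sum>y\<in>half_units d. of_int (n y) * (2 * csc2 (ang y))))"
      by (simp only: right_diff_distrib e1 e2)
    then have m: "\<tau> - ?l \<in> (\<lambda>f. \<Delta> / sqrt 2 * f) ` F" using n by (rule image_eqI)
    have "?l \<in> shift_lattice" unfolding shift_lattice_def by (intro CollectI exI[of _ n] conjI refl TrueI)
    from bexI[of "\<lambda>l. \<tau> - l \<in> (\<lambda>f. \<Delta> / sqrt 2 * f) ` F", OF m this] show ?thesis .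
  qed
  then show ?thesis using F(1) by (intro exI[of _ "(\<lambda>f. \<Delta> / sqrt 2 * f) ` F"]) auto
qed

definition lattice_vectors :: "(real^2) set" where
  "lattice_vectors = (\<lambda>l. l *\<^sub>R e) ` shift_lattice"

lemma lattice_vectors_rank: "lattice_of_rank lattice_vectors (card (half_units d))"
proof -
  let ?f = "\<lambda>y. (sqrt 2 * \<Delta> * csc2 (ang y)) *\<^sub>R e"
  have e0: "e \<noteq> 0" using e1 by auto
  have sum: "(\<Sum>y\<in>half_units d. of_int (n y) *\<^sub>R ?f y) = (\<Sum>y\<in>half_units d. of_int (n y) * (sqrt 2 * \<Delta> * csc2 (ang y))) *\<^sub>R e" for n :: "nat \<Rightarrow> int"
    by (simp add: scaleR_sum_left)
  have "lattice_of_rank {\<Sum>y\<in>half_units d. of_int (n y) *\<^sub>R ?f y | n :: nat \<Rightarrow> int. True} (card (half_units d))"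
  proof (rule lattice_of_rank_image)
    fix n :: "nat \<Rightarrow> int" assume "(\<Sum>y\<in>half_units d. of_int (n y) *\<^sub>R ?f y) = 0"
    then have "(\<Sum>y\<in>half_units d. of_int (n y) * (sqrt 2 * \<Delta> * csc2 (ang y))) = 0" unfolding sum using e0 by simp
    moreover have "(\<Sum>y\<in>half_units d. of_int (n y) * (sqrt 2 * \<Delta> * csc2 (ang y))) = sqrt 2 * \<Delta> * (\<Sum>y\<in>half_units d. of_int (n y) * csc2 (pi * real y / real d))"
      unfolding sum_distrib_left ang_def by (intro sum.cong refl) (simp add: mult_ac)
    ultimately have "(\<Sum>y\<in>half_units d. of_int (n y) * csc2 (pi * real y / real d)) = 0" using \<Delta>0 by simp
    then show "\<forall>y\<in>half_units d. n y = 0" using csc2_independent[OF d3] by blast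
  qed simp
  moreover have "{\<Sum>y\<in>half_units d. of_int (n y) *\<^sub>R ?f y | n :: nat \<Rightarrow> int. True} = lattice_vectors"
    unfolding lattice_vectors_def shift_lattice_def sum by auto
  ultimately show ?thesis by simp
qed

lemma unlabelled_orb:
  assumes "s \<in> orb"
  obtains s' where "s' \<in> mutation_orbit u s0" "unlabelled s = unlabelled s'" "\<And>k. \<exists>k'. unlabelled (mutate u k s) = unlabelled (mutate u k' s')"
proof -
  obtain \<sigma> s' where s: "s = relabel \<sigma> s'" "bij \<sigma>" "s' \<in> mutation_orbit u s0" using assms by (rule orb_E)
  show ?thesis
    by (rule that[OF s(3)]) (auto simp: s(1) unlabelled_relabel[OF s(2)] mutate_relabel[OF s(2)])
qed

lemma exchange_vertices_orb: "exchange_vertices u s0 = unlabelled ` orb"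
proof (intro equalityI subsetI)
  fix X assume "X \<in> unlabelled ` orb"
  then obtain s where s: "s \<in> orb" "X = unlabelled s" by blast
  obtain s' where "s' \<in> mutation_orbit u s0" "unlabelled s = unlabelled s'" by (rule unlabelled_orb[OF s(1)])
  then show "X \<in> exchange_vertices u s0" unfolding exchange_vertices_def s(2) by blast
qed (auto simp: exchange_vertices_def intro: orb_I)

lemma exchange_edges_orb: "exchange_edges u s0 = {{unlabelled s, unlabelled (mutate u k s)} | s k. s \<in> orb}"
proof (intro equalityI subsetI)
  fix E assume "E \<in> {{unlabelled s, unlabelled (mutate u k s)} | s k. s \<in> orb}"
  then obtain s k where E: "E = {unlabelled s, unlabelled (mutate u k s)}" "s \<in> orb" by blast
  obtain s' k' where "s' \<in> mutation_orbit u s0" "unlabelled s = unlabelled s'" "unlabelled (mutate u k s) = unlabelled (mutate u k' s')"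
    using unlabelled_orb[OF E(2)] by metis
  then show "E \<in> exchange_edges u s0" unfolding exchange_edges_def E(1) by (intro CollectI exI[of _ s'] exI[of _ k']) simp
qed (auto simp: exchange_edges_def intro: orb_I)

lemma shift_edge:
  assumes s: "s \<in> orb" and \<tau>: "\<tau> \<in> translation_group"
  shows "image (seed_translate (\<tau> *\<^sub>R e)) ` {unlabelled s, unlabelled (mutate u k s)} = {unlabelled (shift \<tau> s), unlabelled (mutate u k (shift \<tau> s))}"
  using mutate_shift[OF s, of \<tau> k] s \<tau> by (simp add: seed_translate_unlabelled translation_group_def)

lemma lattice_acts: "acts_on_exchange_graph lattice_vectors u s0"
  unfolding acts_on_exchange_graph_def
proof (intro ballI conjI)
  fix w X assume w: "w \<in> lattice_vectors" and X: "X \<in> exchange_vertices u s0"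
  obtain \<tau> where \<tau>: "\<tau> \<in> translation_group" "w = \<tau> *\<^sub>R e" using w lattice_translations by (auto simp: lattice_vectors_def)
  obtain s where s: "s \<in> orb" "X = unlabelled s" using X by (auto simp: exchange_vertices_orb)
  have "shift \<tau> s \<in> orb" using \<tau> s by (simp add: translation_group_def)
  then show "seed_translate w ` X \<in> exchange_vertices u s0"
    by (simp add: s(2) \<tau>(2) seed_translate_unlabelled exchange_vertices_orb)
next
  fix w E assume w: "w \<in> lattice_vectors" and E: "E \<in> exchange_edges u s0"
  obtain \<tau> where \<tau>: "\<tau> \<in> translation_group" "w = \<tau> *\<^sub>R e" using w lattice_translations by (auto simp: lattice_vectors_def)
  obtain s k where s: "s \<in> orb" "E = {unlabelled s, unlabelled (mutate u k s)}" using E by (auto simp: exchange_edges_orb)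
  have "shift \<tau> s \<in> orb" using \<tau> s by (simp add: translation_group_def)
  then show "image (seed_translate w) ` E \<in> exchange_edges u s0"
    unfolding s(2) \<tau>(2) shift_edge[OF s(1) \<tau>(1)] exchange_edges_orb by blast
qed

text \<open>Stated for an arbitrary action so that it serves vertices and edges.\<close>

lemma lattice_orbit_shift:
  assumes act: "\<And>w w'. g w (g w' X) = g (w + w') X" and l: "l \<in> shift_lattice"
  shows "{g w (g (l *\<^sub>R e) X) | w. w \<in> lattice_vectors} = {g w X | w. w \<in> lattice_vectors}"
proof (intro equalityI subsetI)
  fix Y assume "Y \<in> {g w (g (l *\<^sub>R e) X) | w. w \<in> lattice_vectors}"
  then obtain m where m: "m \<in> shift_lattice" "Y = g (m *\<^sub>R e + l *\<^sub>R e) X" by (auto simp: lattice_vectors_def act)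
  then have "Y = g ((m + l) *\<^sub>R e) X" by (simp add: scaleR_add_left)
  then show "Y \<in> {g w X | w. w \<in> lattice_vectors}" using lattice_add[OF m(1) l] by (auto simp: lattice_vectors_def)
next
  fix Y assume "Y \<in> {g w X | w. w \<in> lattice_vectors}"
  then obtain m where m: "m \<in> shift_lattice" "Y = g (m *\<^sub>R e) X" by (auto simp: lattice_vectors_def)
  then have "Y = g ((m + - l) *\<^sub>R e) (g (l *\<^sub>R e) X)" by (simp add: act flip: scaleR_add_left)
  then show "Y \<in> {g w (g (l *\<^sub>R e) X) | w. w \<in> lattice_vectors}" using lattice_add[OF m(1) lattice_minus[OF l]] by (auto simp: lattice_vectors_def)
qed

text \<open>There are finitely many triples \<open>(\<epsilon>, x, y)\<close>; seeds with equal triples differ by an element of the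
translation group, in which the lattice has finite index.\<close>

lemma finite_representatives:
  obtains S where "finite S" "S \<subseteq> orb" "\<And>s. s \<in> orb \<Longrightarrow> \<exists>\<sigma> s1 l. bij \<sigma> \<and> s1 \<in> S \<and> l \<in> shift_lattice \<and> s = relabel \<sigma> (shift l s1)"
proof -
  define G where "G = {(\<epsilon> :: real, x, y). \<exists>p q r. shape \<epsilon> x y p q r}"
  have "G \<subseteq> {1, -1} \<times> {..d} \<times> {..d}" unfolding G_def shape_def formatted_def by auto
  then have finG: "finite G" by (rule finite_subset) auto
  \<comment> \<open>One seed for each triple of parameters that occurs.\<close>
  define R where "R = (\<lambda>(\<epsilon>, x, y). SOME t. \<exists>p q r. shape \<epsilon> x y p q r \<and> t = triple_seed p q r)"
  have R: "\<exists>p q r. shape \<epsilon> x y p q r \<and> R (\<epsilon>, x, y) = triple_seed p q r" if "(\<epsilon>, x, y) \<in> G" for \<epsilon> x y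
  proof -
    have "\<exists>t p q r. shape \<epsilon> x y p q r \<and> t = triple_seed p q r" using that unfolding G_def by blast
    from someI_ex[OF this] show ?thesis unfolding R_def by simp
  qed
  obtain F where F: "finite F" "\<And>\<tau>. \<tau> \<in> translation_group \<Longrightarrow> \<exists>l\<in>shift_lattice. \<tau> - l \<in> F" using lattice_finite_index by blast
  define S where "S = (\<lambda>(g, f). shift f (R g)) ` (G \<times> F) \<inter> orb"
  have fin: "finite S" unfolding S_def using finG F(1) by auto
  have repr: "\<exists>\<sigma> s1 l. bij \<sigma> \<and> s1 \<in> S \<and> l \<in> shift_lattice \<and> s = relabel \<sigma> (shift l s1)" if s: "s \<in> orb" for s
  proof -
    obtain \<sigma> \<epsilon> x y p q r where r: "bij \<sigma>" "s = relabel \<sigma> (triple_seed p q r)" "shape \<epsilon> x y p q r"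
      using s by (rule orb_shape)
    have g: "(\<epsilon>, x, y) \<in> G" using r(3) unfolding G_def by blast
    then obtain p' q' r' where r': "shape \<epsilon> x y p' q' r'" "R (\<epsilon>, x, y) = triple_seed p' q' r'" using R by blast
    obtain \<tau> where \<tau>: "\<tau> \<in> translation_group" "triple_seed p q r = shift \<tau> (triple_seed p' q' r')"
      using shape_translate[OF r'(1) r(3)] by blast
    obtain l where l: "l \<in> shift_lattice" "\<tau> - l \<in> F" using F(2)[OF \<tau>(1)] by blast
    have "\<tau> + - l \<in> translation_group"
      using l(1) lattice_translations \<tau>(1) by (intro translation_group_add translation_group_minus) auto
    then have o: "shift (\<tau> - l) (triple_seed p' q' r') \<in> orb" using r'(1) by (simp add: translation_group_def shape_def)
    then have inS: "shift (\<tau> - l) (triple_seed p' q' r') \<in> S"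
      unfolding S_def using g l(2) by (intro IntI image_eqI[of _ _ "((\<epsilon>, x, y), \<tau> - l)"]) (simp_all add: r'(2))
    have eq: "triple_seed p q r = shift l (shift (\<tau> - l) (triple_seed p' q' r'))"
      unfolding \<tau>(2) seed_translate_add by (simp flip: scaleR_add_left)
    show ?thesis
      by (intro exI[of _ \<sigma>] exI[of _ "shift (\<tau> - l) (triple_seed p' q' r')"] exI[of _ l] conjI r(1) inS l(1))
        (simp only: r(2) eq)
  qed
  have sub: "S \<subseteq> orb" unfolding S_def by (rule Int_lower2)
  show ?thesis by (rule that[OF fin sub repr])
qed

lemma finite_vertex_orbits: "finite (vertex_orbits lattice_vectors u s0)"
proof -
  obtain S where S: "finite S" "S \<subseteq> orb" "\<And>s. s \<in> orb \<Longrightarrow> \<exists>\<sigma> s1 l. bij \<sigma> \<and> s1 \<in> S \<and> l \<in> shift_lattice \<and> s = relabel \<sigma> (shift l s1)"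
    by (rule finite_representatives) blast
  let ?O = "\<lambda>X. {seed_translate w ` X | w. w \<in> lattice_vectors}"
  have "vertex_orbits lattice_vectors u s0 \<subseteq> (\<lambda>s. ?O (unlabelled s)) ` S"
  proof
    fix Y assume "Y \<in> vertex_orbits lattice_vectors u s0"
    then obtain s where s: "s \<in> orb" "Y = ?O (unlabelled s)" unfolding vertex_orbits_def exchange_vertices_orb by blast
    obtain \<sigma> s1 l where r: "bij \<sigma>" "s1 \<in> S" "l \<in> shift_lattice" "s = relabel \<sigma> (shift l s1)" using S(3)[OF s(1)] by blast
    have "unlabelled s = seed_translate (l *\<^sub>R e) ` unlabelled s1"
      by (simp add: r(4) unlabelled_relabel[OF r(1)] seed_translate_unlabelled)
    then have "Y = ?O (unlabelled s1)"
      unfolding s(2) using lattice_orbit_shift[where g = "\<lambda>w X. seed_translate w ` X" and X = "unlabelled s1", OF _ r(3)]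
      by (simp add: image_image seed_translate_add)
    then show "Y \<in> (\<lambda>s. ?O (unlabelled s)) ` S" using r(2) by blast
  qed
  then show ?thesis using S(1) by (rule finite_subset[OF _ finite_imageI])
qed

lemma finite_edge_orbits: "finite (edge_orbits lattice_vectors u s0)"
proof -
  obtain S where S: "finite S" "S \<subseteq> orb" "\<And>s. s \<in> orb \<Longrightarrow> \<exists>\<sigma> s1 l. bij \<sigma> \<and> s1 \<in> S \<and> l \<in> shift_lattice \<and> s = relabel \<sigma> (shift l s1)"
    by (rule finite_representatives) blast
  let ?O = "\<lambda>E. {image (seed_translate w) ` E | w. w \<in> lattice_vectors}"
  let ?E = "\<lambda>s k. {unlabelled s, unlabelled (mutate u k s)}"
  have "edge_orbits lattice_vectors u s0 \<subseteq> (\<lambda>(s, k). ?O (?E s k)) ` (S \<times> (UNIV :: 3 set))"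
  proof
    fix Y assume "Y \<in> edge_orbits lattice_vectors u s0"
    then obtain s k where s: "s \<in> orb" "Y = ?O (?E s k)" unfolding edge_orbits_def exchange_edges_orb by blast
    obtain \<sigma> s1 l where r: "bij \<sigma>" "s1 \<in> S" "l \<in> shift_lattice" "s = relabel \<sigma> (shift l s1)" using S(3)[OF s(1)] by blast
    have o: "s1 \<in> orb" "l \<in> translation_group" using r(2,3) S(2) lattice_translations by auto
    have "?E s k = image (seed_translate (l *\<^sub>R e)) ` ?E s1 (\<sigma> k)"
      unfolding shift_edge[OF o] by (simp add: r(4) mutate_relabel[OF r(1)] unlabelled_relabel[OF r(1)])
    then have "Y = ?O (?E s1 (\<sigma> k))"
      unfolding s(2) using lattice_orbit_shift[where g = "\<lambda>w E. image (seed_translate w) ` E" and X = "?E s1 (\<sigma> k)", OF _ r(3)]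
      by (simp add: image_image seed_translate_add)
    then show "Y \<in> (\<lambda>(s, k). ?O (?E s k)) ` (S \<times> (UNIV :: 3 set))" using r(2) by auto
  qed
  moreover have "finite (S \<times> (UNIV :: 3 set))" using S(1) by simp
  ultimately show ?thesis by (rule finite_subset[OF _ finite_imageI])
qed

theorem lattice_of_translations:
  "\<exists>L n. lattice_of_rank L n \<and> acts_on_exchange_graph L u s0 \<and> finite (vertex_orbits L u s0) \<and>
     finite (edge_orbits L u s0) \<and> real n = real (totient d) / 2"
  using lattice_vectors_rank lattice_acts finite_vertex_orbits finite_edge_orbits totient_eq_half_units[OF d3]
  by (intro exI[of _ lattice_vectors] exI[of _ "card (half_units d)"]) simp

end

section \<open>Triangles and half-strips\<close>

text \<open>If all normal vectors have negative product with \<open>z\<close>, then the domain contains the ray in direction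
\<open>z\<close> from each of its points. A bound in direction \<open>m\<close> makes \<open>z\<close> orthogonal to \<open>m\<close>; but
the vector \<open>z + \<delta> m\<close>, for small positive \<open>\<delta>\<close>, works equally well and is not orthogonal to \<open>m\<close>.\<close>

lemma no_cone_if_bounded_direction:
  fixes s :: "3 seed"
  assumes ne: "x0 \<in> seed_domain s" and m: "m \<noteq> 0" and bd: "\<And>x. x \<in> seed_domain s \<Longrightarrow> \<bar>m \<bullet> x\<bar> \<le> C"
  shows "in_no_cone s"
  unfolding in_no_cone_def
proof
  assume "\<exists>z. \<forall>i. fst (fst s $ i) \<bullet> z < 0"
  then obtain z where z: "\<And>i. fst (fst s $ i) \<bullet> z < 0" by blast
  have ray: "m \<bullet> z' = 0" if z': "\<And>i. fst (fst s $ i) \<bullet> z' < 0" for z'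
  proof (rule ccontr)
    assume nz: "m \<bullet> z' \<noteq> 0"
    define t where "t = (C + \<bar>m \<bullet> x0\<bar> + 1) / \<bar>m \<bullet> z'\<bar>"
    have C0: "C \<ge> 0" using bd[OF ne] by linarith
    have t: "t \<ge> 0" using C0 by (simp add: t_def)
    have "x0 + t *\<^sub>R z' \<in> seed_domain s"
      unfolding seed_domain_def half_plane_def
    proof (intro INT_I CollectI)
      fix i
      have "aff_val (fst s $ i) x0 < 0" using ne by (auto simp: seed_domain_def half_plane_def)
      moreover have "aff_val (fst s $ i) (x0 + t *\<^sub>R z') = aff_val (fst s $ i) x0 + t * (fst (fst s $ i) \<bullet> z')"
        by (simp add: aff_val_def inner_add_right)
      moreover have "t * (fst (fst s $ i) \<bullet> z') \<le> 0" using t z'[of i] by (simp add: mult_nonneg_nonpos)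
      ultimately show "aff_val (fst s $ i) (x0 + t *\<^sub>R z') < 0" by linarith
    qed
    from bd[OF this] have "\<bar>m \<bullet> x0 + t * (m \<bullet> z')\<bar> \<le> C" by (simp add: inner_add_right)
    moreover have "\<bar>t * (m \<bullet> z')\<bar> = C + \<bar>m \<bullet> x0\<bar> + 1" using nz C0 by (simp add: t_def abs_mult)
    ultimately show False by linarith
  qed
  have "\<forall>\<^sub>F \<delta> in at_right 0. fst (fst s $ i) \<bullet> (z + \<delta> *\<^sub>R m) < 0" for i
  proof (rule order_tendstoD)
    show "((\<lambda>\<delta>. fst (fst s $ i) \<bullet> (z + \<delta> *\<^sub>R m)) \<longlongrightarrow> fst (fst s $ i) \<bullet> (z + 0 *\<^sub>R m)) (at_right 0)"
      by (intro tendsto_intros)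
    show "fst (fst s $ i) \<bullet> (z + 0 *\<^sub>R m) < 0" using z by simp
  qed
  then have "\<forall>\<^sub>F \<delta> in at_right 0. \<forall>i. fst (fst s $ i) \<bullet> (z + \<delta> *\<^sub>R m) < 0"
    by (simp add: forall_3 eventually_conj)
  moreover have "\<forall>\<^sub>F \<delta> in at_right 0. (0::real) < \<delta>" by (simp add: eventually_at_right_less)
  ultimately have "\<forall>\<^sub>F \<delta> in at_right 0. 0 < \<delta> \<and> (\<forall>i. fst (fst s $ i) \<bullet> (z + \<delta> *\<^sub>R m) < 0)"
    by (simp add: eventually_conj)
  then have "\<exists>\<delta>. 0 < \<delta> \<and> (\<forall>i. fst (fst s $ i) \<bullet> (z + \<delta> *\<^sub>R m) < 0)"
    by (rule eventually_happens'[OF trivial_limit_at_right_real])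
  then obtain \<delta> where \<delta>: "0 < \<delta>" "\<And>i. fst (fst s $ i) \<bullet> (z + \<delta> *\<^sub>R m) < 0" by blast
  have "m \<bullet> z + \<delta> * (m \<bullet> m) = 0" using ray[OF \<delta>(2)] by (simp add: inner_add_right)
  then show False using ray[OF z] \<delta>(1) m by simp
qed

lemma triangle_interior_nonempty:
  fixes P Q R :: "real^2"
  assumes "\<not> collinear {P, Q, R}"
  shows "interior (convex hull {P, Q, R}) \<noteq> {}"
proof -
  have "\<not> affine_dependent {P, Q, R}" using assms collinear_3_eq_affine_dependent by blast
  moreover have "P \<noteq> Q" "P \<noteq> R" "Q \<noteq> R" using assms by (auto simp: insert_commute)
  then have "card {P, Q, R} = Suc DIM(real^2)" by simp
  ultimately show ?thesis by (simp add: interior_convex_hull_eq_empty)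
qed

lemma in_no_cone_triangle:
  fixes s :: "3 seed"
  assumes "is_triangle (seed_domain s)"
  shows "in_no_cone s"
proof -
  obtain P Q R where nc: "\<not> collinear {P, Q, R}" and D: "seed_domain s = interior (convex hull {P, Q, R})"
    using assms unfolding is_triangle_def by blast
  obtain x0 where x0: "x0 \<in> seed_domain s" using triangle_interior_nonempty[OF nc] D by auto
  have "bounded (seed_domain s)" unfolding D
    by (rule bounded_subset[OF _ interior_subset]) (intro bounded_convex_hull, simp)
  then obtain C where C: "\<And>x. x \<in> seed_domain s \<Longrightarrow> norm x \<le> C" by (auto simp: bounded_iff)
  show ?thesis
  proof (rule no_cone_if_bounded_direction[OF x0])
    show "axis 1 1 \<noteq> (0 :: real^2)" by (simp add: axis_eq_0_iff)
    fix x assume "x \<in> seed_domain s"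
    have "\<bar>axis 1 1 \<bullet> x\<bar> \<le> norm (axis 1 1 :: real^2) * norm x" by (rule Cauchy_Schwarz_ineq2)
    then show "\<bar>axis 1 1 \<bullet> x\<bar> \<le> C" using C[OF \<open>x \<in> _\<close>] by simp
  qed
qed

lemma in_no_cone_half_strip:
  fixes s :: "3 seed"
  assumes "is_half_strip (seed_domain s)"
  shows "in_no_cone s"
proof -
  obtain P Q e where nc: "\<not> collinear {P, Q, P + e}" and D: "seed_domain s = {P + s *\<^sub>R (Q - P) + t *\<^sub>R e | s t. 0 < s \<and> s < 1 \<and> 0 < t}"
    using assms unfolding is_half_strip_def by blast
  have x0: "P + (1/2) *\<^sub>R (Q - P) + 1 *\<^sub>R e \<in> seed_domain s" unfolding D
    by (intro CollectI exI[of _ "1/2"] exI[of _ 1]) simp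
  have e: "e \<noteq> 0"
  proof
    assume "e = 0"
    then have "{P, Q, P + e} = {P, Q}" by auto
    then show False using nc collinear_2 by metis
  qed
  define m where "m = (vector [- e $ 2, e $ 1] :: real^2)"
  have m: "m \<noteq> 0" using e by (auto simp: m_def vec_eq_iff forall_2 vector_2)
  have me: "m \<bullet> e = 0" by (simp add: m_def inner_vec_def sum_2 vector_2)
  show ?thesis
  proof (rule no_cone_if_bounded_direction[OF x0 m])
    fix x assume "x \<in> seed_domain s"
    then obtain a t where x: "x = P + a *\<^sub>R (Q - P) + t *\<^sub>R e" "0 < a" "a < 1" unfolding D by blast
    have "m \<bullet> x = m \<bullet> P + a * (m \<bullet> (Q - P))" by (simp add: x(1) inner_add_right me)
    moreover have "\<bar>a * (m \<bullet> (Q - P))\<bar> \<le> 1 * \<bar>m \<bullet> (Q - P)\<bar>" unfolding abs_mult using x by (intro mult_right_mono) auto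
    ultimately show "\<bar>m \<bullet> x\<bar> \<le> \<bar>m \<bullet> P\<bar> + \<bar>m \<bullet> (Q - P)\<bar>" by linarith
  qed
qed

lemma convex_aff_val: "convex {x. aff_val f x \<le> 0}" "convex {x. aff_val f x = 0}"
proof -
  have 1: "{x. aff_val f x \<le> 0} = {x. fst f \<bullet> x \<le> - snd f}" "{x. aff_val f x = 0} = {x. fst f \<bullet> x = - snd f}"
    by (auto simp: aff_val_def)
  show "convex {x. aff_val f x \<le> 0}" "convex {x. aff_val f x = 0}"
    unfolding 1 by (rule convex_halfspace_le, rule convex_hyperplane)
qed

lemma side_midpoint_not_interior:
  fixes P Q R :: "real^2"
  assumes nc: "\<not> collinear {P, Q, R}"
  shows "midpoint Q R \<notin> interior (convex hull {P, Q, R})"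
proof
  assume M: "midpoint Q R \<in> interior (convex hull {P, Q, R})"
  have QR: "Q \<noteq> R" using nc by (auto simp: insert_commute)
  define a where "a = (vector [- (R - Q) $ 2, (R - Q) $ 1] :: real^2)"
  have a: "a \<noteq> 0" using QR by (auto simp: a_def vec_eq_iff forall_2 vector_2)
  have aR: "a \<bullet> (R - Q) = 0" by (simp add: a_def inner_vec_def sum_2 vector_2 algebra_simps)
  define c where "c = (if a \<bullet> (P - Q) \<le> 0 then a else - a)"
  have c: "c \<noteq> 0" "c \<bullet> (R - Q) = 0" "c \<bullet> (P - Q) \<le> 0" using a aR by (auto simp: c_def)
  have "convex hull {P, Q, R} \<subseteq> {x. c \<bullet> x \<le> c \<bullet> Q}"
    by (rule hull_minimal) (use c in \<open>auto simp: inner_diff_right convex_halfspace_le\<close>)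
  then have "interior (convex hull {P, Q, R}) \<subseteq> interior {x. c \<bullet> x \<le> c \<bullet> Q}" by (rule interior_mono)
  then have "c \<bullet> midpoint Q R < c \<bullet> Q" using M c(1) by auto
  moreover have "c \<bullet> midpoint Q R = c \<bullet> Q" using c(2) by (simp add: midpoint_def inner_diff_right inner_add_right)
  ultimately show False by simp
qed

text \<open>The midpoint of a side is not in the open triangle, so one of the three functions is nonnegative there.
As this function is nonpositive on the closed triangle, it vanishes at both ends of the side.\<close>

lemma triangle_side_line:
  fixes s :: "3 seed"
  assumes nc: "\<not> collinear {P, Q, R}" and D: "seed_domain s = interior (convex hull {P, Q, R})"
  shows "\<exists>i. aff_val (fst s $ i) Q = 0 \<and> aff_val (fst s $ i) R = 0 \<and> aff_val (fst s $ i) P < 0"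
proof -
  let ?H = "convex hull {P, Q, R}"
  have ne: "interior ?H \<noteq> {}" by (rule triangle_interior_nonempty[OF nc])
  have cl: "closure (interior ?H) = ?H"
    using convex_closure_interior[OF convex_convex_hull ne] compact_imp_closed[OF compact_convex_hull[OF finite_imp_compact, of "{P, Q, R}"]]
    by (simp add: closure_closed)
  have le: "aff_val (fst s $ i) x \<le> 0" if "x \<in> ?H" for i x
  proof -
    have "interior ?H \<subseteq> {x. aff_val (fst s $ i) x \<le> 0}"
      unfolding D[symmetric] seed_domain_def half_plane_def by (auto intro: less_imp_le)
    moreover have "closed {x. aff_val (fst s $ i) x \<le> 0}"
      unfolding aff_val_def by (intro closed_Collect_le continuous_intros)
    ultimately have "closure (interior ?H) \<subseteq> {x. aff_val (fst s $ i) x \<le> 0}" by (rule closure_minimal)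
    then show ?thesis using that cl by auto
  qed
  have "midpoint Q R \<notin> seed_domain s" unfolding D by (rule side_midpoint_not_interior[OF nc])
  then obtain i where i: "aff_val (fst s $ i) (midpoint Q R) \<ge> 0"
    by (auto simp: seed_domain_def half_plane_def not_less)
  have v: "aff_val (fst s $ i) P \<le> 0" "aff_val (fst s $ i) Q \<le> 0" "aff_val (fst s $ i) R \<le> 0"
    by (intro le hull_inc; simp)+
  have "2 * aff_val (fst s $ i) (midpoint Q R) = aff_val (fst s $ i) Q + aff_val (fst s $ i) R"
    by (simp add: aff_val_def midpoint_def inner_add_right algebra_simps)
  then have z: "aff_val (fst s $ i) Q = 0" "aff_val (fst s $ i) R = 0" using i v by linarith+
  have "aff_val (fst s $ i) P \<noteq> 0"
  proof
    assume "aff_val (fst s $ i) P = 0"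
    then have "?H \<subseteq> {x. aff_val (fst s $ i) x = 0}"
      by (intro hull_minimal convex_aff_val) (use z in auto)
    moreover obtain x where "x \<in> interior ?H" using ne by blast
    ultimately have "aff_val (fst s $ i) x = 0" using interior_subset by blast
    moreover have "aff_val (fst s $ i) x < 0" using \<open>x \<in> interior ?H\<close> unfolding D[symmetric] by (auto simp: seed_domain_def half_plane_def)
    ultimately show False by simp
  qed
  then show ?thesis using z v(1) by (intro exI[of _ i]) auto
qed

text \<open>In the plane the vectors orthogonal to a nonzero vector are the multiples of its quarter turn.\<close>

lemma perp_2:
  fixes a V :: "real^2"
  assumes "a \<bullet> V = 0" "V \<noteq> 0"
  obtains \<alpha> where "a $ 1 = - \<alpha> * V $ 2" "a $ 2 = \<alpha> * V $ 1"
proof -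
  have o: "a $ 1 * V $ 1 + a $ 2 * V $ 2 = 0" using assms(1) by (simp add: inner_vec_def sum_2)
  have "V $ 1 \<noteq> 0 \<or> V $ 2 \<noteq> 0" using assms(2) by (auto simp: vec_eq_iff forall_2)
  then show ?thesis
  proof
    assume "V $ 1 \<noteq> 0"
    then show ?thesis using o by (intro that[of "a $ 2 / V $ 1"]) (auto simp: field_simps)
  next
    assume "V $ 2 \<noteq> 0"
    then show ?thesis using o by (intro that[of "- a $ 1 / V $ 2"]) (auto simp: field_simps)
  qed
qed

text \<open>The angle of two outward normals and the angle of the sides add up to two right angles. Here \<open>U\<close> and
\<open>V\<close> are the sides starting at the common vertex, \<open>a\<close> is normal to \<open>V\<close> and \<open>b\<close> to \<open>U\<close>.\<close>

lemma normals_inner: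
  fixes a b U V :: "real^2"
  assumes aV: "a \<bullet> V = 0" and bU: "b \<bullet> U = 0" and a: "a \<bullet> a = 2" and b: "b \<bullet> b = 2"
    and aU: "a \<bullet> U < 0" and bV: "b \<bullet> V < 0"
  shows "a \<bullet> b = - 2 * cos (vec_angle U V)" "0 < vec_angle U V" "vec_angle U V < pi"
proof -
  have U: "U \<noteq> 0" and V: "V \<noteq> 0" using aU bV by auto
  obtain \<alpha> where \<alpha>: "a $ 1 = - \<alpha> * V $ 2" "a $ 2 = \<alpha> * V $ 1" using perp_2[OF aV V] .
  obtain \<beta> where \<beta>: "b $ 1 = - \<beta> * U $ 2" "b $ 2 = \<beta> * U $ 1" using perp_2[OF bU U] .
  define X where "X = V $ 1 * U $ 2 - V $ 2 * U $ 1"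
  have VV: "V \<bullet> V = V $ 1 * V $ 1 + V $ 2 * V $ 2" "U \<bullet> U = U $ 1 * U $ 1 + U $ 2 * U $ 2"
    "U \<bullet> V = U $ 1 * V $ 1 + U $ 2 * V $ 2" by (simp_all add: inner_vec_def sum_2)
  have "\<alpha>\<^sup>2 * (V \<bullet> V) = 2" "\<beta>\<^sup>2 * (U \<bullet> U) = 2"
    using a b unfolding VV by (simp_all add: inner_vec_def sum_2 \<alpha> \<beta> power2_eq_square algebra_simps)
  then have n: "\<alpha>\<^sup>2 * (norm V)\<^sup>2 = 2" "\<beta>\<^sup>2 * (norm U)\<^sup>2 = 2" by (simp_all add: power2_norm_eq_inner)
  have s: "\<alpha> * X < 0" "\<beta> * X > 0"
    using aU bV unfolding X_def by (simp_all add: inner_vec_def sum_2 \<alpha> \<beta> algebra_simps)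
  then have neg: "\<alpha> * \<beta> < 0" by (smt (verit) mult_less_0_iff zero_less_mult_iff)
  define N where "N = norm U * norm V"
  have N: "N > 0" using U V by (simp add: N_def)
  have "(\<alpha> * \<beta> * N)\<^sup>2 = (\<alpha>\<^sup>2 * (norm V)\<^sup>2) * (\<beta>\<^sup>2 * (norm U)\<^sup>2)" unfolding N_def by (simp add: power_mult_distrib mult_ac)
  also have "\<dots> = 2\<^sup>2" unfolding n by simp
  finally have "\<bar>\<alpha> * \<beta> * N\<bar> = 2" by (metis abs_numeral power2_abs abs_ge_zero power2_eq_iff_nonneg zero_le_numeral)
  moreover have "\<alpha> * \<beta> * N < 0" using neg N by (rule mult_neg_pos)
  ultimately have ab: "\<alpha> * \<beta> * N = - 2" by linarith
  have "\<bar>U \<bullet> V\<bar> \<le> N" unfolding N_def by (rule Cauchy_Schwarz_ineq2)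
  then have q: "\<bar>U \<bullet> V / N\<bar> \<le> 1" using N by (simp add: abs_divide)
  have "a \<bullet> b = \<alpha> * \<beta> * (U \<bullet> V)" unfolding VV by (simp add: inner_vec_def sum_2 \<alpha> \<beta> algebra_simps)
  also have "\<dots> = (\<alpha> * \<beta> * N) * (U \<bullet> V / N)" using N by simp
  also have "\<dots> = - 2 * cos (vec_angle U V)"
    unfolding ab vec_angle_def N_def[symmetric] using q by (simp add: cos_arccos_abs)
  finally show 1: "a \<bullet> b = - 2 * cos (vec_angle U V)" .
  have r: "0 \<le> vec_angle U V" "vec_angle U V \<le> pi"
    unfolding vec_angle_def N_def[symmetric] using q by (intro arccos_lbound arccos_ubound; linarith)+
  have "vec_angle U V \<noteq> 0"
  proof
    assume "vec_angle U V = 0"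
    then have "(a + b) \<bullet> (a + b) = 0" using 1 a b by (simp add: inner_add_left inner_add_right inner_commute[of b a])
    then have "a + b = 0" by simp
    then have "b \<bullet> V = - (a \<bullet> V)" by (metis add_eq_0_iff inner_minus_left)
    then show False using aV bV by simp
  qed
  moreover have "vec_angle U V \<noteq> pi"
  proof
    assume "vec_angle U V = pi"
    then have "(a - b) \<bullet> (a - b) = 0" using 1 a b by (simp add: inner_diff_left inner_diff_right inner_commute[of b a])
    then have "a = b" by simp
    then show False using aV bV by simp
  qed
  ultimately show "0 < vec_angle U V" "vec_angle U V < pi" using r by linarith+
qed

text \<open>The projection formulas determine the cosine of each angle up to finitely many cases: eliminating the
lengths gives \<open>cos b = - cos (a + c)\<close>. The alternative \<open>b = a + c - pi\<close> cannot hold together with its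
analogue for \<open>a\<close>.\<close>

lemma triangle_angles_from_projection:
  fixes x y z a b c :: real
  assumes pos: "x > 0" "y > 0" "z > 0" and ang: "0 < a" "a < pi" "0 < b" "b < pi" "0 < c" "c < pi"
    and 1: "x = y * cos c + z * cos b" and 2: "y = x * cos c + z * cos a" and 3: "z = x * cos b + y * cos a"
  shows "a + b + c = pi"
proof -
  have key: "b = pi - a - c \<or> b = a + c - pi"
    if pos: "x > 0" "y > 0" "z > 0" and ang: "0 < a" "a < pi" "0 < b" "b < pi" "0 < c" "c < pi"
    and 1: "x = y * cos c + z * cos b" and 2: "y = x * cos c + z * cos a" and 3: "z = x * cos b + y * cos a" for x y z a b c :: real
  proof -
    define k where "k = cos b + cos a * cos c"
    have "x = (x * cos c + z * cos a) * cos c + z * cos b" using 1 2 by metis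
    then have A: "x * (sin c)\<^sup>2 = z * k" unfolding k_def sin_squared_eq by (simp add: algebra_simps power2_eq_square)
    have "z = x * cos b + (x * cos c + z * cos a) * cos a" using 3 2 by metis
    then have B: "z * (sin a)\<^sup>2 = x * k" unfolding k_def sin_squared_eq by (simp add: algebra_simps power2_eq_square)
    have s: "sin a > 0" "sin c > 0" using ang by (auto intro: sin_gt_zero)
    have "z * k > 0" unfolding A[symmetric] using pos s by simp
    then have k: "k > 0" using pos by (simp add: zero_less_mult_iff)
    have "(x * (sin c)\<^sup>2) * (z * (sin a)\<^sup>2) = (z * k) * (x * k)" unfolding A B ..
    then have "(x * z) * (sin a * sin c)\<^sup>2 = (x * z) * k\<^sup>2" by (simp add: power_mult_distrib power2_eq_square mult_ac)
    then have "(sin a * sin c)\<^sup>2 = k\<^sup>2" using pos by simp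
    then have "sin a * sin c = k" using s k by (simp add: power2_eq_iff_nonneg)
    then have cb: "cos b = cos (pi - (a + c))" unfolding k_def cos_pi_minus cos_add by simp
    have le: "\<bar>pi - (a + c)\<bar> \<le> pi" using ang by linarith
    have "cos b = cos \<bar>pi - (a + c)\<bar>" unfolding cb by (rule cos_abs_real[symmetric])
    from cos_inj_pi[OF less_imp_le[OF ang(3)] less_imp_le[OF ang(4)] abs_ge_zero le this]
    have "b = \<bar>pi - (a + c)\<bar>" .
    then show ?thesis by linarith
  qed
  have "b = pi - a - c \<or> b = a + c - pi" by (rule key[OF pos ang 1 2 3])
  moreover have "a = pi - b - c \<or> a = b + c - pi"
    by (rule key[OF pos(2,1,3) ang(3,4,1,2,5,6) 2 1]) (use 3 in linarith)
  ultimately show ?thesis using ang by linarith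
qed

text \<open>The vectors of a triangular seed are the outward normals of the sides, so the form is given by the
angles. The outward normals, weighted by the lengths of the sides, add up to zero; taking products with
each of the normals yields the projection formulas, and hence the sum of the angles.\<close>

lemma triangle_gram:
  fixes s :: "3 seed"
  assumes T: "is_triangle_with_angles (seed_domain s) \<alpha> \<beta> \<gamma>"
    and norm: "\<And>i. aff_form (fst s $ i) (fst s $ i) = 2"
  obtains i j k where "i \<noteq> j" "i \<noteq> k" "j \<noteq> k"
    "aff_form (fst s $ j) (fst s $ k) = - 2 * cos \<alpha>"
    "aff_form (fst s $ k) (fst s $ i) = - 2 * cos \<beta>"
    "aff_form (fst s $ i) (fst s $ j) = - 2 * cos \<gamma>"
    "0 < \<alpha>" "0 < \<beta>" "0 < \<gamma>" "\<alpha> + \<beta> + \<gamma> = pi"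
    "\<exists>P. aff_val (fst s $ i) P < 0 \<and> aff_val (fst s $ j) P = 0 \<and> aff_val (fst s $ k) P = 0"
proof -
  obtain P Q R where nc: "\<not> collinear {P, Q, R}" and D: "seed_domain s = interior (convex hull {P, Q, R})"
    and A: "vec_angle (Q - P) (R - P) = \<alpha>" "vec_angle (R - Q) (P - Q) = \<beta>" "vec_angle (P - R) (Q - R) = \<gamma>"
    using T unfolding is_triangle_with_angles_def by blast
  obtain i where i: "aff_val (fst s $ i) Q = 0" "aff_val (fst s $ i) R = 0" "aff_val (fst s $ i) P < 0"
    using triangle_side_line[OF nc D] by blast
  have e: "{P, Q, R} = {Q, R, P}" "{P, Q, R} = {R, P, Q}" by auto
  obtain j where j: "aff_val (fst s $ j) R = 0" "aff_val (fst s $ j) P = 0" "aff_val (fst s $ j) Q < 0"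
    using triangle_side_line[of Q R P s] nc D unfolding e(1) by blast
  obtain k where k: "aff_val (fst s $ k) P = 0" "aff_val (fst s $ k) Q = 0" "aff_val (fst s $ k) R < 0"
    using triangle_side_line[of R P Q s] nc D unfolding e(2) by blast
  have ne: "i \<noteq> j" "i \<noteq> k" "j \<noteq> k" using i j k by auto
  have diff: "fst f \<bullet> (x - y) = aff_val f x - aff_val f y" for f x y by (simp add: aff_val_def inner_diff_right)
  have nrm: "fst (fst s $ i) \<bullet> fst (fst s $ i) = 2" for i using norm[of i] by (simp add: aff_form_def)
  have a: "aff_form (fst s $ j) (fst s $ k) = - 2 * cos \<alpha>" "0 < \<alpha>" "\<alpha> < pi"
  proof -
    have "fst (fst s $ j) \<bullet> (R - P) = 0" "fst (fst s $ k) \<bullet> (Q - P) = 0"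
      "fst (fst s $ j) \<bullet> (Q - P) < 0" "fst (fst s $ k) \<bullet> (R - P) < 0"
      using i j k by (simp_all add: diff)
    from normals_inner[OF this(1,2) nrm nrm this(3,4)]
    show "aff_form (fst s $ j) (fst s $ k) = - 2 * cos \<alpha>" "0 < \<alpha>" "\<alpha> < pi"
      unfolding A aff_form_def .
  qed
  have b: "aff_form (fst s $ k) (fst s $ i) = - 2 * cos \<beta>" "0 < \<beta>" "\<beta> < pi"
  proof -
    have "fst (fst s $ k) \<bullet> (P - Q) = 0" "fst (fst s $ i) \<bullet> (R - Q) = 0"
      "fst (fst s $ k) \<bullet> (R - Q) < 0" "fst (fst s $ i) \<bullet> (P - Q) < 0"
      using i j k by (simp_all add: diff)
    from normals_inner[OF this(1,2) nrm nrm this(3,4)]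
    show "aff_form (fst s $ k) (fst s $ i) = - 2 * cos \<beta>" "0 < \<beta>" "\<beta> < pi"
      unfolding A aff_form_def .
  qed
  have c: "aff_form (fst s $ i) (fst s $ j) = - 2 * cos \<gamma>" "0 < \<gamma>" "\<gamma> < pi"
  proof -
    have "fst (fst s $ i) \<bullet> (Q - R) = 0" "fst (fst s $ j) \<bullet> (P - R) = 0"
      "fst (fst s $ i) \<bullet> (P - R) < 0" "fst (fst s $ j) \<bullet> (Q - R) < 0"
      using i j k by (simp_all add: diff)
    from normals_inner[OF this(1,2) nrm nrm this(3,4)]
    show "aff_form (fst s $ i) (fst s $ j) = - 2 * cos \<gamma>" "0 < \<gamma>" "\<gamma> < pi"
      unfolding A aff_form_def .
  qed
  define x y z where xyz: "x = - 1 / aff_val (fst s $ i) P" "y = - 1 / aff_val (fst s $ j) Q" "z = - 1 / aff_val (fst s $ k) R"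
  have pos: "x > 0" "y > 0" "z > 0" unfolding xyz using i j k by (simp_all add: divide_neg_neg)
  \<comment> \<open>With these weights, which are proportional to the lengths of the sides, the weighted sum of the
    three affine functions is \<open>-1\<close> at every vertex, hence constant.\<close>
  define m where "m = x *\<^sub>R fst (fst s $ i) + y *\<^sub>R fst (fst s $ j) + z *\<^sub>R fst (fst s $ k)"
  have mo: "m \<bullet> (Q - P) = 0" "m \<bullet> (R - P) = 0"
    unfolding m_def inner_add_left inner_scaleR_left diff xyz using i j k by simp_all
  have "m = 0"
  proof (rule ccontr)
    assume m0: "m \<noteq> 0"
    have U: "Q - P \<noteq> 0" using nc by auto
    obtain \<mu> where \<mu>: "(Q - P) $ 1 = - \<mu> * m $ 2" "(Q - P) $ 2 = \<mu> * m $ 1"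
      using perp_2[of "Q - P" m] mo(1) m0 by (metis inner_commute)
    obtain \<nu> where \<nu>: "(R - P) $ 1 = - \<nu> * m $ 2" "(R - P) $ 2 = \<nu> * m $ 1"
      using perp_2[of "R - P" m] mo(2) m0 by (metis inner_commute)
    have "\<mu> \<noteq> 0" using U \<mu> by (auto simp: vec_eq_iff forall_2)
    then have "R - P = (\<nu> / \<mu>) *\<^sub>R (Q - P)"
      unfolding vec_eq_iff forall_2 vector_scaleR_component \<mu> \<nu> by simp
    then have "collinear {0, Q - P, R - P}" unfolding collinear_lemma by blast
    then have "collinear {Q, P, R}" by (simp add: collinear_3)
    then have "collinear {P, Q, R}" by (simp add: insert_commute)
    then show False using nc by simp
  qed
  then have "fst (fst s $ l) \<bullet> m = 0" for l by simp
  then have I: "x * aff_form (fst s $ l) (fst s $ i) + y * aff_form (fst s $ l) (fst s $ j) + z * aff_form (fst s $ l) (fst s $ k) = 0" for l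
    unfolding m_def aff_form_def by (simp add: inner_add_right)
  have sum: "\<alpha> + \<beta> + \<gamma> = pi"
    by (rule triangle_angles_from_projection[OF pos a(2,3) b(2,3) c(2,3)])
      (use I[of i] I[of j] I[of k] a(1) b(1) c(1) norm aff_form_commute[of "fst s $ i" "fst s $ k"] 
        aff_form_commute[of "fst s $ j" "fst s $ i"] aff_form_commute[of "fst s $ k" "fst s $ j"] in \<open>auto simp: algebra_simps\<close>)
  show ?thesis
    by (rule that[OF ne a(1) b(1) c(1) a(2) b(2) c(2) sum]) (use i j k in blast)
qed

section \<open>Ordering the sides of the initial triangle\<close>

lemma orthonormal_expansion:
  fixes e n v :: "real^2"
  assumes e: "e \<bullet> e = 1" and n: "n \<bullet> n = 1" and en: "e \<bullet> n = 0"
  shows "v = (v \<bullet> n) *\<^sub>R n + (v \<bullet> e) *\<^sub>R e"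
proof -
  define m where "m = v - ((v \<bullet> n) *\<^sub>R n + (v \<bullet> e) *\<^sub>R e)"
  have m: "m \<bullet> e = 0" "m \<bullet> n = 0"
    using e n en by (simp_all add: m_def inner_diff_left inner_add_left inner_commute[of n e])
  have "m = 0"
  proof (rule ccontr)
    assume m0: "m \<noteq> 0"
    obtain \<mu> where \<mu>: "e $ 1 = - \<mu> * m $ 2" "e $ 2 = \<mu> * m $ 1"
      using perp_2[of e m] m(1) m0 by (metis inner_commute)
    obtain \<nu> where \<nu>: "n $ 1 = - \<nu> * m $ 2" "n $ 2 = \<nu> * m $ 1"
      using perp_2[of n m] m(2) m0 by (metis inner_commute)
    have "\<mu> * \<nu> * (m \<bullet> m) = 0" "\<mu> * \<mu> * (m \<bullet> m) = 1" "\<nu> * \<nu> * (m \<bullet> m) = 1"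
      using e n en \<mu> \<nu> by (simp_all add: inner_vec_def sum_2 algebra_simps)
    then show False by auto
  qed
  then show ?thesis by (simp add: m_def)
qed

text \<open>Vectors in the plane with the inner products of the normal form are, in a suitable orthonormal basis, the
vectors of the normal form. The basis is obtained by solving the desired equations for \<open>a\<close> and \<open>c\<close>,
which are independent since \<open>sin (X + Y) > 0\<close>; the vector \<open>b\<close> is then determined by its
products with \<open>a\<close> and \<open>c\<close>.\<close>

lemma gram_frame:
  fixes a b c :: "real^2" and X Y :: real
  assumes aa: "a \<bullet> a = 2" and bb: "b \<bullet> b = 2" and cc: "c \<bullet> c = 2"
    and ab: "a \<bullet> b = - 2 * cos X" and bc: "b \<bullet> c = - 2 * cos Y" and ac: "a \<bullet> c = 2 * cos (X + Y)"
    and S: "sin (X + Y) > 0"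
  shows "\<exists>e n. e \<bullet> e = 1 \<and> n \<bullet> n = 1 \<and> e \<bullet> n = 0 \<and>
     a = sqrt 2 *\<^sub>R ((- cos Y) *\<^sub>R n + (- sin Y) *\<^sub>R e) \<and>
     b = sqrt 2 *\<^sub>R (cos (Y - X) *\<^sub>R n + sin (Y - X) *\<^sub>R e) \<and>
     c = sqrt 2 *\<^sub>R ((- cos X) *\<^sub>R n + sin X *\<^sub>R e)"
proof -
  define k where "k = 1 / (sqrt 2 * sin (X + Y))"
  define e where "e = k *\<^sub>R (cos Y *\<^sub>R c - cos X *\<^sub>R a)"
  define n where "n = (- k) *\<^sub>R (sin X *\<^sub>R a + sin Y *\<^sub>R c)"
  have k2: "k * k * 2 * (sin (X + Y) * sin (X + Y)) = 1" using S by (simp add: k_def)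
  have kS: "sqrt 2 * k * sin (X + Y) = 1" using S by (simp add: k_def)
  have cX: "cos X * cos X = 1 - sin X * sin X" and cY: "cos Y * cos Y = 1 - sin Y * sin Y"
    using cos_squared_eq[of X] cos_squared_eq[of Y] by (simp_all add: power2_eq_square)
  have S2: "sin (X + Y) * sin (X + Y) = sin X * sin X + sin Y * sin Y - 2 * (sin X * sin X) * (sin Y * sin Y) + 2 * (sin X * sin Y) * (cos X * cos Y)"
  proof -
    have "sin (X + Y) * sin (X + Y) = (sin X * sin X) * (cos Y * cos Y) + (sin Y * sin Y) * (cos X * cos X) + 2 * (sin X * sin Y) * (cos X * cos Y)"
      unfolding sin_add by algebra
    then show ?thesis unfolding cX cY by (simp add: algebra_simps)
  qed
  have ca: "c \<bullet> a = 2 * cos (X + Y)" using ac by (simp add: inner_commute)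
  have ee: "e \<bullet> e = 1"
  proof -
    have "e \<bullet> e = k * k * 2 * (cos Y * cos Y + cos X * cos X - 2 * (cos X * cos Y) * cos (X + Y))"
      by (simp add: e_def inner_diff_left inner_diff_right aa cc ac ca algebra_simps)
    also have "cos Y * cos Y + cos X * cos X - 2 * (cos X * cos Y) * cos (X + Y) =
        cos Y * cos Y + cos X * cos X - 2 * (cos X * cos X) * (cos Y * cos Y) + 2 * (sin X * sin Y) * (cos X * cos Y)"
      unfolding cos_add by algebra
    also have "\<dots> = sin (X + Y) * sin (X + Y)" unfolding S2 cX cY by (simp add: algebra_simps)
    finally show ?thesis using k2 by simp
  qed
  have nn: "n \<bullet> n = 1"
  proof -
    have "n \<bullet> n = k * k * 2 * (sin X * sin X + sin Y * sin Y + 2 * (sin X * sin Y) * cos (X + Y))"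
      by (simp add: n_def inner_add_left inner_add_right aa cc ac ca algebra_simps)
    also have "sin X * sin X + sin Y * sin Y + 2 * (sin X * sin Y) * cos (X + Y) = sin (X + Y) * sin (X + Y)"
      unfolding S2 cos_add by (simp add: algebra_simps)
    finally show ?thesis using k2 by simp
  qed
  have p: "sin (X - Y) * cos (X + Y) = sin X * cos X - sin Y * cos Y"
  proof -
    have "sin (X - Y) * cos (X + Y) = sin X * cos X * (cos Y * cos Y + sin Y * sin Y) - sin Y * cos Y * (cos X * cos X + sin X * sin X)"
      unfolding sin_diff cos_add by algebra
    then show ?thesis unfolding cX cY by simp
  qed
  have en: "e \<bullet> n = 0"
  proof -
    have "e \<bullet> n = - k * k * 2 * (sin (X - Y) * cos (X + Y) + cos Y * sin Y - cos X * sin X)"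
      unfolding sin_diff by (simp add: e_def n_def inner_add_right inner_diff_left aa cc ac ca algebra_simps)
    then show ?thesis unfolding p by (simp add: algebra_simps)
  qed
  have A: "a = sqrt 2 *\<^sub>R ((- cos Y) *\<^sub>R n + (- sin Y) *\<^sub>R e)"
  proof -
    have "sqrt 2 *\<^sub>R ((- cos Y) *\<^sub>R n + (- sin Y) *\<^sub>R e) = (sqrt 2 * k * sin (X + Y)) *\<^sub>R a"
      unfolding e_def n_def sin_add by (simp add: algebra_simps)
    then show ?thesis unfolding kS by simp
  qed
  have C: "c = sqrt 2 *\<^sub>R ((- cos X) *\<^sub>R n + sin X *\<^sub>R e)"
  proof -
    have "sqrt 2 *\<^sub>R ((- cos X) *\<^sub>R n + sin X *\<^sub>R e) = (sqrt 2 * k * sin (X + Y)) *\<^sub>R c"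
      unfolding e_def n_def sin_add by (simp add: algebra_simps)
    then show ?thesis unfolding kS by simp
  qed
  have ba: "b \<bullet> a = - 2 * cos X" using ab by (simp add: inner_commute)
  have sq: "2 * k * sin (X + Y) = sqrt 2" using S by (simp add: k_def field_simps)
  have "b \<bullet> e = 2 * k * (cos X * cos X - cos Y * cos Y)"
    by (simp add: e_def inner_diff_right ba bc algebra_simps)
  also have "cos X * cos X - cos Y * cos Y = sin (X + Y) * sin (Y - X)"
  proof -
    have "sin (X + Y) * sin (Y - X) = (sin Y * sin Y) * (cos X * cos X) - (sin X * sin X) * (cos Y * cos Y)"
      unfolding sin_add sin_diff by algebra
    then show ?thesis unfolding cX cY by (simp add: algebra_simps)
  qed
  finally have be: "b \<bullet> e = sqrt 2 * sin (Y - X)" using sq by (simp add: mult.assoc[symmetric])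
  have "b \<bullet> n = 2 * k * (sin X * cos X + sin Y * cos Y)"
    by (simp add: n_def inner_add_right ba bc algebra_simps)
  also have "sin X * cos X + sin Y * cos Y = sin (X + Y) * cos (Y - X)"
  proof -
    have "sin (X + Y) * cos (Y - X) = sin X * cos X * (cos Y * cos Y + sin Y * sin Y) + sin Y * cos Y * (cos X * cos X + sin X * sin X)"
      unfolding sin_add cos_diff by algebra
    then show ?thesis unfolding cX cY by simp
  qed
  finally have bn: "b \<bullet> n = sqrt 2 * cos (Y - X)" using sq by (simp add: mult.assoc[symmetric])
  have B: "b = sqrt 2 *\<^sub>R (cos (Y - X) *\<^sub>R n + sin (Y - X) *\<^sub>R e)"
    using orthonormal_expansion[OF ee nn en, of b] unfolding be bn by (simp add: algebra_simps)
  show ?thesis using ee nn en A B C by blast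
qed

text \<open>The origin of the axis is chosen on the line through \<open>0\<close> in direction \<open>n\<close> so that the first
equation of the normal form holds. The left hand side of the second equation is a constant function,
as the normal vectors weighted by the sines add up to zero, and it is negative at a vertex of the triangle.\<close>

lemma frame_exists:
  fixes p q r :: aff
  assumes d: "d \<ge> 3" and xy: "0 < x" "0 < y" "x + y < d" "2 * x \<le> d" "2 * y \<le> d" "coprime (gcd x y) d"
    and norm: "aff_form p p = 2" "aff_form q q = 2" "aff_form r r = 2"
    and pq: "aff_form p q = - 2 * cos (pi * real x / real d)" and qr: "aff_form q r = - 2 * cos (pi * real y / real d)"
    and pr: "aff_form p r = - 2 * cos (pi * real (d - x - y) / real d)"
    and P: "aff_val p P \<le> 0" "aff_val q P \<le> 0" "aff_val r P \<le> 0" "aff_val p P < 0 \<or> aff_val q P < 0 \<or> aff_val r P < 0"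
  shows "\<exists>e n z0 \<Delta>. affine_frame e n d \<and> affine_frame.formatted e n z0 \<Delta> d 1 x y p q r \<and> \<Delta> \<noteq> 0"
proof -
  define X Y where XY: "X = pi * real x / real d" "Y = pi * real y / real d"
  have d0: "real d > 0" using d by simp
  have XYpos: "X > 0" "Y > 0" "X + Y < pi"
  proof -
    show "X > 0" "Y > 0" unfolding XY using xy d0 by simp_all
    have "real x + real y < real d" using xy(3) by linarith
    then have "pi * (real x + real y) < pi * real d" by simp
    then show "X + Y < pi" unfolding XY using d0 by (simp add: field_simps)
  qed
  have w: "pi * real (d - x - y) / real d = pi - (X + Y)"
    unfolding XY using xy(3) d0 by (simp add: of_nat_diff field_simps)
  have S: "sin (X + Y) > 0" "sin X > 0" "sin Y > 0" using XYpos by (auto intro!: sin_gt_zero)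
  obtain e n where e: "e \<bullet> e = 1" and n: "n \<bullet> n = 1" and en: "e \<bullet> n = 0"
    and a: "fst p = sqrt 2 *\<^sub>R ((- cos Y) *\<^sub>R n + (- sin Y) *\<^sub>R e)"
    and b: "fst q = sqrt 2 *\<^sub>R (cos (Y - X) *\<^sub>R n + sin (Y - X) *\<^sub>R e)"
    and c: "fst r = sqrt 2 *\<^sub>R ((- cos X) *\<^sub>R n + sin X *\<^sub>R e)"
    using gram_frame[of "fst p" "fst q" "fst r" X Y] norm pq qr pr S(1) unfolding aff_form_def XY[symmetric] w by auto
  define C where "C = (\<lambda>z. cos Y * aff_val p z + cos (X + Y) * aff_val q z + cos X * aff_val r z)"
  define D where "D = (\<lambda>z. sin Y * aff_val p z + sin (X + Y) * aff_val q z + sin X * aff_val r z)"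
  have cX: "cos X * cos X = 1 - sin X * sin X" and cY: "cos Y * cos Y = 1 - sin Y * sin Y"
    using cos_squared_eq[of X] cos_squared_eq[of Y] by (simp_all add: power2_eq_square)
  have grad: "cos (X + Y) * cos (Y - X) = cos X * cos X + cos Y * cos Y - 1"
    "sin (X + Y) * cos (Y - X) = sin X * cos X + sin Y * cos Y"
    "sin (X + Y) * sin (Y - X) = sin Y * sin Y - sin X * sin X"
  proof -
    have "cos (X + Y) * cos (Y - X) = (cos X * cos X) * (cos Y * cos Y) - (sin X * sin X) * (sin Y * sin Y)"
      unfolding cos_add cos_diff by algebra
    then show "cos (X + Y) * cos (Y - X) = cos X * cos X + cos Y * cos Y - 1" unfolding cX cY by (simp add: algebra_simps)
    have "sin (X + Y) * cos (Y - X) = sin X * cos X * (cos Y * cos Y + sin Y * sin Y) + sin Y * cos Y * (cos X * cos X + sin X * sin X)"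
      unfolding sin_add cos_diff by algebra
    then show "sin (X + Y) * cos (Y - X) = sin X * cos X + sin Y * cos Y" unfolding cX cY by simp
    have "sin (X + Y) * sin (Y - X) = (sin Y * sin Y) * (cos X * cos X) - (sin X * sin X) * (cos Y * cos Y)"
      unfolding sin_add sin_diff by algebra
    then show "sin (X + Y) * sin (Y - X) = sin Y * sin Y - sin X * sin X" unfolding cX cY by (simp add: algebra_simps)
  qed
  \<comment> \<open>The gradient of \<open>C\<close> is \<open>- sqrt 2 *\<^sub>R n\<close>.\<close>
  define t where "t = C 0 / sqrt 2"
  have Ct: "C (t *\<^sub>R n) = 0"
  proof -
    have nn: "fst p \<bullet> n = - sqrt 2 * cos Y" "fst q \<bullet> n = sqrt 2 * cos (Y - X)" "fst r \<bullet> n = - sqrt 2 * cos X"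
      unfolding a b c using n en by (simp_all add: inner_add_left inner_diff_left)
    have "C (t *\<^sub>R n) = C 0 + t * sqrt 2 * (cos (X + Y) * cos (Y - X) - cos Y * cos Y - cos X * cos X)"
      unfolding C_def aff_val_def inner_scaleR_right nn by (simp add: algebra_simps)
    also have "\<dots> = C 0 - t * sqrt 2" unfolding grad by simp
    finally show ?thesis by (simp add: t_def)
  qed
  have Dconst: "D z = D z'" for z z'
  proof -
    have "sin Y *\<^sub>R fst p + sin (X + Y) *\<^sub>R fst q + sin X *\<^sub>R fst r =
       (sqrt 2 * (sin (X + Y) * cos (Y - X) - sin Y * cos Y - sin X * cos X)) *\<^sub>R n
       + (sqrt 2 * (sin (X + Y) * sin (Y - X) - sin Y * sin Y + sin X * sin X)) *\<^sub>R e"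
      unfolding a b c by (simp add: algebra_simps)
    also have "\<dots> = 0" unfolding grad by simp
    finally have g: "(sin Y *\<^sub>R fst p + sin (X + Y) *\<^sub>R fst q + sin X *\<^sub>R fst r) \<bullet> (z - z') = 0" by simp
    have "D z - D z' = (sin Y *\<^sub>R fst p + sin (X + Y) *\<^sub>R fst q + sin X *\<^sub>R fst r) \<bullet> (z - z')"
      by (simp add: D_def aff_val_def inner_add_left inner_diff_right algebra_simps)
    then show ?thesis using g by simp
  qed
  have "D P < 0"
  proof -
    have "sin Y * aff_val p P \<le> 0" "sin (X + Y) * aff_val q P \<le> 0" "sin X * aff_val r P \<le> 0"
      using S P by (simp_all add: mult_nonneg_nonpos)
    moreover have "sin Y * aff_val p P < 0 \<or> sin (X + Y) * aff_val q P < 0 \<or> sin X * aff_val r P < 0"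
      using S P(4) by (auto simp: mult_pos_neg)
    ultimately show ?thesis unfolding D_def by linarith
  qed
  then have D0: "D (t *\<^sub>R n) \<noteq> 0" using Dconst[of P "t *\<^sub>R n"] by simp
  interpret A: affine_frame e n "t *\<^sub>R n" "D (t *\<^sub>R n)" d by unfold_locales (use e n en d in auto)
  have angs: "A.ang x = X" "A.ang y = Y" by (simp_all add: A.ang_def XY)
  have "affine_frame.formatted e n (t *\<^sub>R n) (D (t *\<^sub>R n)) d 1 x y p q r"
    unfolding A.formatted_def angs A.normal_def
    using xy a b c Ct by (simp add: C_def D_def)
  then show ?thesis using D0 A.affine_frame_axioms by blast
qed

text \<open>A common divisor of \<open>x\<close>, \<open>y\<close> and \<open>d\<close> divides \<open>w\<close> as well, and it could be cancelled from the common
denominator \<open>d\<close>.\<close>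

lemma triangle_angle_numerators:
  fixes r1 r2 r3 :: rat
  assumes d: "d = least_common_denominator {r1, r2, r3}" and pos: "0 < r1" "0 < r2" "0 < r3" and sum: "r1 + r2 + r3 = 1"
  obtains x y w :: nat where "of_rat r1 * pi = pi * real x / real d" "of_rat r2 * pi = pi * real y / real d" "of_rat r3 * pi = pi * real w / real d"
    "0 < x" "0 < y" "0 < w" "x + y + w = d" "d \<ge> 3" "coprime (gcd x y) d"
proof -
  let ?P = "\<lambda>d::nat. 0 < d \<and> (\<forall>r\<in>{r1, r2, r3}. of_nat d * r \<in> \<int>)"
  have "?P (nat (snd (quotient_of r1) * snd (quotient_of r2) * snd (quotient_of r3)))"
  proof -
    define a b c where abc: "a = snd (quotient_of r1)" "b = snd (quotient_of r2)" "c = snd (quotient_of r3)"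
    have p: "a > 0" "b > 0" "c > 0" unfolding abc by (rule quotient_of_denom_pos')+
    have q: "r1 = of_int (fst (quotient_of r1)) / of_int a" "r2 = of_int (fst (quotient_of r2)) / of_int b" "r3 = of_int (fst (quotient_of r3)) / of_int c"
      unfolding abc by (rule quotient_of_div, simp)+
    have i: "of_int a * r1 \<in> \<int>" "of_int b * r2 \<in> \<int>" "of_int c * r3 \<in> \<int>"
      by (subst q, use p in simp)+
    have n: "of_nat (nat (a * b * c)) = (of_int a * of_int b * of_int c :: rat)"
      using p by (simp add: of_nat_nat)
    have "of_int a * of_int b * of_int c * r1 = of_int b * of_int c * (of_int a * r1)"
      "of_int a * of_int b * of_int c * r2 = of_int a * of_int c * (of_int b * r2)"
      "of_int a * of_int b * of_int c * r3 = of_int a * of_int b * (of_int c * r3)" by (simp_all only: mult_ac)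
    then have "of_int a * of_int b * of_int c * r1 \<in> \<int>" "of_int a * of_int b * of_int c * r2 \<in> \<int>" "of_int a * of_int b * of_int c * r3 \<in> \<int>"
      using i by (simp_all only: Ints_mult Ints_of_int)
    then show ?thesis unfolding abc[symmetric] n using p by simp
  qed
  then have Pd: "?P d" unfolding d least_common_denominator_def by (rule LeastI)
  have least: "d \<le> d'" if "?P d'" for d' unfolding d least_common_denominator_def using that by (rule Least_le)
  have d0: "0 < d" using Pd by simp
  have num: "\<exists>x :: nat. of_nat d * r = of_nat x \<and> 0 < x" if "r \<in> {r1, r2, r3}" for r
  proof -
    have "of_nat d * r \<in> \<int>" using Pd that by blast
    then obtain i :: int where i: "of_nat d * r = of_int i" by (rule Ints_cases)
    have "0 < of_nat d * r" using d0 pos that by auto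
    then have "0 < i" unfolding i by simp
    then have "of_nat d * r = of_nat (nat i) \<and> 0 < nat i" using i by (simp add: of_nat_nat)
    then show ?thesis by blast
  qed
  obtain x where x: "of_nat d * r1 = of_nat x" "0 < x" using num[of r1] by auto
  obtain y where y: "of_nat d * r2 = of_nat y" "0 < y" using num[of r2] by auto
  obtain w where w: "of_nat d * r3 = of_nat w" "0 < w" using num[of r3] by auto
  have "(of_nat (x + y + w) :: rat) = of_nat d * (r1 + r2 + r3)" using x y w by (simp add: algebra_simps)
  then have s: "x + y + w = d" unfolding sum by (simp only: mult_1_right of_nat_eq_iff)
  have val: "of_rat r * pi = pi * real k / real d" if "of_nat d * r = of_nat k" for r k
  proof -
    have "r = of_nat k / of_nat d" using that d0 by (simp add: field_simps)
    then have "of_rat r = real k / real d" by (simp add: of_rat_divide)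
    then show ?thesis by simp
  qed
  have "coprime (gcd x y) d"
    unfolding coprime_gcd_iff
  proof (intro allI impI)
    fix g assume g: "g dvd x \<and> g dvd y \<and> g dvd d"
    then have "g dvd x + y" by simp
    then have gw: "g dvd w" using g s by (metis dvd_add_right_iff)
    obtain x' y' w' d' where f: "x = g * x'" "y = g * y'" "w = g * w'" "d = g * d'" using g gw by (auto elim!: dvdE)
    have g0: "g > 0" "d' > 0" using f d0 by auto
    have "of_nat d' * r = of_nat k" if "of_nat d * r = of_nat (g * k)" for r :: rat and k
      using that g0 unfolding f(4) by simp
    then have "of_nat d' * r1 = of_nat x'" "of_nat d' * r2 = of_nat y'" "of_nat d' * r3 = of_nat w'" using x y w f by blast+
    then have "?P d'" using g0 by auto
    then have "d \<le> d'" by (rule least)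
    then show "g = 1" using f(4) g0 by simp
  qed
  then show ?thesis using that[OF val[OF x(1)] val[OF y(1)] val[OF w(1)] x(2) y(2) w(2) s] x y w s by simp
qed

lemma exchange_matrix_skew:
  assumes "exchange_matrix B"
  shows "B $ a $ b = - B $ b $ a"
proof -
  have "transpose B $ b $ a = (- B) $ b $ a" using assms by (simp add: exchange_matrix_def)
  then show ?thesis by (simp add: transpose_def)
qed

text \<open>The sides \<open>i\<close>, \<open>j\<close>, \<open>k\<close> enclose the angles with numerators \<open>x\<close> (between \<open>i\<close> and \<open>j\<close>), \<open>y\<close> (between
\<open>j\<close> and \<open>k\<close>) and \<open>w\<close> (between \<open>i\<close> and \<open>k\<close>).\<close>

definition gram_triple :: "aff^3 \<Rightarrow> nat \<Rightarrow> 3 \<Rightarrow> 3 \<Rightarrow> 3 \<Rightarrow> nat \<Rightarrow> nat \<Rightarrow> nat \<Rightarrow> bool" where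
  "gram_triple v d i j k x y w \<longleftrightarrow> i \<noteq> j \<and> i \<noteq> k \<and> j \<noteq> k \<and>
     aff_form (v $ i) (v $ j) = - 2 * cos (pi * real x / real d) \<and>
     aff_form (v $ j) (v $ k) = - 2 * cos (pi * real y / real d) \<and>
     aff_form (v $ i) (v $ k) = - 2 * cos (pi * real w / real d) \<and>
     0 < x \<and> 0 < y \<and> 0 < w \<and> x + y + w = d \<and> coprime (gcd x y) d"

lemma gram_triple_swap:
  assumes "gram_triple v d i j k x y w"
  shows "gram_triple v d j i k x w y" "gram_triple v d i k j w y x"
proof -
  note A = assms[unfolded gram_triple_def]
  have c: "coprime (gcd x w) d" "coprime (gcd w y) d"
  proof -
    have s: "x + y + w = d" and cp: "\<forall>g. g dvd x \<and> g dvd y \<and> g dvd d \<longrightarrow> g = 1"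
      using A unfolding coprime_gcd_iff by blast+
    have 1: "g dvd y" if "g dvd x" "g dvd w" "g dvd d" for g
    proof -
      have "g dvd (x + w) + y" using that(3) s by (simp add: ac_simps)
      then show ?thesis using that(1,2) by (metis dvd_add dvd_add_right_iff)
    qed
    have 2: "g dvd x" if "g dvd y" "g dvd w" "g dvd d" for g
    proof -
      have "g dvd (y + w) + x" using that(3) s by (simp add: ac_simps)
      then show ?thesis using that(1,2) by (metis dvd_add dvd_add_right_iff)
    qed
    show "coprime (gcd x w) d" "coprime (gcd w y) d" unfolding coprime_gcd_iff using cp 1 2 by blast+
  qed
  show "gram_triple v d j i k x w y" "gram_triple v d i k j w y x"
    unfolding gram_triple_def using A c aff_form_commute[of "v $ j" "v $ i"] aff_form_commute[of "v $ k" "v $ j"] by auto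
qed

lemma gram_triple_reverse:
  assumes "gram_triple v d i j k x y w"
  shows "gram_triple v d k j i y x w"
  using gram_triple_swap(1)[OF gram_triple_swap(2)[OF gram_triple_swap(1)[OF assms]]] .

text \<open>In this order the seed is the seed of an ordered triple.\<close>

definition ordered_triple :: "aff^3 \<Rightarrow> real^3^3 \<Rightarrow> nat \<Rightarrow> 3 \<Rightarrow> 3 \<Rightarrow> 3 \<Rightarrow> nat \<Rightarrow> nat \<Rightarrow> nat \<Rightarrow> bool" where
  "ordered_triple v B d i j k x y w \<longleftrightarrow> gram_triple v d i j k x y w \<and> 2 * x \<le> d \<and> 2 * y \<le> d \<and>
     B $ i $ j = - aff_form (v $ i) (v $ j) \<and> B $ j $ k = - aff_form (v $ j) (v $ k) \<and> B $ i $ k = - aff_form (v $ i) (v $ k)"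

lemma cos_pi_fraction_sign:
  fixes x d :: nat
  assumes "0 < d" "x \<le> d"
  shows "2 * x < d \<Longrightarrow> cos (pi * real x / real d) > 0" "2 * x = d \<Longrightarrow> cos (pi * real x / real d) = 0"
    "d < 2 * x \<Longrightarrow> cos (pi * real x / real d) < 0"
proof -
  have d0: "real d > 0" using assms by simp
  show "cos (pi * real x / real d) > 0" if "2 * x < d"
  proof (rule cos_gt_zero_pi)
    have "real (2 * x) < real d" using that by (simp only: of_nat_less_iff)
    then have "pi * (2 * real x) < pi * real d" by simp
    then show "pi * real x / real d < pi / 2" using d0 by (simp add: field_simps)
    have "0 \<le> pi * real x / real d" by simp
    then show "- (pi / 2) < pi * real x / real d" using pi_gt_zero by linarith
  qed
  show "cos (pi * real x / real d) = 0" if "2 * x = d"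
  proof -
    have "real d = 2 * real x" "real x > 0" using that d0 by auto
    then have "pi * real x / real d = pi / 2" by simp
    then show ?thesis by (simp only: cos_pi_half)
  qed
  show "cos (pi * real x / real d) < 0" if "d < 2 * x"
  proof -
    have "real d < real (2 * x)" using that by (simp only: of_nat_less_iff)
    then have "pi * real d < pi * (2 * real x)" by simp
    then have 1: "pi / 2 < pi * real x / real d" using d0 by (simp add: field_simps)
    have "pi * real x \<le> pi * real d" using assms(2) by simp
    then have 2: "pi * real x / real d \<le> pi" using d0 by (simp add: field_simps)
    have "cos (pi * real x / real d) < cos (pi / 2)" using 1 2 by (intro cos_monotone_0_pi) auto
    then show ?thesis by simp
  qed
qed

lemma cyclic_not_acyclic:
  assumes "B $ i $ j > 0" "B $ j $ k > 0" "B $ k $ i > (0::real)"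
  shows "\<not> acyclic_matrix B"
proof -
  let ?R = "{(i, j). B $ i $ j > 0}"
  have "(i, j) \<in> ?R" "(j, k) \<in> ?R" "(k, i) \<in> ?R" using assms by auto
  then have "(i, i) \<in> ?R\<^sup>+" by (meson trancl.r_into_trancl trancl.trancl_into_trancl)
  then show ?thesis unfolding acyclic_matrix_def acyclic_def by blast
qed

text \<open>A function that increases along every arrow excludes oriented cycles.\<close>

lemma acyclic_by_rank:
  fixes f :: "3 \<Rightarrow> nat"
  assumes "\<And>a b. B $ a $ b > 0 \<Longrightarrow> f a < f b"
  shows "acyclic_matrix B"
proof -
  have "f a < f b" if "(a, b) \<in> {(i, j). B $ i $ j > 0}\<^sup>+" for a b
    using that by (induction rule: trancl_induct) (use assms in \<open>auto intro: less_trans\<close>)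
  then show ?thesis unfolding acyclic_matrix_def acyclic_def by blast
qed

text \<open>On three vertices with all arrows present, the absence of the two oriented triangles makes the arrows a
linear order, and the number of incoming arrows ranks the vertices.\<close>

lemma noncyclic_acyclic:
  fixes B :: "real^3^3" and i j k :: 3
  assumes skew: "\<And>a b. B $ a $ b = - B $ b $ a" and ne: "i \<noteq> j" "i \<noteq> k" "j \<noteq> k"
    and 1: "\<not> (B $ i $ j > 0 \<and> B $ j $ k > 0 \<and> B $ k $ i > 0)" and 2: "\<not> (B $ j $ i > 0 \<and> B $ k $ j > 0 \<and> B $ i $ k > 0)"
    and nz: "B $ i $ j \<noteq> 0" "B $ j $ k \<noteq> 0" "B $ i $ k \<noteq> 0"
  shows "acyclic_matrix B"
proof -
  have un: "a = i \<or> a = j \<or> a = k" for a using ne exhaust_3[of a] exhaust_3[of i] exhaust_3[of j] exhaust_3[of k] by auto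
  have diag: "B $ a $ a = 0" for a using skew[of a a] by simp
  define P Q R where PQR: "P = (B $ i $ j > 0)" "Q = (B $ j $ k > 0)" "R = (B $ i $ k > 0)"
  have s: "B $ j $ i > 0 \<longleftrightarrow> \<not> P" "B $ k $ j > 0 \<longleftrightarrow> \<not> Q" "B $ k $ i > 0 \<longleftrightarrow> \<not> R"
    unfolding PQR using skew[of j i] skew[of k j] skew[of k i] nz by linarith+
  have c: "\<not> (P \<and> Q \<and> \<not> R)" "\<not> (\<not> P \<and> \<not> Q \<and> R)" using 1 2 unfolding s PQR[symmetric] by blast+
  define f :: "3 \<Rightarrow> nat" where "f = (\<lambda>a. of_bool (B $ i $ a > 0) + of_bool (B $ j $ a > 0) + of_bool (B $ k $ a > 0))"
  have f: "f i = of_bool (\<not> P) + of_bool (\<not> R)" "f j = of_bool P + of_bool (\<not> Q)" "f k = of_bool R + of_bool Q"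
    unfolding f_def s diag PQR[symmetric] by simp_all
  have edges: "P \<Longrightarrow> f i < f j" "\<not> P \<Longrightarrow> f j < f i" "Q \<Longrightarrow> f j < f k" "\<not> Q \<Longrightarrow> f k < f j" "R \<Longrightarrow> f i < f k" "\<not> R \<Longrightarrow> f k < f i"
    unfolding f using c by (cases P; cases Q; cases R; simp)+
  show ?thesis
  proof (rule acyclic_by_rank[of B f])
    fix a b assume ab: "B $ a $ b > 0"
    have "a \<noteq> b" using ab diag by auto
    then consider "a = i" "b = j" | "a = j" "b = i" | "a = j" "b = k" | "a = k" "b = j" | "a = i" "b = k" | "a = k" "b = i"
      using un[of a] un[of b] by blast
    then show "f a < f b"
      by cases (use ab edges s PQR in blast)+
  qed
qed

text \<open>Let the last angle be the largest. The parity condition on geometric realisations links the signs of the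
form to the quiver: with an obtuse angle exactly one value of the form is positive, so the quiver is an
oriented triangle, and reversing the order, if necessary, gives it the required orientation. With
three acute angles the quiver is acyclic, hence a linear order of the sides, and that order is taken. With
a right angle one arrow is missing, and each orientation of the two other arrows is compatible with a
linear order.\<close>

lemma ordered_triple_exists:
  assumes ex: "exchange_matrix B" and geo: "geometric_realisation v B"
    and g0: "gram_triple v d i0 j0 k0 x0 y0 w0" and d3: "d \<ge> 3"
  shows "\<exists>i j k x y w. ordered_triple v B d i j k x y w"
proof -
  note skew = exchange_matrix_skew[OF ex]
  have abs: "\<bar>aff_form (v $ a) (v $ b)\<bar> = \<bar>B $ a $ b\<bar>" if "a \<noteq> b" for a b
    using geo that unfolding geometric_realisation_def by blast
  have par: "even (card {(a, b). a < b \<and> aff_form (v $ a) (v $ b) > 0}) \<longleftrightarrow> acyclic_matrix B"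
    if "\<And>a b. a \<noteq> b \<Longrightarrow> aff_form (v $ a) (v $ b) \<noteq> 0"
    using geo that unfolding geometric_realisation_def by blast
  have "\<exists>i j k x y w. gram_triple v d i j k x y w \<and> x \<le> w \<and> y \<le> w"
  proof -
    consider "x0 \<le> w0" "y0 \<le> w0" | "w0 \<le> y0" "x0 \<le> y0" | "w0 \<le> x0" "y0 \<le> x0" by linarith
    then show ?thesis using g0 gram_triple_swap[OF g0] by cases blast+
  qed
  then obtain i j k x y w where g: "gram_triple v d i j k x y w" and max: "x \<le> w" "y \<le> w" by blast
  note G = g[unfolded gram_triple_def]
  have ne: "i \<noteq> j" "i \<noteq> k" "j \<noteq> k" using G by auto
  have un: "a = i \<or> a = j \<or> a = k" for a using ne exhaust_3[of a] exhaust_3[of i] exhaust_3[of j] exhaust_3[of k] by auto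
  have d0: "0 < d" using d3 by simp
  have lt: "2 * x < d" "2 * y < d" using G max by auto
  have neg: "aff_form (v $ i) (v $ j) < 0" "aff_form (v $ j) (v $ k) < 0"
    using G cos_pi_fraction_sign(1)[OF d0 _ lt(1)] cos_pi_fraction_sign(1)[OF d0 _ lt(2)] lt by auto
  have sym: "aff_form (v $ j) (v $ i) = aff_form (v $ i) (v $ j)" "aff_form (v $ k) (v $ j) = aff_form (v $ j) (v $ k)"
    "aff_form (v $ k) (v $ i) = aff_form (v $ i) (v $ k)" by (rule aff_form_commute)+
  have sk: "B $ j $ i = - B $ i $ j" "B $ k $ j = - B $ j $ k" "B $ k $ i = - B $ i $ k" by (rule skew)+
  have B1: "\<bar>B $ i $ j\<bar> = - aff_form (v $ i) (v $ j)" "\<bar>B $ j $ k\<bar> = - aff_form (v $ j) (v $ k)" "\<bar>B $ i $ k\<bar> = \<bar>aff_form (v $ i) (v $ k)\<bar>"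
    using abs[of i j] abs[of j k] abs[of i k] ne neg by auto
  have nz: "B $ i $ j \<noteq> 0" "B $ j $ k \<noteq> 0" using B1 neg by auto
  have rev: "gram_triple v d k j i y x w" by (rule gram_triple_reverse[OF g])
  note OT = ordered_triple_def
  consider "d < 2 * w" | "2 * w = d" | "2 * w < d" by linarith
  then show ?thesis
  proof cases
    case 1
    have pos: "aff_form (v $ i) (v $ k) > 0" using G cos_pi_fraction_sign(3)[OF d0 _ 1] by auto
    have Bik: "\<bar>B $ i $ k\<bar> = aff_form (v $ i) (v $ k)" using B1 pos by simp
    have "aff_form (v $ a) (v $ b) \<noteq> 0" if "a \<noteq> b" for a b
      using un[of a] un[of b] that neg pos sym by auto
    from par[OF this] have pr: "even (card {(a, b). a < b \<and> aff_form (v $ a) (v $ b) > 0}) \<longleftrightarrow> acyclic_matrix B" .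
    have "aff_form (v $ a) (v $ b) > 0 \<longleftrightarrow> (a = i \<and> b = k) \<or> (a = k \<and> b = i)" if "a \<noteq> b" for a b
      using un[of a] un[of b] that neg pos sym ne by auto
    then have "{(a, b). a < b \<and> aff_form (v $ a) (v $ b) > 0} = {(if i < k then i else k, if i < k then k else i)}"
      using ne by (auto simp: not_less le_less split: if_splits)
    then have "\<not> acyclic_matrix B" using pr by simp
    then have cyc: "(B $ i $ j > 0 \<and> B $ j $ k > 0 \<and> B $ k $ i > 0) \<or> (B $ j $ i > 0 \<and> B $ k $ j > 0 \<and> B $ i $ k > 0)"
      using noncyclic_acyclic[OF skew ne] nz Bik pos by fastforce
    then show ?thesis
    proof
      assume "B $ i $ j > 0 \<and> B $ j $ k > 0 \<and> B $ k $ i > 0"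
      then have "ordered_triple v B d i j k x y w" unfolding OT using g lt B1 Bik sk by auto
      then show ?thesis by blast
    next
      assume "B $ j $ i > 0 \<and> B $ k $ j > 0 \<and> B $ i $ k > 0"
      then have "ordered_triple v B d k j i y x w" unfolding OT using rev lt B1 Bik sk sym by auto
      then show ?thesis by blast
    qed
  next
    case 2
    have z: "aff_form (v $ i) (v $ k) = 0" using G cos_pi_fraction_sign(2)[OF d0 _ 2] by auto
    have Bik: "B $ i $ k = 0" using B1 z by simp
    consider "B $ i $ j > 0" "B $ j $ k > 0" | "B $ i $ j < 0" "B $ j $ k < 0" | "B $ i $ j < 0" "B $ j $ k > 0" | "B $ i $ j > 0" "B $ j $ k < 0"
      using nz by linarith
    then show ?thesis
    proof cases
      case 1
      then have "ordered_triple v B d i j k x y w" unfolding OT using g lt B1 Bik z by auto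
      then show ?thesis by blast
    next
      case 2
      then have "ordered_triple v B d k j i y x w" unfolding OT using rev lt B1 Bik z sk sym by auto
      then show ?thesis by blast
    next
      case 3
      then have "ordered_triple v B d j i k x w y"
        unfolding OT using gram_triple_swap(1)[OF g] lt B1 Bik z sk sym \<open>2 * w = d\<close> by auto
      then show ?thesis by blast
    next
      case 4
      then have "ordered_triple v B d i k j w y x"
        unfolding OT using gram_triple_swap(2)[OF g] lt B1 Bik z sk sym \<open>2 * w = d\<close> by auto
      then show ?thesis by blast
    qed
  next
    case 3
    note w3 = 3
    have neg3: "aff_form (v $ i) (v $ k) < 0" using G cos_pi_fraction_sign(1)[OF d0 _ 3] by auto
    have Bik: "\<bar>B $ i $ k\<bar> = - aff_form (v $ i) (v $ k)" "B $ i $ k \<noteq> 0" using B1 neg3 by auto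
    have all: "aff_form (v $ a) (v $ b) < 0" if "a \<noteq> b" for a b
      using un[of a] un[of b] that neg neg3 sym by auto
    have "{(a, b). a < b \<and> aff_form (v $ a) (v $ b) > 0} = {}" using all by (fastforce dest: less_imp_neq)
    then have ac: "acyclic_matrix B" using par all by (metis card.empty even_zero less_irrefl)
    have nc: "\<not> (B $ i $ j > 0 \<and> B $ j $ k > 0 \<and> B $ k $ i > 0)" "\<not> (B $ j $ i > 0 \<and> B $ k $ j > 0 \<and> B $ i $ k > 0)"
      using ac cyclic_not_acyclic[of B i j k] cyclic_not_acyclic[of B i k j] by blast+
    have g1: "gram_triple v d j i k x w y" "gram_triple v d i k j w y x" by (rule gram_triple_swap[OF g])+
    have g2: "gram_triple v d j k i y w x" "gram_triple v d k i j w x y"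
      using gram_triple_swap(2)[OF g1(1)] gram_triple_swap(1)[OF g1(2)] .
    consider "B $ i $ j > 0" "B $ j $ k > 0" "B $ i $ k > 0" | "B $ i $ j < 0" "B $ j $ k < 0" "B $ i $ k < 0" | "B $ i $ j < 0" "B $ j $ k > 0" "B $ i $ k > 0" | "B $ i $ j < 0" "B $ j $ k > 0" "B $ i $ k < 0" | "B $ i $ j > 0" "B $ j $ k < 0" "B $ i $ k > 0" | "B $ i $ j > 0" "B $ j $ k < 0" "B $ i $ k < 0"
      using nz Bik(2) nc unfolding sk by linarith
    then show ?thesis
    proof cases
      case 1
      then have "ordered_triple v B d i j k x y w" unfolding OT using g lt w3 B1 Bik sk sym by auto
      then show ?thesis by blast
    next
      case 2
      then have "ordered_triple v B d k j i y x w" unfolding OT using rev lt w3 B1 Bik sk sym by auto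
      then show ?thesis by blast
    next
      case 3
      then have "ordered_triple v B d j i k x w y" unfolding OT using g1(1) lt w3 B1 Bik sk sym by auto
      then show ?thesis by blast
    next
      case 4
      then have "ordered_triple v B d j k i y w x" unfolding OT using g2(1) lt w3 B1 Bik sk sym by auto
      then show ?thesis by blast
    next
      case 5
      then have "ordered_triple v B d i k j w y x" unfolding OT using g1(2) lt w3 B1 Bik sk sym by auto
      then show ?thesis by blast
    next
      case 6
      then have "ordered_triple v B d k i j w x y" unfolding OT using g2(2) lt w3 B1 Bik sk sym by auto
      then show ?thesis by blast
    qed
  qed
qed

lemma geometric_realisation_norm:
  "geometric_realisation v B \<Longrightarrow> aff_form (v $ i) (v $ i) = 2"
  unfolding geometric_realisation_def by (elim conjE) (rule spec)

theorem theoremB: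
  fixes v :: "aff^3" and B :: "real^3^3" and u :: reference_point
    and r1 r2 r3 :: rat and d :: nat
  assumes "exchange_matrix B" and "mutation_finite B" and "mutation_acyclic B"
    and "geometric_realisation v B"
    and "is_triangle_with_angles (seed_domain (v, B))
           (of_rat r1 * pi) (of_rat r2 * pi) (of_rat r3 * pi)"
    and "d = least_common_denominator {r1, r2, r3}"
    and "valid_reference_point u"
    and "\<forall>s \<in> mutation_orbit u (v, B). mutable u s \<and> compatible u s"
    and "\<forall>s \<in> mutation_orbit u (v, B). is_triangle (seed_domain s) \<or> is_half_strip (seed_domain s)"
  shows "\<exists>L n. lattice_of_rank L n \<and>
           acts_on_exchange_graph L u (v, B) \<and>
           finite (vertex_orbits L u (v, B)) \<and>
           finite (edge_orbits L u (v, B)) \<and>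
           (real n = real (totient d) / 2 \<or> n = totient d)"
proof -
  have norm: "aff_form (v $ i) (v $ i) = 2" for i
    by (rule geometric_realisation_norm[OF assms(4)])
  have norm': "aff_form (fst (v, B) $ i) (fst (v, B) $ i) = 2" for i using norm by simp
  obtain i j k where ijk: "i \<noteq> j" "i \<noteq> k" "j \<noteq> k"
    and gram: "aff_form (v $ j) (v $ k) = - 2 * cos (of_rat r1 * pi)"
      "aff_form (v $ k) (v $ i) = - 2 * cos (of_rat r2 * pi)"
      "aff_form (v $ i) (v $ j) = - 2 * cos (of_rat r3 * pi)"
    and pos: "0 < of_rat r1 * pi" "0 < of_rat r2 * pi" "0 < of_rat r3 * pi"
    and sum: "of_rat r1 * pi + of_rat r2 * pi + of_rat r3 * pi = pi"
    and P: "\<exists>P. aff_val (v $ i) P < 0 \<and> aff_val (v $ j) P = 0 \<and> aff_val (v $ k) P = 0"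
    by (rule triangle_gram[OF assms(5) norm', unfolded fst_conv])
  have last_position: "0 < r1" "0 < r2" "0 < r3" using pos by (simp_all add: zero_less_mult_iff)
  have "(of_rat r1 + of_rat r2 + of_rat r3) * pi = 1 * pi" using sum by (simp add: algebra_simps)
  then have "of_rat (r1 + r2 + r3) = (1 :: real)" by (simp add: of_rat_add)
  then have rsum: "r1 + r2 + r3 = 1" by simp
  obtain x0 y0 w0 where num: "of_rat r1 * pi = pi * real x0 / real d" "of_rat r2 * pi = pi * real y0 / real d" "of_rat r3 * pi = pi * real w0 / real d"
    "0 < x0" "0 < y0" "0 < w0" "x0 + y0 + w0 = d" "d \<ge> 3" "coprime (gcd x0 y0) d"
    by (rule triangle_angle_numerators[OF assms(6) last_position rsum])
  have "gram_triple v d j k i x0 y0 w0"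
    unfolding gram_triple_def using ijk gram num aff_form_commute[of "v $ j" "v $ i"] by auto
  then obtain a b c x y w where o: "ordered_triple v B d a b c x y w"
    using ordered_triple_exists[OF assms(1,4) _ num(8)] by blast
  note G = o[unfolded ordered_triple_def gram_triple_def]
  have w: "d - x - y = w" using G by linarith
  obtain P where P: "aff_val (v $ i) P < 0" "aff_val (v $ j) P = 0" "aff_val (v $ k) P = 0" using P by blast
  have un: "l = i \<or> l = j \<or> l = k" for l using ijk exhaust_3[of l] exhaust_3[of i] exhaust_3[of j] exhaust_3[of k] by auto
  have le: "aff_val (v $ l) P \<le> 0" for l using un[of l] P by auto
  have abc: "a \<noteq> b" "a \<noteq> c" "b \<noteq> c" using G by auto
  have "i = a \<or> i = b \<or> i = c" using abc exhaust_3[of i] exhaust_3[of a] exhaust_3[of b] exhaust_3[of c] by auto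
  then have lt: "aff_val (v $ a) P < 0 \<or> aff_val (v $ b) P < 0 \<or> aff_val (v $ c) P < 0" using P(1) by auto
  have xy: "0 < x" "0 < y" "x + y < d" "2 * x \<le> d" "2 * y \<le> d" "coprime (gcd x y) d" using G by auto
  have forms: "aff_form (v $ a) (v $ b) = - 2 * cos (pi * real x / real d)" "aff_form (v $ b) (v $ c) = - 2 * cos (pi * real y / real d)"
    "aff_form (v $ a) (v $ c) = - 2 * cos (pi * real (d - x - y) / real d)" unfolding w using G by blast+
  have "\<exists>e n z0 \<Delta>. affine_frame e n d \<and> affine_frame.formatted e n z0 \<Delta> d 1 x y (v $ a) (v $ b) (v $ c) \<and> \<Delta> \<noteq> 0"
    by (rule frame_exists[OF num(8) xy norm norm norm forms le le le lt])
  then obtain e n z0 \<Delta> where fr: "affine_frame e n d" and fm: "affine_frame.formatted e n z0 \<Delta> d 1 x y (v $ a) (v $ b) (v $ c)" and \<Delta>: "\<Delta> \<noteq> 0"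
    by (elim exE conjE)
  interpret A: affine_frame e n z0 \<Delta> d by (rule fr)
  note skew = exchange_matrix_skew[OF assms(1)]
  have diag: "B $ l $ l = 0" for l using skew[of l l] by simp
  have t: "relabel (perm3 a b c) (v, B) = triple_seed (v $ a) (v $ b) (v $ c)"
    by (rule seed3_eqI) (use G diag skew[of b a] skew[of c b] skew[of c a] in \<open>simp_all add: perm3_def\<close>)
  have bij: "bij (perm3 a b c)" by (rule bij_perm3[OF abc])
  have "perm3 a b c \<circ> inv (perm3 a b c) = (\<lambda>i. i)" using bij by (auto simp: fun_eq_iff surj_f_inv_f bij_is_surj)
  then have vB: "(v, B) = relabel (inv (perm3 a b c)) (triple_seed (v $ a) (v $ b) (v $ c))"
    unfolding t[symmetric] relabel_relabel by (simp add: relabel_id)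
  interpret F: formatted_orbit e n z0 \<Delta> d u "(v, B)"
  proof unfold_locales
    show "mutable u s" if "s \<in> mutation_orbit u (v, B)" for s using assms(8) that by blast
    show "in_no_cone s" if "s \<in> mutation_orbit u (v, B)" for s
      using assms(9) that in_no_cone_triangle in_no_cone_half_strip by blast
    show "\<exists>\<sigma> \<epsilon> x y p q r. bij \<sigma> \<and> (v, B) = relabel \<sigma> (triple_seed p q r) \<and> A.formatted \<epsilon> x y p q r"
      using bij_imp_bij_inv[OF bij] vB fm by blast
    show "\<Delta> \<noteq> 0" by (rule \<Delta>)
  qed
  show ?thesis using F.lattice_of_translations by blast
qed

end
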